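(* Let $\pmb k$ be a field, $B$ be the standard graded polynomial ring $\pmb k[x,y]$, and $c$ be a positive integer. Then the projective resolution $\mathbb{UPR}_{\mathbb Z}$ defined in the context is a universal projective resolution for the graded Betti numbers $$0\to B(-3c)^2\to B(-2c)^3\to B\to B/I\to0.$$ That is, whenever $I$ is a homogeneous ideal of $B$ such that $B/I$ has a minimal homogeneous resolution with the displayed graded Betti numbers, there exists a ring homomorphism $(\pmb R_{\mathbb Z})_{w_{\mathbb Z}}\to\pmb k$ such that $\mathbb{UPR}_{\mathbb Z}\otimes_{(\pmb R_{\mathbb Z})_{w_{\mathbb Z}}}\pmb k$ is a minimal homogeneous resolution of $B/I$ over $B$.
   Context: Put $d=2c$. Let $\pmb z=(z_{i,j})$, $0\le i\le d$, $1\le j\le3$, be indeterminates, $\pmb R_{\mathbb Z}=\mathbb Z[\pmb z]$ and $\pmb S_{\mathbb Z}=\mathbb Z[x,y,\pmb z]=\pmb R_{\mathbb Z}[x,y]$, bigraded with $\deg x=\deg y=(1,0)$, $\deg z_{i,j}=(0,1)$. Given a homomorphism $(\pmb R_{\mathbb Z})_{w_{\mathbb Z}}\to\pmb k$, one identifies $(\pmb S_{\mathbb Z})_{w_{\mathbb Z}}\otimes_{(\pmb R_{\mathbb Z})_{w_{\mathbb Z}}}\pmb k=\pmb k[x,y]=B$. Let $G_j=\sum_{i=0}^dz_{i,j}x^iy^{d-i}$ for $1\le j\le3$, and $\pmb d_{1,\mathbb Z}=[G_1,G_2,G_3]$. For a positive integer or zero $i$, let $A^{(i)}_{\mathbb Z}=[A_1|A_2|A_3]$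 be the $(d+i+1)\times3(i+1)$ matrix where the block $A_j$ has rows indexed by $r=0,\dots,d+i$, columns indexed by $k=0,\dots,i$, and $(r,k)$ entry $z_{r-k,j}$ (zero unless $0\le r-k\le d$). Let $w_{\mathbb Z}=\det A^{(c-1)}_{\mathbb Z}$ (a $3c\times3c$ determinant). Expanding this determinant across the first row, write $w_{\mathbb Z}=z_{0,1}Z_1+z_{0,2}Z_2+z_{0,3}Z_3$, where $Z_1,Z_2,Z_3$ are the corresponding cofactors (signed minors). The subscript $w_{\mathbb Z}$ on a ring denotes localization at the powers of $w_{\mathbb Z}$. Let $A=A^{(c)}_{\mathbb Z}$, a $(3c+1)\times(3c+3)$ matrix with columns numbered $1,\dots,3c+3$, and for $i<m$ let $A(i,m)$ be the determinant of $A$ with columns $i$ and $m$ deleted. For $i\in\{1,c+2,2c+3\}$ let $\pmb b^{(i)}$ be the column vector with entries $b^{(i)}_m=(-1)^{m+1}A(m,i)$ for $m<i$, $b^{(i)}_i=0$, $b^{(i)}_m=(-1)^mA(i,m)$ for $m>i$. Let $\rho^{(c)}=[y^c,xy^{c-1},\dots,x^c]$, let $N^{(c)}$ be the $3\times3(c+1)$ block diagonal matrix with three diagonal blocks $\rho^{(c)}$, and put $\pmb d_{2,\mathbb Z}=[N^{(c)}\pmb b^{(1)},N^{(c)}\pmb b^{(c+2)},N^{(c)}\pmb b^{(2c+3)}]$, a $3\times3$ matrix. Let $\pmb d_{3,\mathbb Z}=[z_{0,1},(-1)^{c+1}z_{0,2},z_{0,3}]^{\rm T}$. These form a complex $0\to\pmb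 S_{\mathbb Z}(-3c,-3c-3)\xrightarrow{\pmb d_{3,\mathbb Z}}\pmb S_{\mathbb Z}(-3c,-3c-2)^3\xrightarrow{\pmb d_{2,\mathbb Z}}\pmb S_{\mathbb Z}(-2c,-1)^3\xrightarrow{\pmb d_{1,\mathbb Z}}\pmb S_{\mathbb Z}$. Let $\sigma_{\mathbb Z}:(\pmb S_{\mathbb Z})_{w_{\mathbb Z}}^3\to(\pmb S_{\mathbb Z})_{w_{\mathbb Z}}$ be the splitting $\frac1{w_{\mathbb Z}}[Z_1,(-1)^{c+1}Z_2,Z_3]$ of $\pmb d_{3,\mathbb Z}$ (so $\sigma_{\mathbb Z}\circ\pmb d_{3,\mathbb Z}=1$). Then $$\mathbb{UPR}_{\mathbb Z}:\quad0\to\ker\sigma_{\mathbb Z}\xrightarrow{\pmb d_{2,\mathbb Z}|_{\ker\sigma_{\mathbb Z}}}(\pmb S_{\mathbb Z})_{w_{\mathbb Z}}^3\xrightarrow{\pmb d_{1,\mathbb Z}}(\pmb S_{\mathbb Z})_{w_{\mathbb Z}},$$ with the gradings inherited from the complex $0\to\pmb S_{\mathbb Z}(-3c,-3c-3)\xrightarrow{\pmb d_{3,\mathbb Z}}\pmb S_{\mathbb Z}(-3c,-3c-2)^3\xrightarrow{\pmb d_{2,\mathbb Z}}\pmb S_{\mathbb Z}(-2c,-1)^3\xrightarrow{\pmb d_{1,\mathbb Z}}\pmb S_{\mathbb Z}$; $\ker\sigma_{\mathbb Z}$ is a projective $(\pmb S_{\mathbb Z})_{w_{\mathbb Z}}$-module,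 a direct summand of $(\pmb S_{\mathbb Z})_{w_{\mathbb Z}}^3$. *)

theory Defs
  imports
    "HOL-Library.Poly_Mapping"
    "HOL-Library.Product_Plus"
    "HOL-Library.Product_Lexorder"
    "HOL-Computational_Algebra.Polynomial_Factorial"
    "HOL-Algebra.QuotRing"
    "HOL-Algebra.Generated_Groups"
    "HOL-Algebra.Free_Abelian_Groups"
    "Jordan_Normal_Form.Determinant"
begin

section \<open>Graded modules\<close>

text \<open>The fields \<open>mult\<close> and \<open>one\<close> that a module record inherits carry no information.\<close>

record ('a, 'b, 'g) graded_module = "('a, 'b) module" +
  deg_part :: "'g \<Rightarrow> 'b set"

text \<open>A subset of a ring type, viewed as a ring.\<close>

definition ring_on :: "'r::comm_ring_1 set \<Rightarrow> 'r ring" where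
  "ring_on K = \<lparr>carrier = K, monoid.mult = (*), monoid.one = 1, ring.zero = 0, ring.add = (+)\<rparr>"

text \<open>For a ring \<open>K\<close> whose degree \<open>g\<close> part is \<open>H g\<close>: the graded free module
  \<open>K(-a\<^sub>1) \<oplus> \<dots> \<oplus> K(-a\<^sub>n)\<close>, where \<open>[a\<^sub>1, \<dots>, a\<^sub>n]\<close> is the list \<open>ds\<close>.\<close>

definition gr_free ::
    "'r::comm_ring_1 set \<Rightarrow> ('g::ab_group_add \<Rightarrow> 'r set) \<Rightarrow> 'g list \<Rightarrow> ('r, 'r vec, 'g) graded_module" where
  "gr_free K H ds =
    \<lparr>carrier = {v \<in> carrier_vec (length ds). \<forall>i<length ds. v $ i \<in> K},
     monoid.mult = undefined, monoid.one = undefined,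
     ring.zero = 0\<^sub>v (length ds), ring.add = (+), module.smult = (\<cdot>\<^sub>v),
     deg_part = (\<lambda>g. {v \<in> carrier_vec (length ds). \<forall>i<length ds. v $ i \<in> H (g - ds ! i)})\<rparr>"

definition graded_hom ::
    "'r ring \<Rightarrow> ('r, 'm, 'g) graded_module \<Rightarrow> ('r, 'n, 'g) graded_module \<Rightarrow> ('m \<Rightarrow> 'n) set" where
  "graded_hom R M N = {f \<in> carrier M \<rightarrow> carrier N.
     (\<forall>u\<in>carrier M. \<forall>v\<in>carrier M. f (u \<oplus>\<^bsub>M\<^esub> v) = f u \<oplus>\<^bsub>N\<^esub> f v) \<and>
     (\<forall>r\<in>carrier R. \<forall>v\<in>carrier M. f (r \<odot>\<^bsub>M\<^esub> v) = r \<odot>\<^bsub>N\<^esub> f v) \<and>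
     (\<forall>g. f ` deg_part M g \<subseteq> deg_part N g)}"

definition graded_iso ::
    "'r ring \<Rightarrow> ('r, 'm, 'g) graded_module \<Rightarrow> ('r, 'n, 'g) graded_module \<Rightarrow> ('m \<Rightarrow> 'n) \<Rightarrow> bool" where
  "graded_iso R M N f \<longleftrightarrow> f \<in> graded_hom R M N \<and> bij_betw f (carrier M) (carrier N) \<and>
     (\<forall>g. f ` deg_part M g = deg_part N g)"

definition graded_free ::
    "'r::comm_ring_1 set \<Rightarrow> ('g::ab_group_add \<Rightarrow> 'r set) \<Rightarrow> ('r, 'm, 'g) graded_module \<Rightarrow> bool" where
  "graded_free K H M \<longleftrightarrow> module (ring_on K) M \<and>
     (\<exists>ds f. graded_iso (ring_on K) (gr_free K H ds) M f)"

text \<open>A finitely generated projective module is a direct summand of some \<open>K\<^sup>n\<close>;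
  the summand is required to be compatible with the gradings.\<close>

definition graded_projective ::
    "'r::comm_ring_1 set \<Rightarrow> ('g::ab_group_add \<Rightarrow> 'r set) \<Rightarrow> ('r, 'm, 'g) graded_module \<Rightarrow> bool" where
  "graded_projective K H M \<longleftrightarrow> module (ring_on K) M \<and>
     (\<exists>ds. \<exists>f \<in> graded_hom (ring_on K) M (gr_free K H ds).
           \<exists>p \<in> graded_hom (ring_on K) (gr_free K H ds) M. \<forall>v\<in>carrier M. p (f v) = v)"

text \<open>\<open>0 \<rightarrow> F2 \<rightarrow> F1 \<rightarrow> F0\<close> is an exact sequence of homogeneous homomorphisms.\<close>

definition acyclic_complex ::
    "'r ring \<Rightarrow> ('r, 'm2, 'g) graded_module \<Rightarrow> ('m2 \<Rightarrow> 'm1) \<Rightarrow> ('r, 'm1, 'g) graded_module \<Rightarrow>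
     ('m1 \<Rightarrow> 'm0) \<Rightarrow> ('r, 'm0, 'g) graded_module \<Rightarrow> bool" where
  "acyclic_complex R F2 d2 F1 d1 F0 \<longleftrightarrow>
     d2 \<in> graded_hom R F2 F1 \<and> d1 \<in> graded_hom R F1 F0 \<and>
     inj_on d2 (carrier F2) \<and>
     d2 ` carrier F2 = {v \<in> carrier F1. d1 v = \<zero>\<^bsub>F0\<^esub>}"

definition projective_resolution ::
    "'r::comm_ring_1 set \<Rightarrow> ('g::ab_group_add \<Rightarrow> 'r set) \<Rightarrow>
     ('r, 'm2, 'g) graded_module \<Rightarrow> ('m2 \<Rightarrow> 'm1) \<Rightarrow> ('r, 'm1, 'g) graded_module \<Rightarrow>
     ('m1 \<Rightarrow> 'm0) \<Rightarrow> ('r, 'm0, 'g) graded_module \<Rightarrow> bool" where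
  "projective_resolution K H F2 d2 F1 d1 F0 \<longleftrightarrow>
     graded_projective K H F2 \<and> graded_projective K H F1 \<and> graded_projective K H F0 \<and>
     acyclic_complex (ring_on K) F2 d2 F1 d1 F0"


section \<open>The polynomial ring in \<open>x\<close>, \<open>y\<close>\<close>

text \<open>\<open>A[x,y]\<close>; the exponent \<open>(i, j)\<close> stands for the monomial \<open>x\<^sup>i y\<^sup>j\<close>.
  For a field \<open>k\<close> the whole type \<open>k bipoly\<close> is the ring \<open>B\<close>.\<close>

type_synonym 'a bipoly = "(nat \<times> nat) \<Rightarrow>\<^sub>0 'a"

definition xy_monom :: "nat \<Rightarrow> nat \<Rightarrow> 'a::comm_ring_1 \<Rightarrow> 'a bipoly" where
  "xy_monom i j a = Poly_Mapping.single (i, j) a"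

definition xy_const :: "'a::comm_ring_1 \<Rightarrow> 'a bipoly" where
  "xy_const a = xy_monom 0 0 a"

definition B_deg :: "int \<Rightarrow> 'k::field bipoly set" where
  "B_deg n = {p. \<forall>(i, j)\<in>Poly_Mapping.keys p. int (i + j) = n}"

definition B_irrel :: "'k::field bipoly set" where
  "B_irrel = Idl\<^bsub>ring_on UNIV\<^esub> {xy_monom 1 0 1, xy_monom 0 1 1}"

definition ideal_times :: "'r set \<Rightarrow> ('r, 'm, 'g) graded_module \<Rightarrow> 'm set" where
  "ideal_times J M = generate (add_monoid M) {r \<odot>\<^bsub>M\<^esub> v | r v. r \<in> J \<and> v \<in> carrier M}"

definition homogeneous_ideal :: "'k::field bipoly set \<Rightarrow> bool" where
  "homogeneous_ideal I \<longleftrightarrow> ideal I (ring_on UNIV) \<and>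
     I = Idl\<^bsub>ring_on UNIV\<^esub> {f \<in> I. \<exists>n. f \<in> B_deg n}"

text \<open>The graded \<open>B\<close>-module \<open>B/I\<close>.\<close>

definition B_quot :: "'k::field bipoly set \<Rightarrow> ('k bipoly, 'k bipoly set, int) graded_module" where
  "B_quot I = (let Q = ring_on UNIV Quot I in
    \<lparr>carrier = carrier Q, monoid.mult = monoid.mult Q, monoid.one = \<one>\<^bsub>Q\<^esub>, ring.zero = \<zero>\<^bsub>Q\<^esub>, ring.add = ring.add Q,
     module.smult = (\<lambda>b C. (I +>\<^bsub>ring_on UNIV\<^esub> b) \<otimes>\<^bsub>Q\<^esub> C),
     deg_part = (\<lambda>n. (\<lambda>b. I +>\<^bsub>ring_on UNIV\<^esub> b) ` B_deg n)\<rparr>)"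

text \<open>\<open>0 \<rightarrow> F2 \<rightarrow> F1 \<rightarrow> F0\<close> is a minimal homogeneous resolution of \<open>N\<close> over \<open>B\<close>.\<close>

definition minimal_resolution ::
    "('k::field bipoly, 'm2, int) graded_module \<Rightarrow> ('m2 \<Rightarrow> 'm1) \<Rightarrow>
     ('k bipoly, 'm1, int) graded_module \<Rightarrow> ('m1 \<Rightarrow> 'm0) \<Rightarrow>
     ('k bipoly, 'm0, int) graded_module \<Rightarrow> ('k bipoly, 'n, int) graded_module \<Rightarrow> bool" where
  "minimal_resolution F2 d2 F1 d1 F0 N \<longleftrightarrow>
     graded_free UNIV B_deg F2 \<and> graded_free UNIV B_deg F1 \<and> graded_free UNIV B_deg F0 \<and>
     acyclic_complex (ring_on UNIV) F2 d2 F1 d1 F0 \<and>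
     (\<exists>\<epsilon> \<in> graded_hom (ring_on UNIV) F0 N.
        \<epsilon> ` carrier F0 = carrier N \<and>
        d1 ` carrier F1 = {v \<in> carrier F0. \<epsilon> v = \<zero>\<^bsub>N\<^esub>}) \<and>
     d2 ` carrier F2 \<subseteq> ideal_times B_irrel F1 \<and>
     d1 ` carrier F1 \<subseteq> ideal_times B_irrel F0"

text \<open>\<open>B/I\<close> has a minimal homogeneous resolution
  \<open>0 \<rightarrow> \<Oplus>\<^sub>i B(-a\<^sub>i) \<rightarrow> \<Oplus>\<^sub>i B(-b\<^sub>i) \<rightarrow> B \<rightarrow> B/I \<rightarrow> 0\<close>.\<close>

definition has_graded_betti :: "int list \<Rightarrow> int list \<Rightarrow> 'k::field bipoly set \<Rightarrow> bool" where
  "has_graded_betti as bs I \<longleftrightarrow>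
     (\<exists>d2 d1. minimal_resolution (gr_free UNIV B_deg as) d2 (gr_free UNIV B_deg bs) d1
                (gr_free UNIV B_deg [0]) (B_quot I))"


section \<open>The rings \<open>R\<close> and \<open>S\<close> over the integers and their localizations\<close>

text \<open>Integer polynomials in variables \<open>z\<^bsub>i,j\<^esub>\<close> for all \<open>i, j\<close>; the rings for a given \<open>c\<close> are
  the subrings in which only \<open>i \<le> 2c\<close>, \<open>1 \<le> j \<le> 3\<close> occur. The order on pairs is imported only
  in order that this type is an integral domain.\<close>

type_synonym zpoly = "((nat \<times> nat) \<Rightarrow>\<^sub>0 nat) \<Rightarrow>\<^sub>0 int"

definition zvar :: "nat \<Rightarrow> nat \<Rightarrow> zpoly" where
  "zvar i j = Poly_Mapping.single (Poly_Mapping.single (i, j) 1) 1"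

definition R_Z :: "nat \<Rightarrow> zpoly set" where
  "R_Z c = {p. \<forall>t\<in>Poly_Mapping.keys p. Poly_Mapping.keys t \<subseteq> {0..2 * c} \<times> {1..3}}"

definition S_Z :: "nat \<Rightarrow> zpoly bipoly set" where
  "S_Z c = {p. \<forall>e. Poly_Mapping.lookup p e \<in> R_Z c}"

definition S_Z_deg :: "nat \<Rightarrow> int \<times> int \<Rightarrow> zpoly bipoly set" where
  "S_Z_deg c g = {p \<in> S_Z c. \<forall>(i, j)\<in>Poly_Mapping.keys p. int (i + j) = fst g \<and>
      (\<forall>t\<in>Poly_Mapping.keys (Poly_Mapping.lookup p (i, j)).
         int (\<Sum>v\<in>Poly_Mapping.keys t. Poly_Mapping.lookup t v) = snd g)}"

text \<open>The matrix \<open>A\<^sup>(\<^sup>i\<^sup>)\<close>. Its column with (0-based) index \<open>q = (i + 1) * l + k\<close>, \<open>k \<le> i\<close>, is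
  column \<open>k\<close> of the block \<open>A\<^bsub>l+1\<^esub>\<close>.\<close>

definition A_mat :: "nat \<Rightarrow> nat \<Rightarrow> zpoly mat" where
  "A_mat c i = mat (2 * c + i + 1) (3 * (i + 1)) (\<lambda>(r, q).
     let j = q div (i + 1) + 1; k = q mod (i + 1)
     in if k \<le> r \<and> r - k \<le> 2 * c then zvar (r - k) j else 0)"

definition w_Z :: "nat \<Rightarrow> zpoly" where
  "w_Z c = det (A_mat c (c - 1))"

text \<open>\<open>Z\<^sub>j\<close> is the cofactor of the entry \<open>z\<^bsub>0,j\<^esub>\<close> of the first row of \<open>A\<^sup>(\<^sup>c\<^sup>-\<^sup>1\<^sup>)\<close>.\<close>

definition Z_cof :: "nat \<Rightarrow> nat \<Rightarrow> zpoly" where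
  "Z_cof c j = cofactor (A_mat c (c - 1)) 0 ((j - 1) * c)"

text \<open>Both localizations at \<open>w\<close> are realized inside \<open>Q[x,y]\<close>, with \<open>Q\<close> the field of
  fractions of the integral domain \<open>zpoly\<close>.\<close>

type_synonym zfrac = "zpoly fract"

definition R_w :: "nat \<Rightarrow> zfrac set" where
  "R_w c = {Fract a (w_Z c ^ n) | a n. a \<in> R_Z c}"

definition S_emb :: "zpoly bipoly \<Rightarrow> zfrac bipoly" where
  "S_emb p = Poly_Mapping.map to_fract p"

definition S_frac :: "nat \<Rightarrow> zpoly bipoly \<Rightarrow> nat \<Rightarrow> zfrac bipoly" where
  "S_frac c p n = xy_const (Fract 1 (w_Z c ^ n)) * S_emb p"

definition S_w :: "nat \<Rightarrow> zfrac bipoly set" where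
  "S_w c = {S_frac c p n | p n. p \<in> S_Z c}"

text \<open>The element \<open>w\<close> is homogeneous of bidegree \<open>(0, 3c)\<close>.\<close>

definition S_w_deg :: "nat \<Rightarrow> int \<times> int \<Rightarrow> zfrac bipoly set" where
  "S_w_deg c g = {S_frac c p n | p n. p \<in> S_Z_deg c (g + (0, int (3 * c * n)))}"


section \<open>The complex \<open>UPR\<close>\<close>

definition G_Z :: "nat \<Rightarrow> nat \<Rightarrow> zpoly bipoly" where
  "G_Z c j = (\<Sum>i=0..2 * c. xy_monom i (2 * c - i) (zvar i j))"

definition d1_Z :: "nat \<Rightarrow> zpoly bipoly mat" where
  "d1_Z c = mat_of_rows_list 3 [[G_Z c 1, G_Z c 2, G_Z c 3]]"

text \<open>\<open>A(i,m)\<close>, with 1-based column numbers \<open>i\<close>, \<open>m\<close>.\<close>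

definition A_minor :: "nat \<Rightarrow> nat \<Rightarrow> nat \<Rightarrow> zpoly" where
  "A_minor c i m = det (mat_of_cols (3 * c + 1)
     [col (A_mat c c) (q - 1). q \<leftarrow> [1..<3 * c + 4], q \<noteq> i \<and> q \<noteq> m])"

text \<open>\<open>b\<^sup>(\<^sup>i\<^sup>)\<close>; the entry numbered \<open>m\<close> from 1 has index \<open>m - 1\<close>.\<close>

definition b_vec :: "nat \<Rightarrow> nat \<Rightarrow> zpoly vec" where
  "b_vec c i = vec (3 * c + 3) (\<lambda>q. let m = q + 1 in
     if m < i then (-1) ^ (m + 1) * A_minor c m i
     else if m = i then 0
     else (-1) ^ m * A_minor c i m)"

definition N_mat :: "nat \<Rightarrow> zpoly bipoly mat" where
  "N_mat c = mat 3 (3 * (c + 1)) (\<lambda>(j, q).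
     let k = q mod (c + 1) in if q div (c + 1) = j then xy_monom k (c - k) 1 else 0)"

definition d2_Z :: "nat \<Rightarrow> zpoly bipoly mat" where
  "d2_Z c = mat_of_cols 3
     [N_mat c *\<^sub>v map_vec xy_const (b_vec c i). i \<leftarrow> [1, c + 2, 2 * c + 3]]"

definition sigma_Z :: "nat \<Rightarrow> zfrac bipoly mat" where
  "sigma_Z c = mat_of_rows_list 3
     [[S_frac c (xy_const (Z_cof c 1)) 1,
       S_frac c (xy_const ((-1) ^ (c + 1) * Z_cof c 2)) 1,
       S_frac c (xy_const (Z_cof c 3)) 1]]"

text \<open>The modules of the complex, with shifts as in
  \<open>S(-3c,-3c-2)\<^sup>3 \<rightarrow> S(-2c,-1)\<^sup>3 \<rightarrow> S\<close>. The ring \<open>S\<close> in homological degree 0 appears as the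
  module of vectors of length 1.\<close>

definition UPR0 :: "nat \<Rightarrow> (zfrac bipoly, zfrac bipoly vec, int \<times> int) graded_module" where
  "UPR0 c = gr_free (S_w c) (S_w_deg c) [(0, 0)]"

definition UPR1 :: "nat \<Rightarrow> (zfrac bipoly, zfrac bipoly vec, int \<times> int) graded_module" where
  "UPR1 c = gr_free (S_w c) (S_w_deg c) (replicate 3 (2 * int c, 1))"

definition UPR2 :: "nat \<Rightarrow> (zfrac bipoly, zfrac bipoly vec, int \<times> int) graded_module" where
  "UPR2 c = (let F = gr_free (S_w c) (S_w_deg c) (replicate 3 (3 * int c, 3 * int c + 2));
                 K = {v. sigma_Z c *\<^sub>v v = 0\<^sub>v 1}
             in F\<lparr>carrier := carrier F \<inter> K, deg_part := (\<lambda>g. deg_part F g \<inter> K)\<rparr>)"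

definition UPR_d1 :: "nat \<Rightarrow> zfrac bipoly vec \<Rightarrow> zfrac bipoly vec" where
  "UPR_d1 c v = map_mat S_emb (d1_Z c) *\<^sub>v v"

definition UPR_d2 :: "nat \<Rightarrow> zfrac bipoly vec \<Rightarrow> zfrac bipoly vec" where
  "UPR_d2 c v = map_mat S_emb (d2_Z c) *\<^sub>v v"


section \<open>Tensor products and base change\<close>

text \<open>\<open>M \<otimes>\<^bsub>R\<^esub> N\<close> is the free abelian group on \<open>M \<times> N\<close> modulo the subgroup generated by the
  bilinearity relations.\<close>

definition tensor_free :: "('r, 'm, 'x) module_scheme \<Rightarrow> ('r, 'n, 'y) module_scheme \<Rightarrow>
    (('m \<times> 'n) \<Rightarrow>\<^sub>0 int) monoid" where
  "tensor_free M N = free_Abelian_group (carrier M \<times> carrier N)"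

definition tensor_rel :: "'r ring \<Rightarrow> ('r, 'm, 'x) module_scheme \<Rightarrow> ('r, 'n, 'y) module_scheme \<Rightarrow>
    (('m \<times> 'n) \<Rightarrow>\<^sub>0 int) set" where
  "tensor_rel R M N = generate (tensor_free M N)
    ({frag_of (m \<oplus>\<^bsub>M\<^esub> m', n) - frag_of (m, n) - frag_of (m', n) | m m' n.
        m \<in> carrier M \<and> m' \<in> carrier M \<and> n \<in> carrier N} \<union>
     {frag_of (m, n \<oplus>\<^bsub>N\<^esub> n') - frag_of (m, n) - frag_of (m, n') | m n n'.
        m \<in> carrier M \<and> n \<in> carrier N \<and> n' \<in> carrier N} \<union>
     {frag_of (r \<odot>\<^bsub>M\<^esub> m, n) - frag_of (m, r \<odot>\<^bsub>N\<^esub> n) | r m n.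
        r \<in> carrier R \<and> m \<in> carrier M \<and> n \<in> carrier N})"

definition tensor :: "'r ring \<Rightarrow> ('r, 'm, 'x) module_scheme \<Rightarrow> ('r, 'n, 'y) module_scheme \<Rightarrow>
    (('m \<times> 'n) \<Rightarrow>\<^sub>0 int) set monoid" where
  "tensor R M N = tensor_free M N Mod tensor_rel R M N"

definition tensor_elem :: "'r ring \<Rightarrow> ('r, 'm, 'x) module_scheme \<Rightarrow> ('r, 'n, 'y) module_scheme \<Rightarrow>
    'm \<Rightarrow> 'n \<Rightarrow> (('m \<times> 'n) \<Rightarrow>\<^sub>0 int) set" where
  "tensor_elem R M N m n = tensor_rel R M N #>\<^bsub>tensor_free M N\<^esub> frag_of (m, n)"

text \<open>The map into \<open>M \<otimes> N\<close> induced by a map \<open>\<Phi>\<close> from generators \<open>m' \<otimes> n'\<close> of another tensor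
  product to representatives in the free group on \<open>M \<times> N\<close>. (When the induced map is well-defined,
  the right-hand side is a single coset.)\<close>

definition tensor_induced :: "'r ring \<Rightarrow> ('r, 'm, 'x) module_scheme \<Rightarrow> ('r, 'n, 'y) module_scheme \<Rightarrow>
    ('m1 \<times> 'n1 \<Rightarrow> (('m \<times> 'n) \<Rightarrow>\<^sub>0 int)) \<Rightarrow> (('m1 \<times> 'n1) \<Rightarrow>\<^sub>0 int) set \<Rightarrow> (('m \<times> 'n) \<Rightarrow>\<^sub>0 int) set" where
  "tensor_induced R M N \<Phi> C =
     tensor_rel R M N <#>\<^bsub>tensor_free M N\<^esub> (frag_extend \<Phi> ` C)"

definition restrict_scalars :: "('r \<Rightarrow> 's) \<Rightarrow> ('s, 'm, 'x) module_scheme \<Rightarrow> ('r, 'm) module" where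
  "restrict_scalars h M =
    \<lparr>carrier = carrier M, monoid.mult = monoid.mult M, monoid.one = \<one>\<^bsub>M\<^esub>, ring.zero = \<zero>\<^bsub>M\<^esub>, ring.add = ring.add M,
     module.smult = (\<lambda>r m. h r \<odot>\<^bsub>M\<^esub> m)\<rparr>"

definition field_module :: "('r \<Rightarrow> 'k::field) \<Rightarrow> ('r, 'k) module" where
  "field_module \<phi> =
    \<lparr>carrier = UNIV, monoid.mult = (*), monoid.one = 1, ring.zero = 0, ring.add = (+), module.smult = (\<lambda>r a. \<phi> r * a)\<rparr>"

text \<open>\<open>M \<otimes>\<^bsub>R\<^sub>w\<^esub> k\<close> for an \<open>S\<^sub>w\<close>-module \<open>M\<close> and \<open>\<phi> : R\<^sub>w \<rightarrow> k\<close>. It is a module over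
  \<open>S\<^sub>w \<otimes>\<^bsub>R\<^sub>w\<^esub> k = B\<close>: the polynomial \<open>p = \<Sum> p\<^sub>e (x,y)\<^sup>e\<close> is \<open>\<Sum> (x,y)\<^sup>e \<otimes> p\<^sub>e\<close>, so that
  \<open>p \<cdot> (m \<otimes> a) = \<Sum> (x,y)\<^sup>e m \<otimes> p\<^sub>e a\<close>. As \<open>\<phi>\<close> is not homogeneous, only the first component of
  the bigrading induces a grading.\<close>

definition base_change :: "nat \<Rightarrow> (zfrac \<Rightarrow> 'k::field) \<Rightarrow>
    (zfrac bipoly, 'm, int \<times> int) graded_module \<Rightarrow>
    ('k bipoly, (('m \<times> 'k) \<Rightarrow>\<^sub>0 int) set, int) graded_module" where
  "base_change c \<phi> M = (let R = ring_on (R_w c); M' = restrict_scalars xy_const M;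
                             k = field_module \<phi>; T = tensor R M' k in
    \<lparr>carrier = carrier T, monoid.mult = undefined, monoid.one = undefined, ring.zero = \<one>\<^bsub>T\<^esub>, ring.add = monoid.mult T,
     module.smult = (\<lambda>p. tensor_induced R M' k (\<lambda>(m, a).
        \<Sum>(i, j)\<in>Poly_Mapping.keys p.
          frag_of (xy_monom i j 1 \<odot>\<^bsub>M\<^esub> m, Poly_Mapping.lookup p (i, j) * a))),
     deg_part = (\<lambda>n. generate T
        {tensor_elem R M' k m a | m a. \<exists>l. m \<in> deg_part M (n, l)})\<rparr>)"

text \<open>\<open>f \<otimes> 1\<close>, where \<open>N\<close> is the codomain of \<open>f\<close>.\<close>

definition base_change_map :: "nat \<Rightarrow> (zfrac \<Rightarrow> 'k::field) \<Rightarrow>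
    (zfrac bipoly, 'n, int \<times> int) graded_module \<Rightarrow> ('m \<Rightarrow> 'n) \<Rightarrow>
    (('m \<times> 'k) \<Rightarrow>\<^sub>0 int) set \<Rightarrow> (('n \<times> 'k) \<Rightarrow>\<^sub>0 int) set" where
  "base_change_map c \<phi> N f =
     tensor_induced (ring_on (R_w c)) (restrict_scalars xy_const N) (field_module \<phi>)
       (\<lambda>(m, a). frag_of (f m, a))"

end

theory Submission
  imports Defs
begin

text \<open>
  The matrix \<open>A\<^sup>(\<^sup>m\<^sup>)\<close> is the matrix of \<open>(V\<^sub>1, V\<^sub>2, V\<^sub>3) \<mapsto> \<Sum> V\<^sub>l G\<^sub>l\<close> on triples of forms of degree \<open>m\<close>. Thus
  inverting \<open>w = det A\<^sup>(\<^sup>c\<^sup>-\<^sup>1\<^sup>)\<close> means that \<open>G\<^sub>1, G\<^sub>2, G\<^sub>3\<close> have no syzygy with entries of degree less than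
  \<open>c\<close> (\<open>w_nonzero_iff\<close>), and everything follows from this.

  Only three columns of \<open>A\<^sup>(\<^sup>c\<^sup>)\<close> have a nonzero entry in the first row, the entries being the components
  of \<open>z = (z\<^bsub>0,1\<^esub>, z\<^bsub>0,2\<^esub>, z\<^bsub>0,3\<^esub>)\<close>; what remains without them and the first row is \<open>A\<^sup>(\<^sup>c\<^sup>-\<^sup>1\<^sup>)\<close>. The columns of
  \<open>d\<^sub>2\<close> are syzygies of degree \<open>c\<close> because a determinant with two equal rows vanishes
  (\<open>A_mat_mult_b_vec\<close>), and by the block structure their coefficients at \<open>y\<^sup>c\<close> form, up to signs and the
  factor \<open>w\<close>, the matrix of the cross product with \<open>z\<close> (\<open>coeff_syz_0\<close>). So the combinations with
  coefficients in the kernel of \<open>\<sigma>\<close> realize every vector orthogonal to \<open>z\<close> exactly once. Given any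
  syzygy, one can therefore subtract such a combination to make it divisible by \<open>x\<close>, and the quotient
  is a syzygy of smaller degree. Below degree \<open>c\<close> nothing is left
  (\<open>syzygy_is_combination\<close>, \<open>combination_injective\<close>). The argument takes place over an arbitrary subring
  of a field in which \<open>w\<close> is a unit. Hence it proves exactness over the localization of \<open>S\<close> and, with
  the coefficients specialized, over \<open>k[x,y]\<close>.

  Now let \<open>I\<close> be an ideal with the given Betti numbers. The coefficients of its three generators define
  a homomorphism \<open>R \<rightarrow> k\<close>. As the entries of the second differential of the given resolution have degree
  \<open>c\<close>, the generators have no syzygy with entries of degree less than \<open>c\<close>; so the image of \<open>w\<close> is not \<open>0\<close>, and
  the homomorphism extends to the localization (\<open>specialization_of_resolution\<close>). The module \<open>ker \<sigma>\<close>
  consists of the fixed points of the idempotent matrix \<open>1 - d\<^sub>3 \<sigma>\<close>, whose entries are constants of degree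
  \<open>0\<close>. For such modules the tensor product with \<open>k\<close> is the module of fixed points of the specialized
  matrix (\<open>graded_iso_cls\<close>), which identifies the base change of the universal complex with the
  specialized complex. Its first differential is that of the given resolution, and the images of both
  second differentials are the kernel of the first. The augmentation to \<open>B/I\<close> and the minimality are
  therefore those of the given resolution, and \<open>ker \<sigma>\<close> becomes free because \<open>\<sigma>\<close> has a
  nonzero entry in \<open>k\<close> (\<open>graded_free_kernel_sigma\<close>).
\<close>

section \<open>Coefficients of polynomials\<close>

abbreviation coef :: "('a \<Rightarrow>\<^sub>0 'b::zero) \<Rightarrow> 'a \<Rightarrow> 'b" where "coef \<equiv> Poly_Mapping.lookup"
abbreviation supp :: "('a \<Rightarrow>\<^sub>0 'b::zero) \<Rightarrow> 'a set" where "supp \<equiv> Poly_Mapping.keys"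

lemma poly_mapping_additive_induct [case_names zero single add]:
  assumes "P 0" "\<And>k v. P (Poly_Mapping.single k v)" "\<And>f g. P f \<Longrightarrow> P g \<Longrightarrow> P (f + g)"
  shows "P (p :: 'a \<Rightarrow>\<^sub>0 'b::comm_monoid_add)"
proof (induction p rule: update_induct)
  case const
  then show ?case by (rule assms(1))
next
  case (update f a b)
  have "Poly_Mapping.update a b f = f + Poly_Mapping.single a b"
    by (rule poly_mapping_eqI)
      (use update in \<open>auto simp: lookup_update lookup_add lookup_single when_def in_keys_iff\<close>)
  then show ?case using update assms by metis
qed

lemma sum_singles:
  fixes p :: "'a \<Rightarrow>\<^sub>0 'b::comm_monoid_add"
  assumes "finite E" "supp p \<subseteq> E"
  shows "(\<Sum>e\<in>E. Poly_Mapping.single e (coef p e)) = p"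
proof (rule poly_mapping_eqI)
  fix k
  have "coef (\<Sum>e\<in>E. Poly_Mapping.single e (coef p e)) k = (\<Sum>e\<in>E. if e = k then coef p k else 0)"
    unfolding lookup_sum by (rule sum.cong) (auto simp: lookup_single when_def)
  also have "\<dots> = coef p k"
    using assms by (auto simp: in_keys_iff)
  finally show "coef (\<Sum>e\<in>E. Poly_Mapping.single e (coef p e)) k = coef p k" .
qed

lemma coef_map: "coef (Poly_Mapping.map f p) e = (f (coef p e) when coef p e \<noteq> 0)"
  by (simp add: map.rep_eq)

lemma mult_sum_singles:
  fixes p q :: "'a::monoid_add \<Rightarrow>\<^sub>0 'b::semiring_0"
  shows "p * q = (\<Sum>a\<in>supp p. \<Sum>b\<in>supp q. Poly_Mapping.single (a + b) (coef p a * coef q b))"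
proof -
  have "p * q = (\<Sum>a\<in>supp p. Poly_Mapping.single a (coef p a)) *
      (\<Sum>b\<in>supp q. Poly_Mapping.single b (coef q b))"
    by (simp add: sum_singles)
  also have "\<dots> = (\<Sum>a\<in>supp p. \<Sum>b\<in>supp q. Poly_Mapping.single (a + b) (coef p a * coef q b))"
    by (simp add: sum_product mult_single)
  finally show ?thesis .
qed

text \<open>Localizations of polynomial rings occur as subsets of a type, so coefficient rings are subrings of a
  type throughout; \<open>UNIV\<close> gives the case of a field.\<close>

definition ring_closed :: "'a::comm_ring_1 set \<Rightarrow> bool" where
  "ring_closed R \<longleftrightarrow> 1 \<in> R \<and> (\<forall>a\<in>R. \<forall>b\<in>R. a - b \<in> R \<and> a * b \<in> R)"

lemma ring_closed_UNIV [simp]: "ring_closed UNIV"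
  by (simp add: ring_closed_def)

context
  fixes R :: "'a::comm_ring_1 set"
  assumes R: "ring_closed R"
begin

lemma ring_closed_one: "1 \<in> R"
  and ring_closed_diff: "a \<in> R \<Longrightarrow> b \<in> R \<Longrightarrow> a - b \<in> R"
  and ring_closed_mult: "a \<in> R \<Longrightarrow> b \<in> R \<Longrightarrow> a * b \<in> R"
  using R by (auto simp: ring_closed_def)

lemma ring_closed_zero: "0 \<in> R"
  using ring_closed_diff[OF ring_closed_one ring_closed_one] by simp

lemma ring_closed_uminus: "a \<in> R \<Longrightarrow> - a \<in> R"
  using ring_closed_diff[OF ring_closed_zero, of a] by simp

lemma ring_closed_add: "a \<in> R \<Longrightarrow> b \<in> R \<Longrightarrow> a + b \<in> R"
  using ring_closed_diff[of a "- b"] ring_closed_uminus by simp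

lemma ring_closed_sum: "(\<And>i. i \<in> I \<Longrightarrow> f i \<in> R) \<Longrightarrow> sum f I \<in> R"
  by (induction I rule: infinite_finite_induct) (auto intro: ring_closed_zero ring_closed_add)

lemma ring_closed_prod: "(\<And>i. i \<in> I \<Longrightarrow> f i \<in> R) \<Longrightarrow> prod f I \<in> R"
  by (induction I rule: infinite_finite_induct) (auto intro: ring_closed_one ring_closed_mult)

lemma ring_closed_power: "a \<in> R \<Longrightarrow> a ^ n \<in> R"
  by (induction n) (auto intro: ring_closed_one ring_closed_mult)

end

lemmas ring_closed_intros = ring_closed_one ring_closed_zero ring_closed_diff ring_closed_mult
  ring_closed_uminus ring_closed_add ring_closed_sum ring_closed_prod ring_closed_power

definition coeffs_in :: "'a::comm_ring_1 set \<Rightarrow> ('e::comm_monoid_add \<Rightarrow>\<^sub>0 'a) set" where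
  "coeffs_in R = {p. \<forall>e. coef p e \<in> R}"

lemma coeffs_in_UNIV [simp]: "coeffs_in UNIV = UNIV"
  by (simp add: coeffs_in_def)

lemma coeffs_in_single:
  "ring_closed R \<Longrightarrow> a \<in> R \<Longrightarrow> Poly_Mapping.single e a \<in> coeffs_in R"
  by (auto simp: coeffs_in_def lookup_single when_def intro: ring_closed_zero)

lemma coeffs_in_sum:
  "ring_closed R \<Longrightarrow> (\<And>i. i \<in> I \<Longrightarrow> f i \<in> coeffs_in R) \<Longrightarrow> sum f I \<in> coeffs_in R"
  by (auto simp: coeffs_in_def lookup_sum intro: ring_closed_sum)

lemma ring_closed_coeffs_in:
  assumes R: "ring_closed R"
  shows "ring_closed (coeffs_in R)"
  unfolding ring_closed_def
proof (intro conjI ballI)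
  show "1 \<in> coeffs_in R"
    using R by (auto simp: coeffs_in_def lookup_one when_def intro: ring_closed_intros)
next
  fix p q :: "'b \<Rightarrow>\<^sub>0 'a" assume pq: "p \<in> coeffs_in R" "q \<in> coeffs_in R"
  show "p - q \<in> coeffs_in R"
    using R pq by (auto simp: coeffs_in_def lookup_minus intro: ring_closed_diff)
  show "p * q \<in> coeffs_in R"
    unfolding mult_sum_singles using R pq
    by (intro coeffs_in_sum coeffs_in_single ring_closed_mult) (auto simp: coeffs_in_def)
qed

text \<open>A ring homomorphism may be defined on a subring \<open>R\<close> only, as the values
  of a function outside \<open>R\<close> carry no meaning.\<close>

locale hom_on =
  fixes R :: "'a::comm_ring_1 set" and f :: "'a \<Rightarrow> 'b::comm_ring_1"
  assumes closed: "ring_closed R"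
    and hom_one: "f 1 = 1"
    and hom_add: "a \<in> R \<Longrightarrow> b \<in> R \<Longrightarrow> f (a + b) = f a + f b"
    and hom_mult: "a \<in> R \<Longrightarrow> b \<in> R \<Longrightarrow> f (a * b) = f a * f b"
begin

lemma hom_zero: "f 0 = 0"
  using hom_add[of 0 0] ring_closed_zero[OF closed] by simp

lemma hom_uminus: "a \<in> R \<Longrightarrow> f (- a) = - f a"
  using hom_add[of "- a" a] hom_zero ring_closed_uminus[OF closed, of a]
  by (simp add: eq_neg_iff_add_eq_0)

lemma hom_diff: "a \<in> R \<Longrightarrow> b \<in> R \<Longrightarrow> f (a - b) = f a - f b"
  using hom_add[of a "- b"] hom_uminus ring_closed_uminus[OF closed, of b] by simp

lemma hom_sum: "(\<And>i. i \<in> I \<Longrightarrow> g i \<in> R) \<Longrightarrow> f (sum g I) = (\<Sum>i\<in>I. f (g i))"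
proof (induction I rule: infinite_finite_induct)
  case (insert x F)
  then have "f (g x + sum g F) = f (g x) + f (sum g F)"
    by (intro hom_add) (auto intro: ring_closed_sum[OF closed])
  then show ?case using insert by simp
qed (auto simp: hom_zero)

lemma coef_map_hom: "coef (Poly_Mapping.map f p) e = f (coef p e)"
  by (auto simp: coef_map when_def hom_zero)

lemma map_hom_single: "Poly_Mapping.map f (Poly_Mapping.single e a) = Poly_Mapping.single e (f a)"
  by (rule poly_mapping_eqI) (auto simp: coef_map_hom lookup_single when_def hom_zero)

lemma map_hom_sum:
  fixes g :: "'i \<Rightarrow> 'e::comm_monoid_add \<Rightarrow>\<^sub>0 'a"
  assumes "\<And>i. i \<in> I \<Longrightarrow> g i \<in> coeffs_in R"
  shows "Poly_Mapping.map f (sum g I) = (\<Sum>i\<in>I. Poly_Mapping.map f (g i))"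
  by (rule poly_mapping_eqI)
    (use assms in \<open>auto simp: coef_map_hom lookup_sum coeffs_in_def intro: hom_sum\<close>)

lemma map_hom_on: "hom_on (coeffs_in R) (Poly_Mapping.map f :: ('e::comm_monoid_add \<Rightarrow>\<^sub>0 'a) \<Rightarrow> _)"
proof
  show "ring_closed (coeffs_in R :: ('e \<Rightarrow>\<^sub>0 'a) set)" by (rule ring_closed_coeffs_in[OF closed])
  show "Poly_Mapping.map f (1 :: 'e \<Rightarrow>\<^sub>0 'a) = 1"
    by (rule poly_mapping_eqI) (auto simp: coef_map_hom lookup_one when_def hom_zero hom_one)
  fix p q :: "'e \<Rightarrow>\<^sub>0 'a" assume pq: "p \<in> coeffs_in R" "q \<in> coeffs_in R"
  show "Poly_Mapping.map f (p + q) = Poly_Mapping.map f p + Poly_Mapping.map f q"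
    by (rule poly_mapping_eqI)
      (use pq in \<open>auto simp: coef_map_hom lookup_add hom_add coeffs_in_def\<close>)
  have expand: "Poly_Mapping.map f p = (\<Sum>a\<in>supp p. Poly_Mapping.single a (f (coef p a)))"
    for p :: "'e \<Rightarrow>\<^sub>0 'a"
    using sum_singles[of "supp p" "Poly_Mapping.map f p"]
    by (force simp: in_keys_iff coef_map_hom hom_zero)
  have in_R: "Poly_Mapping.single (a + b) (coef p a * coef q b) \<in> coeffs_in R" for a b
    using pq by (intro coeffs_in_single closed ring_closed_mult) (auto simp: coeffs_in_def)
  have "Poly_Mapping.map f (p * q) = (\<Sum>a\<in>supp p. \<Sum>b\<in>supp q.
      Poly_Mapping.map f (Poly_Mapping.single (a + b) (coef p a * coef q b)))"
    unfolding mult_sum_singles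
    by (simp add: map_hom_sum in_R coeffs_in_sum[OF closed])
  also have "\<dots> = (\<Sum>a\<in>supp p. \<Sum>b\<in>supp q. Poly_Mapping.single (a + b) (f (coef p a) * f (coef q b)))"
    using pq by (simp add: map_hom_single hom_mult coeffs_in_def)
  also have "\<dots> = Poly_Mapping.map f p * Poly_Mapping.map f q"
    by (simp add: expand sum_product mult_single)
  finally show "Poly_Mapping.map f (p * q) = Poly_Mapping.map f p * Poly_Mapping.map f q" .
qed

end

section \<open>Homogeneous components as univariate polynomials\<close>

text \<open>Setting \<open>y = 1\<close> identifies the forms of degree \<open>n\<close> with the univariate polynomials of degree at most
  \<open>n\<close>. In the latter, division by \<open>x\<close> is a shift of the coefficients.\<close>

definition slice :: "nat \<Rightarrow> 'a::comm_ring_1 bipoly \<Rightarrow> 'a poly" where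
  "slice n p = (\<Sum>i\<le>n. monom (coef p (i, n - i)) i)"

definition homogenize :: "nat \<Rightarrow> 'a::comm_ring_1 poly \<Rightarrow> 'a bipoly" where
  "homogenize n f = (\<Sum>i\<le>n. xy_monom i (n - i) (coeff f i))"

lemma coeff_slice: "coeff (slice n p) i = (if i \<le> n then coef p (i, n - i) else 0)"
  unfolding slice_def coeff_sum coeff_monom by simp

lemma coef_homogenize: "coef (homogenize n f) (i, j) = (if i + j = n then coeff f i else 0)"
proof -
  have "coef (homogenize n f) (i, j) = (\<Sum>k\<le>n. if k = i then if i + j = n then coeff f i else 0 else 0)"
    unfolding homogenize_def lookup_sum xy_monom_def lookup_single
    by (rule sum.cong) (auto simp: when_def)
  then show ?thesis by simp
qed

lemma slice_add: "slice n (p + q) = slice n p + slice n q"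
  by (rule poly_eqI) (simp add: coeff_slice lookup_add)

lemma slice_zero [simp]: "slice n 0 = 0"
  by (rule poly_eqI) (simp add: coeff_slice)

lemma slice_sum: "slice n (sum f I) = (\<Sum>i\<in>I. slice n (f i))"
  by (induction I rule: infinite_finite_induct) (auto simp: slice_add)

lemma slice_single: "slice n (Poly_Mapping.single (i, j) a) = (if i + j = n then monom a i else 0)"
  by (rule poly_eqI) (auto simp: coeff_slice lookup_single when_def)

lemma homogenize_add: "homogenize n (f + g) = homogenize n f + homogenize n g"
  by (rule poly_mapping_eqI) (auto simp: coef_homogenize lookup_add)

lemma homogenize_zero [simp]: "homogenize n 0 = 0"
  by (rule poly_mapping_eqI) (auto simp: coef_homogenize)

lemma homogenize_sum: "homogenize n (sum f I) = (\<Sum>i\<in>I. homogenize n (f i))"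
  by (induction I rule: infinite_finite_induct) (auto simp: homogenize_add)

lemma eq_zero_if_slices_zero: "(\<And>n. slice n p = 0) \<Longrightarrow> p = 0"
proof (rule poly_mapping_eqI)
  fix e :: "nat \<times> nat" assume "\<And>n. slice n p = 0"
  then have "coeff (slice (fst e + snd e) p) (fst e) = 0" by simp
  then show "coef p e = coef 0 e" by (simp add: coeff_slice)
qed

text \<open>Both differentials have homogeneous entries. This lemma therefore reduces statements about
  them to univariate polynomials, one degree at a time.\<close>

lemma slice_mult_homogenize:
  assumes f: "\<And>k. k > m \<Longrightarrow> coeff f k = 0"
  shows "slice n (p * homogenize m f) = (if m \<le> n then slice (n - m) p * f else 0)"
proof (induction p rule: poly_mapping_additive_induct)
  case (single e a)
  obtain i j where e: "e = (i, j)" by (cases e)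
  have "slice n (Poly_Mapping.single e a * homogenize m f) =
      (\<Sum>k\<le>m. if i + j + m = n then monom (a * coeff f k) (i + k) else 0)"
    unfolding homogenize_def xy_monom_def sum_distrib_left slice_sum e mult_single
    by (rule sum.cong) (auto simp: slice_single)
  also have "\<dots> = (if i + j + m = n then monom a i * (\<Sum>k\<le>m. monom (coeff f k) k) else 0)"
    by (simp add: sum_distrib_left mult_monom)
  also have "(\<Sum>k\<le>m. monom (coeff f k) k) = f"
    by (rule poly_eqI) (use f in \<open>auto simp: coeff_sum coeff_monom not_le\<close>)
  finally show ?case by (auto simp: e slice_single)
qed (auto simp: slice_add algebra_simps)

lemma homogenize_mult:
  assumes f: "\<And>k. k > m \<Longrightarrow> coeff f k = 0" and g: "\<And>k. k > n \<Longrightarrow> coeff g k = 0"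
  shows "homogenize m f * homogenize n g = homogenize (m + n) (f * g)"
proof -
  have fg: "coeff (f * g) k = 0" if "k > m + n" for k
    unfolding coeff_mult using f g that
    by (intro sum.neutral) (metis add_le_mono atMost_iff le_add_diff_inverse mult_not_zero not_le)
  have "slice d (homogenize m f) = (if d = m then f else 0)" for d
    using f by (auto intro!: poly_eqI simp: coeff_slice coef_homogenize not_le)
  moreover have "slice d (homogenize (m + n) (f * g)) = (if d = m + n then f * g else 0)" for d
    using fg by (auto intro!: poly_eqI simp: coeff_slice coef_homogenize not_le)
  ultimately have "slice d (homogenize m f * homogenize n g - homogenize (m + n) (f * g)) = 0" for d
    using slice_add[of d "homogenize m f * homogenize n g - homogenize (m + n) (f * g)" "homogenize (m + n) (f * g)"]
    by (auto simp: slice_mult_homogenize[OF g] split: if_splits)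
  then show ?thesis using eq_zero_if_slices_zero by (metis eq_iff_diff_eq_0)
qed

lemma sum_homogenize_slices:
  assumes "finite N" "\<And>n. n \<notin> N \<Longrightarrow> slice n p = 0"
  shows "(\<Sum>n\<in>N. homogenize n (slice n p)) = p"
proof (rule poly_mapping_eqI)
  fix e :: "nat \<times> nat" obtain i j where e: "e = (i, j)" by (cases e)
  have "coef (\<Sum>n\<in>N. homogenize n (slice n p)) e = (\<Sum>n\<in>N. if n = i + j then coeff (slice n p) i else 0)"
    unfolding e lookup_sum coef_homogenize by (rule sum.cong) auto
  also have "\<dots> = coeff (slice (i + j) p) i" using assms by auto
  finally show "coef (\<Sum>n\<in>N. homogenize n (slice n p)) e = coef p e" by (simp add: e coeff_slice)
qed

lemma finite_nonzero_slices: "finite {n. slice n p \<noteq> 0}"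
proof (rule finite_subset)
  show "{n. slice n p \<noteq> 0} \<subseteq> (\<lambda>(i, j). i + j) ` supp p"
  proof
    fix n assume "n \<in> {n. slice n p \<noteq> 0}"
    then obtain i where "coeff (slice n p) i \<noteq> 0" using leading_coeff_neq_0 by blast
    then have "i \<le> n" "(i, n - i) \<in> supp p" by (auto simp: coeff_slice in_keys_iff split: if_splits)
    then show "n \<in> (\<lambda>(i, j). i + j) ` supp p" by force
  qed
qed simp

section \<open>Minors of the matrices \<open>A\<^sup>(\<^sup>i\<^sup>)\<close>\<close>

lemma A_mat_carrier [simp]:
  "A_mat c m \<in> carrier_mat (2 * c + m + 1) (3 * (m + 1))"
  "dim_row (A_mat c m) = 2 * c + m + 1" "dim_col (A_mat c m) = 3 * (m + 1)"
  by (simp_all add: A_mat_def)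

lemma A_mat_index:
  assumes "r < 2 * c + m + 1" "l < 3" "k \<le> m"
  shows "A_mat c m $$ (r, (m + 1) * l + k) =
    (if k \<le> r \<and> r - k \<le> 2 * c then zvar (r - k) (l + 1) else 0)"
proof -
  have "(m + 1) * l + k < 3 * (m + 1)"
  proof -
    have "(m + 1) * l \<le> (m + 1) * 2" using assms by (intro mult_le_mono) auto
    then show ?thesis using assms by simp
  qed
  moreover have "((m + 1) * l + k) div (m + 1) = l" "((m + 1) * l + k) mod (m + 1) = k"
    using assms by (auto intro!: div_nat_eqI simp: less_Suc_eq_le simp del: mult_Suc)
  ultimately show ?thesis using assms by (simp add: A_mat_def Let_def)
qed

lemma sum_lessThan_blocks:
  "(\<Sum>q<3 * n. F q) = (\<Sum>l<3::nat. \<Sum>k<n. F (n * l + k))" for F :: "nat \<Rightarrow> 'a::comm_monoid_add"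
proof -
  have "(\<Sum>q<3 * n. F q) = (\<Sum>l<3. sum F {l * n ..< l * n + n})"
    by (rule sum.nat_group[symmetric])
  also have "\<dots> = (\<Sum>l<3. \<Sum>k<n. F (n * l + k))"
  proof (rule sum.cong[OF refl])
    fix l :: nat
    have "sum F {l * n ..< l * n + n} = sum F {0 + l * n ..< n + l * n}" by (simp add: add.commute)
    also have "\<dots> = (\<Sum>k = 0..<n. F (k + l * n))" by (rule sum.shift_bounds_nat_ivl)
    finally show "sum F {l * n ..< l * n + n} = (\<Sum>k<n. F (n * l + k))"
      by (simp add: lessThan_atLeast0 ac_simps)
  qed
  finally show ?thesis .
qed

lemma A_minor_filter:
  "A_minor c i m = det (mat_of_cols (3 * c + 1)
     (map (\<lambda>q. col (A_mat c c) (q - 1)) [q \<leftarrow> [1..<3 * c + 4]. q \<noteq> i \<and> q \<noteq> m]))"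
proof -
  have "concat (map (\<lambda>x. if P x then [f x] else []) xs) = map f (filter P xs)"
    for P and f :: "nat \<Rightarrow> zpoly vec" and xs
    by (induction xs) auto
  then show ?thesis by (simp only: A_minor_def)
qed

text \<open>Delete column \<open>i\<close> of \<open>A\<^sup>(\<^sup>c\<^sup>)\<close> and put a copy of row \<open>r\<close> of what remains on top. The resulting square
  matrix has two equal rows, and the expansion of its determinant along the new row is
  entry \<open>r\<close> of \<open>A b\<^sup>(\<^sup>i\<^sup>)\<close>.\<close>

lemma A_mat_mult_b_vec:
  assumes i: "1 \<le> i" "i \<le> 3 * c + 3" and r: "r < 3 * c + 1"
  shows "(\<Sum>q<3 * c + 3. A_mat c c $$ (r, q) * b_vec c i $ q) = 0"
proof -
  define A where "A = A_mat c c"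
  have A: "A \<in> carrier_mat (3 * c + 1) (3 * c + 3)" by (intro carrier_matI) (simp_all add: A_def)
  define L where "L = [q \<leftarrow> [1..<3 * c + 4]. q \<noteq> i]"
  have L_eq: "L = [1..<i] @ [i + 1..<3 * c + 4]"
  proof -
    have "[1..<3 * c + 4] = [1..<i] @ i # [i + 1..<3 * c + 4]"
      using i upt_add_eq_append[of 1 i "3 * c + 4 - i"] upt_conv_Cons[of i "3 * c + 4"] by auto
    then have "L = [q \<leftarrow> [1..<i]. q \<noteq> i] @ [q \<leftarrow> [i + 1..<3 * c + 4]. q \<noteq> i]"
      by (simp add: L_def)
    also have "[q \<leftarrow> [1..<i]. q \<noteq> i] = [1..<i]" by (rule filter_True) auto
    also have "[q \<leftarrow> [i + 1..<3 * c + 4]. q \<noteq> i] = [i + 1..<3 * c + 4]" by (rule filter_True) auto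
    finally show ?thesis .
  qed
  have len: "length L = 3 * c + 2" using i by (simp add: L_eq)
  have dist: "distinct L" by (simp add: L_def)
  have L_nth: "L ! p = (if p + 1 < i then p + 1 else p + 2)" if "p < 3 * c + 2" for p
    using that i by (auto simp: L_eq nth_append)
  have L_set: "set L = {1..<3 * c + 4} - {i}" by (auto simp: L_def)
  define D where "D = mat (3 * c + 2) (3 * c + 2) (\<lambda>(s, p). A $$ (if s = 0 then r else s - 1, L ! p - 1))"
  have D: "D \<in> carrier_mat (3 * c + 2) (3 * c + 2)" by (simp add: D_def)
  \<comment> \<open>Row \<open>0\<close> of \<open>D\<close> is the added copy; the original row \<open>r\<close> has moved to position \<open>r + 1\<close>.\<close>
  have "row D 0 = row D (r + 1)"
    using r by (intro eq_vecI) (auto simp: D_def)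
  then have "det D = 0"
    using r by (intro det_identical_rows[OF D, of 0 "r + 1"]) auto
  have minor: "A_minor c i (L ! p) = det (mat_delete D 0 p)" "A_minor c (L ! p) i = det (mat_delete D 0 p)"
    if p: "p < 3 * c + 2" for p
  proof -
    have L_split: "L = take p L @ L ! p # drop (Suc p) L"
      using p len by (simp add: id_take_nth_drop)
    have "L ! p \<notin> set (take p L) \<union> set (drop (Suc p) L)"
      using dist by (subst (asm) L_split) simp
    then have "[q \<leftarrow> L. q \<noteq> L ! p] = take p L @ drop (Suc p) L"
      by (subst L_split) (auto intro!: arg_cong2[of _ _ _ _ append] filter_True)
    moreover have "[q \<leftarrow> L. q \<noteq> L ! p] = [q \<leftarrow> [1..<3 * c + 4]. q \<noteq> i \<and> q \<noteq> L ! p]"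
      unfolding L_def filter_filter ..
    ultimately have cols: "[q \<leftarrow> [1..<3 * c + 4]. q \<noteq> i \<and> q \<noteq> L ! p] = take p L @ drop (Suc p) L"
      by simp
    have nth: "(take p L @ drop (Suc p) L) ! k = L ! insert_index p k" if "k < 3 * c + 1" for k
      using that p len by (auto simp: nth_append insert_index_def)
    have "mat_of_cols (3 * c + 1) (map (\<lambda>q. col A (q - 1)) (take p L @ drop (Suc p) L)) = mat_delete D 0 p"
      (is "?M = _")
    proof (rule eq_matI)
      fix s k assume "s < dim_row (mat_delete D 0 p)" "k < dim_col (mat_delete D 0 p)"
      then have s: "s < 3 * c + 1" and k: "k < 3 * c + 1" by (auto simp: D_def mat_delete_def)
      have ik: "insert_index p k < 3 * c + 2" using k by (auto simp: insert_index_def)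
      have "L ! insert_index p k \<in> set L" using ik len by (intro nth_mem) simp
      then have in_cols: "L ! insert_index p k - 1 < 3 * c + 3" by (auto simp: L_set)
      have "?M $$ (s, k) = col A (L ! insert_index p k - 1) $ s"
        using s k p len nth[OF k] by (simp add: mat_of_cols_index del: map_append)
      also have "\<dots> = A $$ (s, L ! insert_index p k - 1)"
        using s A in_cols by simp
      also have "\<dots> = D $$ (insert_index 0 s, insert_index p k)"
        using s ik by (simp add: D_def)
      also have "\<dots> = mat_delete D 0 p $$ (s, k)"
        using mat_delete_index[of D "3 * c + 1" 0 p s k] D s k p by simp
      finally show "?M $$ (s, k) = mat_delete D 0 p $$ (s, k)" .
    qed (use len p in \<open>auto simp: D_def mat_delete_def\<close>)
    then show "A_minor c i (L ! p) = det (mat_delete D 0 p)"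
      unfolding A_minor_filter cols A_def[symmetric] by simp
    then show "A_minor c (L ! p) i = det (mat_delete D 0 p)"
      unfolding A_minor_filter by (simp add: conj_commute)
  qed
  have summand: "A $$ (r, L ! p - 1) * b_vec c i $ (L ! p - 1) = D $$ (0, p) * cofactor D 0 p"
    if p: "p < 3 * c + 2" for p
  proof -
    have "b_vec c i $ (L ! p - 1) = (-1) ^ p * det (mat_delete D 0 p)"
      using p i minor[OF p] by (auto simp: b_vec_def Let_def L_nth split: if_splits)
    moreover have "D $$ (0, p) = A $$ (r, L ! p - 1)" using p by (simp add: D_def)
    ultimately show ?thesis by (simp add: cofactor_def)
  qed
  have "(\<Sum>q<3 * c + 3. A $$ (r, q) * b_vec c i $ q) = (\<Sum>m\<in>{1..<3 * c + 4}. A $$ (r, m - 1) * b_vec c i $ (m - 1))"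
    by (rule sum.reindex_bij_witness[of _ "\<lambda>m. m - 1" Suc]) auto
  also have "\<dots> = (\<Sum>m\<in>set L. A $$ (r, m - 1) * b_vec c i $ (m - 1))"
    using i by (intro sum.mono_neutral_right) (auto simp: L_set b_vec_def Let_def)
  also have "\<dots> = (\<Sum>p<3 * c + 2. A $$ (r, L ! p - 1) * b_vec c i $ (L ! p - 1))"
    using sum.reindex_bij_betw[OF bij_betw_nth[OF dist _ refl], of "{..<3 * c + 2}" "\<lambda>m. A $$ (r, m - 1) * b_vec c i $ (m - 1)"]
    by (simp add: len)
  also have "\<dots> = (\<Sum>p<3 * c + 2. D $$ (0, p) * cofactor D 0 p)"
    using summand by (intro sum.cong) auto
  also have "\<dots> = det D"
    using laplace_expansion_row[OF D, of 0] by simp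
  finally show ?thesis using \<open>det D = 0\<close> by (simp add: A_def)
qed

text \<open>The columns of \<open>A\<^sup>(\<^sup>c\<^sup>)\<close> with a nonzero entry in the first row; without them and the first
  row, \<open>A\<^sup>(\<^sup>c\<^sup>)\<close> is \<open>A\<^sup>(\<^sup>c\<^sup>-\<^sup>1\<^sup>)\<close>.\<close>

definition lead_col :: "nat \<Rightarrow> nat \<Rightarrow> nat" where
  "lead_col c l = (c + 1) * l + 1"

lemma det_one_lead_col:
  assumes c: "c > 0" and d: "d < 3" and len: "length L = 3 * c + 1" and p: "p \<le> 3 * c"
    and lead: "L ! p = lead_col c d"
    and rest: "\<And>q. q < 3 * c \<Longrightarrow> L ! insert_index p q = q + q div c + 2"
  shows "det (mat_of_cols (3 * c + 1) [col (A_mat c c) (q - 1). q \<leftarrow> L]) = (-1) ^ p * zvar 0 (d + 1) * w_Z c"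
proof -
  define M where "M = mat_of_cols (3 * c + 1) [col (A_mat c c) (q - 1). q \<leftarrow> L]"
  have M: "M \<in> carrier_mat (3 * c + 1) (3 * c + 1)" using len by (simp add: M_def carrier_matI)
  have M_index: "M $$ (r, k) = A_mat c c $$ (r, L ! k - 1)"
    if "r < 3 * c + 1" "k < 3 * c + 1" "L ! k - 1 < 3 * (c + 1)" for r k
    using that len by (simp add: M_def mat_of_cols_index)
  have block: "\<exists>l k. l < 3 \<and> k < c \<and> q = c * l + k \<and> q + q div c + 2 - 1 = (c + 1) * l + (k + 1)"
    if "q < 3 * c" for q
  proof (intro exI conjI)
    show "q div c < 3" using that c by (simp add: less_mult_imp_div_less)
    show "q mod c < c" using c by simp
    show "q = c * (q div c) + q mod c" by simp
    have "q + q div c + 2 - 1 = (c * (q div c) + q mod c) + q div c + 1" by simp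
    then show "q + q div c + 2 - 1 = (c + 1) * (q div c) + (q mod c + 1)" by (simp only: algebra_simps)
  qed
  \<comment> \<open>Inside each block, dropping the leading column shifts the column index by one, and
    dropping the first row shifts the row index by one; the entry depends on their difference only.\<close>
  have rest_index: "M $$ (r, insert_index p q) = (if r = 0 then 0 else A_mat c (c - 1) $$ (r - 1, q))"
    if r: "r < 3 * c + 1" and q: "q < 3 * c" for r q
  proof -
    obtain l k where lk: "l < 3" "k < c" "q = c * l + k" "q + q div c + 2 - 1 = (c + 1) * l + (k + 1)"
      using block[OF q] by blast
    have "(c + 1) * l \<le> (c + 1) * 2" using lk by (intro mult_le_mono) auto
    then have "(c + 1) * l + (k + 1) < 3 * (c + 1)" using lk by simp
    moreover have "insert_index p q < 3 * c + 1" using q by (auto simp: insert_index_def)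
    ultimately have "M $$ (r, insert_index p q) = A_mat c c $$ (r, (c + 1) * l + (k + 1))"
      using M_index[of r "insert_index p q"] r rest[OF q] lk(4) by simp
    also have "\<dots> = (if k + 1 \<le> r \<and> r - (k + 1) \<le> 2 * c then zvar (r - (k + 1)) (l + 1) else 0)"
      using r lk by (intro A_mat_index) auto
    also have "\<dots> = (if r = 0 then 0 else A_mat c (c - 1) $$ (r - 1, q))"
      using A_mat_index[of "r - 1" c "c - 1" l k] r lk c by auto
    finally show ?thesis .
  qed
  have "mat_delete M 0 p = A_mat c (c - 1)"
  proof (rule eq_matI)
    fix r q assume "r < dim_row (A_mat c (c - 1))" "q < dim_col (A_mat c (c - 1))"
    then have "r < 3 * c" "q < 3 * c" using c by simp_all
    then show "mat_delete M 0 p $$ (r, q) = A_mat c (c - 1) $$ (r, q)"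
      using mat_delete_index[of M "3 * c" 0 p r q] M p rest_index[of "r + 1" q] by simp
  qed (use M c in \<open>auto simp: mat_delete_def\<close>)
  then have cof: "cofactor M 0 p = (-1) ^ p * w_Z c" by (simp add: cofactor_def w_Z_def)
  have lead_entry: "M $$ (0, p) = zvar 0 (d + 1)"
  proof -
    have "(c + 1) * d \<le> (c + 1) * 2" using d by (intro mult_le_mono) auto
    then have "(c + 1) * d < 3 * (c + 1)" by simp
    then show ?thesis
      using M_index[of 0 p] A_mat_index[of 0 c c d 0] p d lead by (simp add: lead_col_def)
  qed
  have zero: "M $$ (0, k) = 0" if "k < 3 * c + 1" "k \<noteq> p" for k
  proof -
    have "delete_index p k < 3 * c" "insert_index p (delete_index p k) = k"
      using that p by (auto simp: delete_index_def insert_index_def)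
    then show ?thesis using rest_index[of 0 "delete_index p k"] by simp
  qed
  have "det M = (\<Sum>k<3 * c + 1. M $$ (0, k) * cofactor M 0 k)"
    by (rule laplace_expansion_row[OF M]) simp
  also have "\<dots> = (\<Sum>k<3 * c + 1. if k = p then M $$ (0, p) * cofactor M 0 p else 0)"
    using zero by (intro sum.cong) auto
  also have "\<dots> = M $$ (0, p) * cofactor M 0 p"
    using p by simp
  finally have "det M = (-1) ^ p * zvar 0 (d + 1) * w_Z c" by (simp add: cof lead_entry mult_ac)
  then show ?thesis by (simp only: M_def)
qed

lemma A_minor_lead_cols:
  assumes c: "c > 0"
  shows "A_minor c (lead_col c 0) (lead_col c 1) = zvar 0 3 * w_Z c"
    and "A_minor c (lead_col c 0) (lead_col c 2) = (-1) ^ c * zvar 0 2 * w_Z c"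
    and "A_minor c (lead_col c 1) (lead_col c 2) = zvar 0 1 * w_Z c"
proof -
  define B0 B1 B2 where "B0 = [2..<c + 2]" and "B1 = [c + 3..<2 * c + 3]" and "B2 = [2 * c + 4..<3 * c + 4]"
  have upt_split: "[i..<k] = [i..<j] @ [j..<k]" if "i \<le> j" "j \<le> k" for i j k :: nat
    using upt_add_eq_append[of i j "k - j"] that by simp
  have all: "[1..<3 * c + 4] = 1 # B0 @ (c + 2) # B1 @ (2 * c + 3) # B2"
  proof -
    have "[1..<3 * c + 4] = [1..<c + 2] @ [c + 2..<2 * c + 3] @ [2 * c + 3..<3 * c + 4]"
      using upt_split[of 1 "c + 2" "3 * c + 4"] upt_split[of "c + 2" "2 * c + 3" "3 * c + 4"] by simp
    then show ?thesis by (simp add: upt_conv_Cons numeral_eq_Suc B0_def B1_def B2_def del: upt_Suc)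
  qed
  have filter: "filter P B0 = B0" "filter P B1 = B1" "filter P B2 = B2"
    if "\<And>q. q \<noteq> 1 \<Longrightarrow> q \<noteq> c + 2 \<Longrightarrow> q \<noteq> 2 * c + 3 \<Longrightarrow> P q" for P
    using that by (auto intro!: filter_True simp: B0_def B1_def B2_def)
  have len: "length B0 = c" "length B1 = c" "length B2 = c"
    by (simp_all add: B0_def B1_def B2_def del: upt_Suc)
  have nth: "B0 ! k = k + 2" "B1 ! k = k + c + 3" "B2 ! k = k + 2 * c + 4" if "k < c" for k
    using that by (simp_all add: B0_def B1_def B2_def del: upt_Suc)
  have div: "q div c = (if q < c then 0 else if q < 2 * c then 1 else 2)" if "q < 3 * c" for q
    using that by (auto intro!: div_nat_eqI)
  have lead: "lead_col c 0 = 1" "lead_col c 1 = c + 2" "lead_col c 2 = 2 * c + 3"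
    by (simp_all add: lead_col_def)
  have minor: "A_minor c i m = (-1) ^ p * zvar 0 (d + 1) * w_Z c"
    if "[q \<leftarrow> [1..<3 * c + 4]. q \<noteq> i \<and> q \<noteq> m] = L" "d < 3" "length L = 3 * c + 1" "p \<le> 3 * c"
      "L ! p = lead_col c d" "\<And>q. q < 3 * c \<Longrightarrow> L ! insert_index p q = q + q div c + 2" for i m p d L
    unfolding A_minor_filter that(1) by (rule det_one_lead_col[OF c that(2-6)])
  have "A_minor c (lead_col c 0) (lead_col c 1) = (-1) ^ (2 * c) * zvar 0 (2 + 1) * w_Z c"
  proof (rule minor)
    show "[q \<leftarrow> [1..<3 * c + 4]. q \<noteq> lead_col c 0 \<and> q \<noteq> lead_col c 1] = B0 @ B1 @ (2 * c + 3) # B2"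
      unfolding all lead by (simp add: filter)
    fix q assume "q < 3 * c"
    then show "(B0 @ B1 @ (2 * c + 3) # B2) ! insert_index (2 * c) q = q + q div c + 2"
      by (auto simp: nth_append insert_index_def len nth nth_Cons' div)
  qed (simp_all add: len nth_append lead lead[simplified])
  then show "A_minor c (lead_col c 0) (lead_col c 1) = zvar 0 3 * w_Z c" by simp
  have "A_minor c (lead_col c 0) (lead_col c 2) = (-1) ^ c * zvar 0 (1 + 1) * w_Z c"
  proof (rule minor)
    show "[q \<leftarrow> [1..<3 * c + 4]. q \<noteq> lead_col c 0 \<and> q \<noteq> lead_col c 2] = B0 @ (c + 2) # B1 @ B2"
      unfolding all lead by (simp add: filter)
    fix q assume "q < 3 * c"
    then show "(B0 @ (c + 2) # B1 @ B2) ! insert_index c q = q + q div c + 2"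
      by (auto simp: nth_append insert_index_def len nth nth_Cons' div)
  qed (simp_all add: len nth_append lead lead[simplified])
  then show "A_minor c (lead_col c 0) (lead_col c 2) = (-1) ^ c * zvar 0 2 * w_Z c"
    by (simp add: numeral_eq_Suc)
  have "A_minor c (lead_col c 1) (lead_col c 2) = (-1) ^ 0 * zvar 0 (0 + 1) * w_Z c"
  proof (rule minor)
    show "[q \<leftarrow> [1..<3 * c + 4]. q \<noteq> lead_col c 1 \<and> q \<noteq> lead_col c 2] = 1 # B0 @ B1 @ B2"
      unfolding all lead by (simp add: filter)
    fix q assume "q < 3 * c"
    then show "(1 # B0 @ B1 @ B2) ! insert_index 0 q = q + q div c + 2"
      by (auto simp: nth_append insert_index_def len nth nth_Cons' div)
  qed (simp_all add: len nth_append lead lead[simplified])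
  then show "A_minor c (lead_col c 1) (lead_col c 2) = zvar 0 1 * w_Z c" by simp
qed

lemma sum_zvar_Z_cof:
  assumes c: "c > 0"
  shows "(\<Sum>l<3. zvar 0 (l + 1) * Z_cof c (l + 1)) = w_Z c"
proof -
  define A where "A = A_mat c (c - 1)"
  have A: "A \<in> carrier_mat (3 * c) (3 * c)" using A_mat_carrier(1)[of c "c - 1"] c by (simp add: A_def)
  have "w_Z c = (\<Sum>q<3 * c. A $$ (0, q) * cofactor A 0 q)"
    using laplace_expansion_row[OF A, of 0] c by (simp add: w_Z_def A_def)
  also have "\<dots> = (\<Sum>l<3. \<Sum>k<c. A $$ (0, c * l + k) * cofactor A 0 (c * l + k))"
    by (rule sum_lessThan_blocks)
  also have "\<dots> = (\<Sum>l<3. \<Sum>k<c. if k = 0 then zvar 0 (l + 1) * cofactor A 0 (c * l) else 0)"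
    using A_mat_index[of 0 c "c - 1"] c by (intro sum.cong refl) (auto simp: A_def)
  also have "\<dots> = (\<Sum>l<3. zvar 0 (l + 1) * Z_cof c (l + 1))"
    using c by (simp add: Z_cof_def A_def mult.commute)
  finally show ?thesis by simp
qed

section \<open>Homogeneity of the minors\<close>

lemma sum_lessThan_3: "(\<Sum>l<3::nat. f l) = f 0 + f 1 + f 2" for f :: "nat \<Rightarrow> 'a::comm_monoid_add"
  by (simp add: numeral_eq_Suc add.assoc)

lemma supp_mult_exponents:
  fixes p q :: zpoly
  assumes "t \<in> supp (p * q)"
  obtains a b where "t = a + b" "a \<in> supp p" "b \<in> supp q"
  using keys_mult[of p q] assms by blast

lemma supp_add_exponents: "supp (a + b :: (nat \<times> nat) \<Rightarrow>\<^sub>0 nat) = supp a \<union> supp b"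
  by (auto simp: in_keys_iff lookup_add)

lemma ring_closed_R_Z: "ring_closed (R_Z c)"
  unfolding ring_closed_def
proof (intro conjI ballI)
  show "1 \<in> R_Z c" by (simp add: R_Z_def)
  fix p q assume pq: "p \<in> R_Z c" "q \<in> R_Z c"
  show "p - q \<in> R_Z c" using pq keys_diff[of p q] by (force simp: R_Z_def)
  show "p * q \<in> R_Z c"
    unfolding R_Z_def
  proof (intro CollectI ballI)
    fix t assume "t \<in> supp (p * q)"
    then obtain a b where t: "t = a + b" "a \<in> supp p" "b \<in> supp q" by (rule supp_mult_exponents)
    have "supp a \<subseteq> {0..2 * c} \<times> {1..3}" "supp b \<subseteq> {0..2 * c} \<times> {1..3}"
      using pq t unfolding R_Z_def by auto
    then show "supp t \<subseteq> {0..2 * c} \<times> {1..3}" by (simp add: t supp_add_exponents)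
  qed
qed

definition R_Z_deg :: "nat \<Rightarrow> int \<Rightarrow> zpoly set" where
  "R_Z_deg c d = {p \<in> R_Z c. \<forall>t\<in>supp p. int (\<Sum>v\<in>supp t. coef t v) = d}"

lemma R_Z_deg_zero: "0 \<in> R_Z_deg c d"
  using ring_closed_zero[OF ring_closed_R_Z] by (simp add: R_Z_deg_def)

lemma R_Z_deg_one: "1 \<in> R_Z_deg c 0"
  using ring_closed_one[OF ring_closed_R_Z] by (simp add: R_Z_deg_def)

lemma R_Z_deg_add: "p \<in> R_Z_deg c d \<Longrightarrow> q \<in> R_Z_deg c d \<Longrightarrow> p + q \<in> R_Z_deg c d"
  using keys_add[of p q] ring_closed_add[OF ring_closed_R_Z, of p c q] by (force simp: R_Z_deg_def)

lemma R_Z_deg_uminus: "p \<in> R_Z_deg c d \<Longrightarrow> - p \<in> R_Z_deg c d"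
  using ring_closed_uminus[OF ring_closed_R_Z, of p c] by (simp add: R_Z_deg_def)

lemma total_degree_add:
  fixes s t :: "nat \<times> nat \<Rightarrow>\<^sub>0 nat"
  shows "(\<Sum>v\<in>supp (s + t). coef (s + t) v) = (\<Sum>v\<in>supp s. coef s v) + (\<Sum>v\<in>supp t. coef t v)"
  by (rule setsum_keys_plus_distrib) auto

lemma R_Z_deg_mult:
  assumes "p \<in> R_Z_deg c d" "q \<in> R_Z_deg c e"
  shows "p * q \<in> R_Z_deg c (d + e)"
  unfolding R_Z_deg_def
proof (intro CollectI conjI ballI)
  show "p * q \<in> R_Z c" using assms ring_closed_mult[OF ring_closed_R_Z] by (simp add: R_Z_deg_def)
  fix t assume "t \<in> supp (p * q)"
  then obtain a b where t: "t = a + b" "a \<in> supp p" "b \<in> supp q" by (rule supp_mult_exponents)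
  then show "int (\<Sum>v\<in>supp t. coef t v) = d + e"
    using assms by (simp add: total_degree_add R_Z_deg_def)
qed

lemma R_Z_deg_sum: "(\<And>i. i \<in> I \<Longrightarrow> f i \<in> R_Z_deg c d) \<Longrightarrow> sum f I \<in> R_Z_deg c d"
  by (induction I rule: infinite_finite_induct) (auto intro: R_Z_deg_zero R_Z_deg_add)

lemma R_Z_deg_prod:
  "finite I \<Longrightarrow> (\<And>i. i \<in> I \<Longrightarrow> f i \<in> R_Z_deg c 1) \<Longrightarrow> prod f I \<in> R_Z_deg c (int (card I))"
  by (induction I rule: finite_induct) (auto intro: R_Z_deg_one R_Z_deg_mult)

lemma R_Z_deg_sign: "p \<in> R_Z_deg c d \<Longrightarrow> (-1) ^ n * p \<in> R_Z_deg c d"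
  by (cases "even n") (auto intro: R_Z_deg_uminus)

lemma R_Z_deg_power: "p \<in> R_Z_deg c d \<Longrightarrow> p ^ n \<in> R_Z_deg c (d * int n)"
  by (induction n) (auto intro: R_Z_deg_one R_Z_deg_mult simp: algebra_simps)

text \<open>Every summand of the Leibniz formula is a product of \<open>n\<close> entries.\<close>

lemma det_homogeneous:
  assumes M: "M \<in> carrier_mat n n" and entries: "\<And>i j. i < n \<Longrightarrow> j < n \<Longrightarrow> M $$ (i, j) \<in> R_Z_deg c 1"
  shows "det M \<in> R_Z_deg c (int n)"
  unfolding det_def'[OF M]
proof (rule R_Z_deg_sum)
  fix p assume "p \<in> {p. p permutes {0..<n}}"
  then have p: "p permutes {0..<n}" by simp
  have "(\<Prod>i = 0..<n. M $$ (i, p i)) \<in> R_Z_deg c (int (card {0..<n}))"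
    using p entries permutes_in_image[OF p] by (intro R_Z_deg_prod) auto
  then show "signof p * (\<Prod>i = 0..<n. M $$ (i, p i)) \<in> R_Z_deg c (int n)"
    by (auto simp: sign_def intro: R_Z_deg_uminus)
qed

lemma zvar_in_R_Z: "i \<le> 2 * c \<Longrightarrow> l < 3 \<Longrightarrow> zvar i (l + 1) \<in> R_Z c"
  by (auto simp: R_Z_def zvar_def)

lemma zvar_homogeneous: "i \<le> 2 * c \<Longrightarrow> l < 3 \<Longrightarrow> zvar i (l + 1) \<in> R_Z_deg c 1"
  using zvar_in_R_Z[of i c l] by (simp add: R_Z_deg_def) (simp add: zvar_def)

lemma A_mat_homogeneous:
  assumes "r < 2 * c + m + 1" "q < 3 * (m + 1)"
  shows "A_mat c m $$ (r, q) \<in> R_Z_deg c 1"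
proof -
  have "q div (m + 1) < 3" using assms by (simp add: less_mult_imp_div_less)
  then show ?thesis
    using assms zvar_homogeneous[of "r - q mod (m + 1)" c "q div (m + 1)"] R_Z_deg_zero
    by (auto simp: A_mat_def Let_def)
qed

lemma w_Z_homogeneous: "c > 0 \<Longrightarrow> w_Z c \<in> R_Z_deg c (int (3 * c))"
  unfolding w_Z_def by (rule det_homogeneous) (auto intro!: A_mat_homogeneous carrier_matI)

lemma Z_cof_homogeneous:
  assumes c: "c > 0" and l: "l < 3"
  shows "Z_cof c (l + 1) \<in> R_Z_deg c (int (3 * c - 1))"
proof -
  have A: "A_mat c (c - 1) \<in> carrier_mat (Suc (3 * c - 1)) (Suc (3 * c - 1))"
    using c by (auto intro!: carrier_matI)
  have "l * c \<le> 2 * c" using l by (intro mult_le_mono) auto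
  then have lc: "l * c < Suc (3 * c - 1)" using c by simp
  have "det (mat_delete (A_mat c (c - 1)) 0 (l * c)) \<in> R_Z_deg c (int (3 * c - 1))"
  proof (rule det_homogeneous)
    show "mat_delete (A_mat c (c - 1)) 0 (l * c) \<in> carrier_mat (3 * c - 1) (3 * c - 1)"
      using A by (auto simp: mat_delete_def)
    fix r k assume rk: "r < 3 * c - 1" "k < 3 * c - 1"
    then have "insert_index 0 r < 2 * c + (c - 1) + 1" "insert_index (l * c) k < 3 * (c - 1 + 1)"
      by (auto simp: insert_index_def)
    then show "mat_delete (A_mat c (c - 1)) 0 (l * c) $$ (r, k) \<in> R_Z_deg c 1"
      using A_mat_homogeneous[of "insert_index 0 r" c "c - 1" "insert_index (l * c) k"]
        mat_delete_index[OF A _ lc rk, of 0] by simp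
  qed
  then show ?thesis by (simp add: Z_cof_def cofactor_def R_Z_deg_sign)
qed

lemma A_minor_homogeneous:
  assumes "i \<in> {1..3 * c + 3}" "m \<in> {1..3 * c + 3}" "i \<noteq> m"
  shows "A_minor c i m \<in> R_Z_deg c (int (3 * c + 1))"
proof -
  define L where "L = [q \<leftarrow> [1..<3 * c + 4]. q \<noteq> i \<and> q \<noteq> m]"
  have set: "set L = {1..<3 * c + 4} - {i, m}" by (auto simp: L_def)
  have "card ({1..<3 * c + 4} - {i, m}) = card {1..<3 * c + 4} - card {i, m}"
    using assms by (intro card_Diff_subset) auto
  then have card: "card ({1..<3 * c + 4} - {i, m}) = 3 * c + 1"
    using assms(3) by simp
  have "distinct L" by (simp add: L_def)
  then have len: "length L = 3 * c + 1"
    using card distinct_card[of L] by (simp only: set)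
  have "det (mat_of_cols (3 * c + 1) (map (\<lambda>q. col (A_mat c c) (q - 1)) L)) \<in> R_Z_deg c (int (3 * c + 1))"
  proof (rule det_homogeneous)
    show "mat_of_cols (3 * c + 1) (map (\<lambda>q. col (A_mat c c) (q - 1)) L) \<in> carrier_mat (3 * c + 1) (3 * c + 1)"
      using len by (simp add: carrier_matI)
    fix r k assume r: "r < 3 * c + 1" and k: "k < 3 * c + 1"
    have "L ! k \<in> set L" using k len by (intro nth_mem) simp
    then have "L ! k - 1 < 3 * (c + 1)" unfolding set by auto
    then show "mat_of_cols (3 * c + 1) (map (\<lambda>q. col (A_mat c c) (q - 1)) L) $$ (r, k) \<in> R_Z_deg c 1"
      using r k len A_mat_homogeneous[of r c c "L ! k - 1"] by (simp add: mat_of_cols_index)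
  qed
  then show ?thesis by (simp only: A_minor_filter L_def)
qed

lemma b_vec_homogeneous:
  assumes "i \<in> {1..3 * c + 3}" "q < 3 * c + 3"
  shows "b_vec c i $ q \<in> R_Z_deg c (int (3 * c + 1))"
proof -
  have "(-1) ^ n * A_minor c m i \<in> R_Z_deg c (int (3 * c + 1))" if "m \<in> {1..3 * c + 3}" "m \<noteq> i" for n m
    using that assms by (intro R_Z_deg_sign A_minor_homogeneous) auto
  moreover have "(-1) ^ n * A_minor c i m \<in> R_Z_deg c (int (3 * c + 1))" if "m \<in> {1..3 * c + 3}" "m \<noteq> i" for n m
    using that assms by (intro R_Z_deg_sign A_minor_homogeneous) auto
  ultimately show ?thesis
    using assms R_Z_deg_zero by (auto simp: b_vec_def Let_def simp del: power_Suc)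
qed

lemma R_Z_deg_subset: "R_Z_deg c d \<subseteq> R_Z c"
  by (auto simp: R_Z_deg_def)

lemmas w_Z_in_R_Z = subsetD[OF R_Z_deg_subset w_Z_homogeneous]
  and Z_cof_in_R_Z = subsetD[OF R_Z_deg_subset Z_cof_homogeneous]
  and b_vec_in_R_Z = subsetD[OF R_Z_deg_subset b_vec_homogeneous]

lemma lead_col_bounds: "l < 3 \<Longrightarrow> 1 \<le> lead_col c l \<and> lead_col c l \<le> 3 * c + 3"
  using mult_le_mono[of "c + 1" "c + 1" l 2] by (auto simp: lead_col_def)

lemma block_index_less: "l < 3 \<Longrightarrow> k \<le> m \<Longrightarrow> (m + 1) * l + k < 3 * (m + 1)" for l :: nat
  using mult_le_mono[of "m + 1" "m + 1" l 2] by auto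

section \<open>Syzygies of three specialized binary forms\<close>

text \<open>The factor \<open>e = \<plusminus>1\<close> accounts for the sign in the second entries of \<open>\<sigma>\<close> and \<open>d\<^sub>3\<close>.\<close>

lemma triple_product:
  fixes e :: "'b::field"
  assumes "e * e = 1" "a * p + b * q + d * r = 1" "u * a + v * b + x * d = 0"
  shows "(r * u - p * x) * d + - e * (p * v - q * u) * (e * b) = u"
    "- e * (q * x - r * v) * (e * d) + - e * (p * v - q * u) * (- (e * a)) = v"
    "- e * (q * x - r * v) * (- (e * b)) + (r * u - p * x) * (- a) = x"
proof -
  show "(r * u - p * x) * d + - e * (p * v - q * u) * (e * b) = u" using assms by Groebner_Basis.algebra
  show "- e * (q * x - r * v) * (e * d) + - e * (p * v - q * u) * (- (e * a)) = v" using assms by Groebner_Basis.algebra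
  show "- e * (q * x - r * v) * (- (e * b)) + (r * u - p * x) * (- a) = x" using assms by Groebner_Basis.algebra
qed

lemma cross_product_kernel:
  fixes e :: "'b::field"
  assumes "e * e = 1" "a * p + b * q + d * r = 1" "p * x - e * q * y + r * z = 0"
    "y * d + e * z * b = 0" "e * x * d - e * z * a = 0" "e * x * b + y * a = 0"
  shows "x = 0" "y = 0" "z = 0"
proof -
  show "x = 0" using assms by Groebner_Basis.algebra
  show "y = 0" using assms by Groebner_Basis.algebra
  show "z = 0" using assms by Groebner_Basis.algebra
qed

text \<open>The variables \<open>z\<^bsub>i,j\<^esub>\<close> take values in a field. The embedding into the field of fractions is one such
  specialization; those with values in \<open>k\<close> are the others of interest.\<close>

locale specialization = comm_ring_hom h for h :: "zpoly \<Rightarrow> 'q::field" +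
  fixes c :: nat
  assumes c_pos: "c > 0"
begin

text \<open>The form \<open>G\<^bsub>l+1\<^esub>\<close> and the entry \<open>(l, i)\<close> of \<open>d\<^sub>2\<close> at \<open>y = 1\<close>, followed by the entries of \<open>d\<^sub>3\<close>, up to
  sign, and of \<open>\<sigma>\<close>.\<close>

definition form :: "nat \<Rightarrow> 'q poly" where
  "form l = (\<Sum>i\<le>2 * c. monom (h (zvar i (l + 1))) i)"

definition syz :: "nat \<Rightarrow> nat \<Rightarrow> 'q poly" where
  "syz i l = (\<Sum>k\<le>c. monom (h (b_vec c (lead_col c i) $ ((c + 1) * l + k))) k)"

definition w :: 'q where "w = h (w_Z c)"

definition z0 :: "nat \<Rightarrow> 'q" where "z0 l = h (zvar 0 (l + 1))"

definition splitting :: "nat \<Rightarrow> 'q" where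
  "splitting l = (if l = 1 then (-1) ^ (c + 1) else 1) * h (Z_cof c (l + 1)) / w"

lemma coeff_form: "coeff (form l) i = (if i \<le> 2 * c then h (zvar i (l + 1)) else 0)"
  by (simp add: form_def coeff_sum)

lemma coeff_syz: "coeff (syz i l) k = (if k \<le> c then h (b_vec c (lead_col c i) $ ((c + 1) * l + k)) else 0)"
  by (simp add: syz_def coeff_sum)

text \<open>The matrix \<open>A\<^sup>(\<^sup>m\<^sup>)\<close> describes the map \<open>V \<mapsto> \<Sum> V\<^sub>l G\<^sub>l\<close> on triples of forms of degree \<open>m\<close>.\<close>

lemma A_mat_mult_eq_coeff:
  assumes r: "r < 2 * c + m + 1" and V: "\<And>l k. l < 3 \<Longrightarrow> k > m \<Longrightarrow> coeff (V l) k = 0"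
  shows "(\<Sum>q<3 * (m + 1). h (A_mat c m $$ (r, q)) * coeff (V (q div (m + 1))) (q mod (m + 1))) =
    coeff (\<Sum>l<3. V l * form l) r"
proof -
  have "(\<Sum>q<3 * (m + 1). h (A_mat c m $$ (r, q)) * coeff (V (q div (m + 1))) (q mod (m + 1))) =
      (\<Sum>l<3. \<Sum>k<m + 1. h (A_mat c m $$ (r, (m + 1) * l + k)) *
         coeff (V (((m + 1) * l + k) div (m + 1))) (((m + 1) * l + k) mod (m + 1)))"
    by (rule sum_lessThan_blocks)
  also have "\<dots> = (\<Sum>l<3. coeff (V l * form l) r)"
  proof (rule sum.cong[OF refl])
    fix l :: nat assume "l \<in> {..<3}"
    then have l: "l < 3" by simp
    have entry: "h (A_mat c m $$ (r, (m + 1) * l + k)) * coeff (V (((m + 1) * l + k) div (m + 1))) (((m + 1) * l + k) mod (m + 1))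
        = (if k \<le> r then coeff (V l) k * coeff (form l) (r - k) else 0)" if "k < m + 1" for k
    proof -
      have "((m + 1) * l + k) div (m + 1) = l" "((m + 1) * l + k) mod (m + 1) = k"
        using that by (auto intro!: div_nat_eqI simp: less_Suc_eq_le simp del: mult_Suc)
      then show ?thesis
        using A_mat_index[OF r l, of k] that by (simp add: coeff_form)
    qed
    have "(\<Sum>k<m + 1. h (A_mat c m $$ (r, (m + 1) * l + k)) *
         coeff (V (((m + 1) * l + k) div (m + 1))) (((m + 1) * l + k) mod (m + 1))) =
       (\<Sum>k<m + 1. if k \<le> r then coeff (V l) k * coeff (form l) (r - k) else 0)"
      using entry by (intro sum.cong) auto
    also have "\<dots> = (\<Sum>k\<in>{..m} \<inter> {..r}. coeff (V l) k * coeff (form l) (r - k))"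
      by (simp only: Suc_eq_plus1[symmetric] lessThan_Suc_atMost sum.inter_restrict finite_atMost atMost_iff)
    also have "\<dots> = (\<Sum>k\<le>r. coeff (V l) k * coeff (form l) (r - k))"
      using V[OF l] by (intro sum.mono_neutral_left) auto
    finally show "(\<Sum>k<m + 1. h (A_mat c m $$ (r, (m + 1) * l + k)) *
         coeff (V (((m + 1) * l + k) div (m + 1))) (((m + 1) * l + k) mod (m + 1))) = coeff (V l * form l) r"
      by (simp add: coeff_mult)
  qed
  finally show ?thesis by (simp add: coeff_sum)
qed

lemma coeff_combination_zero:
  assumes r: "r > 2 * c + m" and V: "\<And>l k. l < 3 \<Longrightarrow> k > m \<Longrightarrow> coeff (V l) k = 0"
  shows "coeff (\<Sum>l<3. V l * form l) r = 0"
  unfolding coeff_sum coeff_mult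
proof (intro sum.neutral ballI)
  fix l i assume "l \<in> {..<3::nat}" "i \<in> {..r}"
  then show "coeff (V l) i * coeff (form l) (r - i) = 0"
    using r V[of l i] by (cases "i > m") (auto simp: coeff_form)
qed

lemma syz_relation:
  assumes i: "i < 3"
  shows "(\<Sum>l<3. syz i l * form l) = 0"
proof (rule poly_eqI)
  fix r
  have V: "coeff (syz i l) k = 0" if "k > c" for l k using that by (simp add: coeff_syz)
  show "coeff (\<Sum>l<3. syz i l * form l) r = coeff 0 r"
  proof (cases "r < 2 * c + c + 1")
    case True
    have "coeff (\<Sum>l<3. syz i l * form l) r =
        (\<Sum>q<3 * (c + 1). h (A_mat c c $$ (r, q)) * coeff (syz i (q div (c + 1))) (q mod (c + 1)))"
      using A_mat_mult_eq_coeff[OF True, of "syz i"] V by simp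
    also have "\<dots> = (\<Sum>q<3 * c + 3. h (A_mat c c $$ (r, q) * b_vec c (lead_col c i) $ q))"
    proof (rule sum.cong)
      fix q
      have "q mod (c + 1) \<le> c" by (metis Suc_eq_plus1 less_Suc_eq_le mod_less_divisor zero_less_Suc)
      then show "h (A_mat c c $$ (r, q)) * coeff (syz i (q div (c + 1))) (q mod (c + 1)) =
          h (A_mat c c $$ (r, q) * b_vec c (lead_col c i) $ q)"
        by (simp add: coeff_syz hom_mult del: mult_Suc)
    qed simp
    also have "\<dots> = h (\<Sum>q<3 * c + 3. A_mat c c $$ (r, q) * b_vec c (lead_col c i) $ q)"
      by (simp add: hom_sum)
    also have "\<dots> = 0"
      using A_mat_mult_b_vec[of "lead_col c i" c r] lead_col_bounds[OF i, of c] True by simp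
    finally show ?thesis by simp
  qed (use coeff_combination_zero[of c r "syz i"] V in simp)
qed

text \<open>By the description of \<open>A\<^sup>(\<^sup>c\<^sup>-\<^sup>1\<^sup>)\<close> as a linear map, a syzygy with entries of degree less than \<open>c\<close> is a
  vector in its kernel. The direction from right to left shows later that \<open>w\<close> does not vanish
  under suitable specializations.\<close>

lemma w_nonzero_iff:
  "w \<noteq> 0 \<longleftrightarrow> (\<forall>V. (\<forall>l<3. \<forall>k\<ge>c. coeff (V l) k = 0) \<longrightarrow> (\<Sum>l<3. V l * form l) = 0 \<longrightarrow> (\<forall>l<3. V l = 0))"
proof -
  define A where "A = map_mat h (A_mat c (c - 1))"
  have A: "A \<in> carrier_mat (3 * c) (3 * c)" using c_pos by (simp add: A_def carrier_matI)
  have w: "w = det A" by (simp add: w_def w_Z_def A_def)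
  have mult: "(A *\<^sub>v v) $ r = coeff (\<Sum>l<3. V l * form l) r"
    if v: "v \<in> carrier_vec (3 * c)" and vV: "\<And>q. q < 3 * c \<Longrightarrow> v $ q = coeff (V (q div c)) (q mod c)"
      and V: "\<forall>l<3. \<forall>k\<ge>c. coeff (V l) k = 0" and r: "r < 3 * c" for v V r
  proof -
    have "(A *\<^sub>v v) $ r = (\<Sum>q<3 * c. h (A_mat c (c - 1) $$ (r, q)) * coeff (V (q div c)) (q mod c))"
      using r A v vV by (auto simp: scalar_prod_def A_def lessThan_atLeast0 intro!: sum.cong)
    then show ?thesis using A_mat_mult_eq_coeff[of r "c - 1" V] V r c_pos by simp
  qed
  show ?thesis
  proof (intro iffI allI impI)
    fix V l assume "w \<noteq> 0" and V: "\<forall>l<3. \<forall>k\<ge>c. coeff (V l) k = 0" "(\<Sum>l<3. V l * form l) = 0" and l: "l < (3::nat)"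
    define v where "v = vec (3 * c) (\<lambda>q. coeff (V (q div c)) (q mod c))"
    have "A *\<^sub>v v = 0\<^sub>v (3 * c)"
      using mult[of v V] V A by (intro eq_vecI) (auto simp: v_def)
    moreover have "v \<in> carrier_vec (3 * c)" by (simp add: v_def)
    ultimately have "v \<noteq> 0\<^sub>v (3 * c) \<Longrightarrow> det A = 0"
      by (intro iffD2[OF det_0_iff_vec_prod_zero_field[OF A]] exI[of _ v] conjI)
    then have "v = 0\<^sub>v (3 * c)" using \<open>w \<noteq> 0\<close> unfolding w by blast
    then have "v $ q = 0" if "q < 3 * c" for q using that by simp
    then have zero: "coeff (V (q div c)) (q mod c) = 0" if "q < 3 * c" for q
      using that unfolding v_def by simp
    show "V l = 0"
    proof (rule poly_eqI)
      fix k show "coeff (V l) k = coeff 0 k"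
        using zero[of "c * l + k"] V l block_index_less[of l k "c - 1"] c_pos by (cases "k < c") auto
    qed
  next
    assume inj: "\<forall>V. (\<forall>l<3. \<forall>k\<ge>c. coeff (V l) k = 0) \<longrightarrow> (\<Sum>l<3. V l * form l) = 0 \<longrightarrow> (\<forall>l<3. V l = 0)"
    show "w \<noteq> 0"
    proof
      assume "w = 0"
      then have "det A = 0" by (simp only: w)
      then have "\<exists>v. v \<in> carrier_vec (3 * c) \<and> v \<noteq> 0\<^sub>v (3 * c) \<and> A *\<^sub>v v = 0\<^sub>v (3 * c)"
        by (rule iffD1[OF det_0_iff_vec_prod_zero_field[OF A]])
      then obtain v where v: "v \<in> carrier_vec (3 * c)" "v \<noteq> 0\<^sub>v (3 * c)" "A *\<^sub>v v = 0\<^sub>v (3 * c)"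
        by (elim exE conjE)
      define V where "V l = (\<Sum>k<c. monom (v $ (c * l + k)) k)" for l
      have coeff_V: "coeff (V l) k = (if k < c then v $ (c * l + k) else 0)" for l k
        by (simp add: V_def coeff_sum)
      have "(\<Sum>l<3. V l * form l) = 0"
      proof (rule poly_eqI)
        fix r show "coeff (\<Sum>l<3. V l * form l) r = coeff 0 r"
        proof (cases "r < 3 * c")
          case True
          then show ?thesis using mult[of v V r] v c_pos by (simp add: coeff_V)
        next
          case False
          then show ?thesis using coeff_combination_zero[of "c - 1" r V] c_pos by (auto simp: coeff_V)
        qed
      qed
      then have V: "V l = 0" if "l < 3" for l using inj that by (simp add: coeff_V)
      have "v $ q = 0" if "q < 3 * c" for q
      proof -
        have "q div c < 3" using that c_pos by (simp add: less_mult_imp_div_less)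
        then show ?thesis using V[of "q div c"] coeff_V[of "q div c" "q mod c"] c_pos by simp
      qed
      then have "v = 0\<^sub>v (3 * c)" using v by (intro eq_vecI) auto
      then show False using v by simp
    qed
  qed
qed

lemma form_0: "coeff (form l) 0 = z0 l"
  by (simp add: coeff_form z0_def)

text \<open>The coefficients at \<open>y\<^sup>c\<close> of the entries of \<open>d\<^sub>2\<close> are minors of \<open>A\<^sup>(\<^sup>c\<^sup>)\<close> without two of the three
  leading columns, hence multiples of \<open>w\<close>.\<close>

lemma coeff_syz_0:
  shows "coeff (syz 0 0) 0 = 0" "coeff (syz 0 1) 0 = (-1) ^ c * z0 2 * w" "coeff (syz 0 2) 0 = - ((-1) ^ c * z0 1 * w)"
    and "coeff (syz 1 0) 0 = z0 2 * w" "coeff (syz 1 1) 0 = 0" "coeff (syz 1 2) 0 = - (z0 0 * w)"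
    and "coeff (syz 2 0) 0 = (-1) ^ c * z0 1 * w" "coeff (syz 2 1) 0 = - ((-1) ^ c * z0 0 * w)" "coeff (syz 2 2) 0 = 0"
proof -
  have b: "b_vec c i $ (lead_col c l - 1) =
      (if lead_col c l < i then (-1) ^ (lead_col c l + 1) * A_minor c (lead_col c l) i
       else if lead_col c l = i then 0 else (-1) ^ lead_col c l * A_minor c i (lead_col c l))" if "l < 3" for i l
  proof -
    have "lead_col c l - 1 < 3 * c + 3" "lead_col c l - 1 + 1 = lead_col c l"
      using lead_col_bounds[OF that, of c] by auto
    then show ?thesis unfolding b_vec_def Let_def index_vec[OF \<open>lead_col c l - 1 < 3 * c + 3\<close>] by simp
  qed
  have coeff: "coeff (syz i l) 0 = h (b_vec c (lead_col c i) $ (lead_col c l - 1))" for i l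
    by (simp add: coeff_syz lead_col_def)
  have lead: "lead_col c 0 = 1" "lead_col c (Suc 0) = c + 2" "lead_col c 1 = c + 2" "lead_col c 2 = 2 * c + 3"
    by (simp_all add: lead_col_def)
  note minors = A_minor_lead_cols[OF c_pos, unfolded lead]
  have sign: "(-1) ^ (c + 2) = ((-1) ^ c :: zpoly)" "(-1) ^ (c + 2 + 1) = (- ((-1) ^ c) :: zpoly)"
    "(-1) ^ (2 * c + 3) = (-1 :: zpoly)" "(-1) ^ (1 + 1) = (1 :: zpoly)"
    by (simp_all add: power_add)
  have z: "h (zvar 0 1) = z0 0" "h (zvar 0 2) = z0 1" "h (zvar 0 3) = z0 2"
    by (simp_all add: z0_def numeral_eq_Suc)
  note evaluate = hom_mult hom_uminus hom_power hom_one hom_zero z z[simplified] w_def[symmetric] minors minors[simplified]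
  show "coeff (syz 0 0) 0 = 0" "coeff (syz 1 1) 0 = 0" "coeff (syz 2 2) 0 = 0"
    unfolding coeff using b[of 0 "lead_col c 0"] b[of 1 "lead_col c 1"] b[of 2 "lead_col c 2"] by (simp_all only: lead) simp_all
  show "coeff (syz 0 1) 0 = (-1) ^ c * z0 2 * w"
    unfolding coeff using b[of 1 "lead_col c 0"] by (simp only: lead sign) (simp add: evaluate)
  show "coeff (syz 0 2) 0 = - ((-1) ^ c * z0 1 * w)"
    unfolding coeff using b[of 2 "lead_col c 0"] by (simp only: lead sign) (simp add: evaluate)
  show "coeff (syz 1 0) 0 = z0 2 * w"
    unfolding coeff using b[of 0 "lead_col c 1"] by (simp only: lead sign) (simp add: evaluate)
  show "coeff (syz 1 2) 0 = - (z0 0 * w)"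
    unfolding coeff using b[of 2 "lead_col c 1"] by (simp only: lead sign) (simp add: evaluate)
  show "coeff (syz 2 0) 0 = (-1) ^ c * z0 1 * w"
    unfolding coeff using b[of 0 "lead_col c 2"] by (simp only: lead sign) (simp add: evaluate)
  show "coeff (syz 2 1) 0 = - ((-1) ^ c * z0 0 * w)"
    unfolding coeff using b[of 1 "lead_col c 2"] by (simp only: lead sign) (simp add: evaluate)
qed

lemma sum_z0_Z_cof: "(\<Sum>l<3. z0 l * h (Z_cof c (l + 1))) = w"
  using arg_cong[OF sum_zvar_Z_cof[OF c_pos], of h] by (simp add: hom_sum hom_mult z0_def w_def)

end

text \<open>The same with coefficients in a subring \<open>R\<close> that contains the inverse of \<open>w\<close>.\<close>

locale unit_specialization = specialization +
  fixes R :: "'a set"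
  assumes R_closed: "ring_closed R"
    and h_in_R: "p \<in> R_Z c \<Longrightarrow> h p \<in> R"
    and w_nonzero: "w \<noteq> 0"
    and inverse_w_in_R: "inverse w \<in> R"
begin

lemma coeff_syz_in_R: "i < 3 \<Longrightarrow> l < 3 \<Longrightarrow> coeff (syz i l) k \<in> R"
  using block_index_less[of l k c] lead_col_bounds[of i c]
  by (auto simp: coeff_syz ring_closed_zero[OF R_closed] intro!: h_in_R b_vec_in_R_Z)

lemma splitting_in_R: "l < 3 \<Longrightarrow> splitting l \<in> R"
  unfolding splitting_def divide_inverse
  by (intro ring_closed_mult[OF R_closed])
    (auto intro!: ring_closed_intros[OF R_closed] inverse_w_in_R h_in_R Z_cof_in_R_Z[OF c_pos, simplified])

text \<open>Up to signs and the factor \<open>w\<close>, the matrix of the values \<open>coeff (syz i l) 0\<close> is that of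
  the cross product with the vector \<open>z0\<close>. Its image is the orthogonal complement of \<open>z0\<close>, and
  the triple product formula \<open>(\<zeta> \<times> t) \<times> z0 = (\<zeta> \<cdot> z0) t - (t \<cdot> z0) \<zeta>\<close> gives a preimage of \<open>t\<close>.\<close>

lemma lead_coeff_preimage:
  assumes t: "\<And>l. l < 3 \<Longrightarrow> t l \<in> R" "(\<Sum>l<3. t l * z0 l) = 0"
  obtains s where "\<And>i. i < 3 \<Longrightarrow> s i \<in> R" "(\<Sum>i<3. splitting i * s i) = 0"
    "\<And>l. l < 3 \<Longrightarrow> (\<Sum>i<3. s i * coeff (syz i l) 0) = t l"
proof -
  define e :: 'a where "e = (-1) ^ c"
  have e: "e * e = 1" by (simp add: e_def power_add[symmetric])
  define \<zeta> where "\<zeta> l = h (Z_cof c (l + 1)) * inverse w" for l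
  have \<zeta>_R: "\<zeta> l \<in> R" if "l < 3" for l
    unfolding \<zeta>_def using that
    by (intro ring_closed_mult[OF R_closed] inverse_w_in_R h_in_R Z_cof_in_R_Z[OF c_pos])
  have "(\<Sum>l<3. z0 l * \<zeta> l) = w * inverse w"
    by (simp add: \<zeta>_def mult.assoc[symmetric] sum_distrib_right[symmetric] sum_z0_Z_cof[simplified])
  then have \<zeta>: "z0 0 * \<zeta> 0 + z0 1 * \<zeta> 1 + z0 2 * \<zeta> 2 = 1"
    using w_nonzero by (simp add: sum_lessThan_3)
  define s where "s i = inverse w * (if i = 0 then - e * (\<zeta> 1 * t 2 - \<zeta> 2 * t 1)
      else if i = 1 then \<zeta> 2 * t 0 - \<zeta> 0 * t 2 else - e * (\<zeta> 0 * t 1 - \<zeta> 1 * t 0))" for i :: nat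
  have e_R: "e \<in> R" unfolding e_def by (intro ring_closed_intros[OF R_closed])
  show thesis
  proof
    show "s i \<in> R" if "i < 3" for i
      unfolding s_def using that by (auto intro!: ring_closed_intros[OF R_closed] inverse_w_in_R e_R \<zeta>_R t)
    have "splitting 0 = \<zeta> 0" "splitting 1 = - e * \<zeta> 1" "splitting 2 = \<zeta> 2"
      by (simp_all add: splitting_def \<zeta>_def e_def field_simps)
    then show "(\<Sum>i<3. splitting i * s i) = 0"
      by (simp add: sum_lessThan_3 s_def algebra_simps)
    have t: "t 0 * z0 0 + t 1 * z0 1 + t 2 * z0 2 = 0" using t(2) by (simp add: sum_lessThan_3)
    have cancel: "inverse w * x * (y * w) = x * y" for x y using w_nonzero by simp
    have "(\<Sum>i<3. s i * coeff (syz i 0) 0) = inverse w * (\<zeta> 2 * t 0 - \<zeta> 0 * t 2) * (z0 2 * w)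
        + inverse w * (- e * (\<zeta> 0 * t 1 - \<zeta> 1 * t 0)) * (e * z0 1 * w)"
      by (simp add: sum_lessThan_3 coeff_syz_0 coeff_syz_0[simplified] s_def e_def)
    also have "\<dots> = t 0"
      unfolding cancel using triple_product(1)[OF e \<zeta> t] by simp
    finally have 0: "(\<Sum>i<3. s i * coeff (syz i 0) 0) = t 0" .
    have "(\<Sum>i<3. s i * coeff (syz i 1) 0) = inverse w * (- e * (\<zeta> 1 * t 2 - \<zeta> 2 * t 1)) * (e * z0 2 * w)
        + inverse w * (- e * (\<zeta> 0 * t 1 - \<zeta> 1 * t 0)) * (- (e * z0 0) * w)"
      by (simp add: sum_lessThan_3 coeff_syz_0 coeff_syz_0[simplified] s_def e_def)
    also have "\<dots> = t 1"
      unfolding cancel using triple_product(2)[OF e \<zeta> t] by simp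
    finally have 1: "(\<Sum>i<3. s i * coeff (syz i 1) 0) = t 1" .
    have "(\<Sum>i<3. s i * coeff (syz i 2) 0) = inverse w * (- e * (\<zeta> 1 * t 2 - \<zeta> 2 * t 1)) * (- (e * z0 1) * w)
        + inverse w * (\<zeta> 2 * t 0 - \<zeta> 0 * t 2) * (- z0 0 * w)"
      by (simp add: sum_lessThan_3 coeff_syz_0 coeff_syz_0[simplified] s_def e_def)
    also have "\<dots> = t 2"
      unfolding cancel using triple_product(3)[OF e \<zeta> t] by simp
    finally have 2: "(\<Sum>i<3. s i * coeff (syz i 2) 0) = t 2" .
    show "(\<Sum>i<3. s i * coeff (syz i l) 0) = t l" if "l < 3" for l
    proof -
      have "l = 0 \<or> l = 1 \<or> l = 2" using that by auto
      then show ?thesis using 0 1 2 by auto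
    qed
  qed
qed

text \<open>Up to signs this is the triple product formula \<open>\<zeta> \<times> (s \<times> z0) = (\<zeta> \<cdot> z0) s - (\<zeta> \<cdot> s) z0\<close> with \<open>\<zeta> \<cdot> z0 = 1\<close>.\<close>

lemma lead_coeff_injective:
  assumes "(\<Sum>i<3. splitting i * s i) = 0" "\<And>l. l < 3 \<Longrightarrow> (\<Sum>i<3. s i * coeff (syz i l) 0) = 0" "i < 3"
  shows "s i = 0"
proof -
  define e :: 'a where "e = (-1) ^ c"
  have e: "e * e = 1" by (simp add: e_def power_add[symmetric])
  define \<zeta> where "\<zeta> l = h (Z_cof c (l + 1)) * inverse w" for l
  have "(\<Sum>l<3. z0 l * \<zeta> l) = w * inverse w"
    by (simp add: \<zeta>_def mult.assoc[symmetric] sum_distrib_right[symmetric] sum_z0_Z_cof[simplified])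
  then have \<zeta>: "z0 0 * \<zeta> 0 + z0 1 * \<zeta> 1 + z0 2 * \<zeta> 2 = 1"
    using w_nonzero by (simp add: sum_lessThan_3)
  have "splitting 0 = \<zeta> 0" "splitting 1 = - e * \<zeta> 1" "splitting 2 = \<zeta> 2"
    by (simp_all add: splitting_def \<zeta>_def e_def field_simps)
  then have s: "\<zeta> 0 * s 0 - e * \<zeta> 1 * s 1 + \<zeta> 2 * s 2 = 0"
    using assms(1) by (simp add: sum_lessThan_3)
  have "(s 1 * z0 2 + e * s 2 * z0 1) * w = 0"
    using assms(2)[of 0] by (simp add: sum_lessThan_3 coeff_syz_0 coeff_syz_0[simplified] e_def algebra_simps)
  then have 0: "s 1 * z0 2 + e * s 2 * z0 1 = 0" using w_nonzero by simp
  have "(e * s 0 * z0 2 - e * s 2 * z0 0) * w = 0"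
    using assms(2)[of 1] by (simp add: sum_lessThan_3 coeff_syz_0 coeff_syz_0[simplified] e_def algebra_simps)
  then have 1: "e * s 0 * z0 2 - e * s 2 * z0 0 = 0" using w_nonzero by simp
  have "(\<Sum>i<3. s i * coeff (syz i 2) 0) = - ((e * s 0 * z0 1 + s 1 * z0 0) * w)"
    by (simp add: sum_lessThan_3 coeff_syz_0 coeff_syz_0[simplified] e_def algebra_simps)
  then have "(e * s 0 * z0 1 + s 1 * z0 0) * w = 0"
    using assms(2)[of 2] by simp
  then have 2: "e * s 0 * z0 1 + s 1 * z0 0 = 0" using w_nonzero by simp
  have "s 0 = 0" "s 1 = 0" "s 2 = 0" using cross_product_kernel[OF e \<zeta> s 0 1 2] by auto
  moreover have "i = 0 \<or> i = 1 \<or> i = 2" using assms(3) by auto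
  ultimately show ?thesis by auto
qed

text \<open>A syzygy of degree at least \<open>c\<close> can be corrected by a combination of
  the three given syzygies so that its values at \<open>0\<close> vanish, and then be divided by the variable.
  Below degree \<open>c\<close> there are no syzygies, which ends the process.\<close>

lemma syzygy_is_combination:
  assumes "\<And>l k. l < 3 \<Longrightarrow> coeff (V l) k \<in> R" "\<And>l k. l < 3 \<Longrightarrow> k \<ge> c + m \<Longrightarrow> coeff (V l) k = 0"
    and "(\<Sum>l<3. V l * form l) = 0"
  shows "\<exists>s. (\<forall>i<3. \<forall>k. coeff (s i) k \<in> R) \<and> (\<forall>i<3. \<forall>k\<ge>m. coeff (s i) k = 0) \<and>
    (\<Sum>i<3. smult (splitting i) (s i)) = 0 \<and> (\<forall>l<3. (\<Sum>i<3. s i * syz i l) = V l)"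
  using assms
proof (induction m arbitrary: V)
  case 0
  then have "V l = 0" if "l < 3" for l
    using w_nonzero_iff w_nonzero that by auto
  then show ?case by (intro exI[of _ "\<lambda>_. 0"]) (auto simp: ring_closed_zero[OF R_closed])
next
  case (Suc m)
  have "coeff (\<Sum>l<3. V l * form l) 0 = 0" using Suc.prems(3) by simp
  then have t: "(\<Sum>l<3. coeff (V l) 0 * z0 l) = 0"
    by (simp add: coeff_sum coeff_mult form_0)
  obtain a where a: "\<And>i. i < 3 \<Longrightarrow> a i \<in> R" "(\<Sum>i<3. splitting i * a i) = 0"
    "\<And>l. l < 3 \<Longrightarrow> (\<Sum>i<3. a i * coeff (syz i l) 0) = coeff (V l) 0"
    using lead_coeff_preimage[of "\<lambda>l. coeff (V l) 0", OF _ t] Suc.prems(1) by blast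
  \<comment> \<open>\<open>U\<close> vanishes at \<open>0\<close>; dividing it by the variable gives \<open>V'\<close>, to which the induction hypothesis applies.\<close>
  define U where "U l = V l - (\<Sum>i<3. smult (a i) (syz i l))" for l
  define V' where "V' l = poly_shift 1 (U l)" for l
  have U: "U l = pCons 0 (V' l)" if "l < 3" for l
  proof (rule poly_eqI)
    fix k
    have "coeff (U l) 0 = 0" using a(3)[OF that] by (simp add: U_def coeff_sum)
    then show "coeff (U l) k = coeff (pCons 0 (V' l)) k"
      by (cases k) (simp_all add: V'_def coeff_poly_shift)
  qed
  have "(\<Sum>l<3. (\<Sum>i<3. smult (a i) (syz i l)) * form l) = (\<Sum>i<3. smult (a i) (\<Sum>l<3. syz i l * form l))"
    by (simp add: sum_lessThan_3 algebra_simps smult_add_right)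
  also have "\<dots> = 0" by (simp add: syz_relation)
  finally have "(\<Sum>l<3. U l * form l) = 0"
    using Suc.prems(3) by (simp add: U_def left_diff_distrib sum_subtractf)
  moreover have "(\<Sum>l<3. U l * form l) = pCons 0 (\<Sum>l<3. V' l * form l)"
    by (simp add: sum_lessThan_3 U)
  ultimately have V'_syz: "(\<Sum>l<3. V' l * form l) = 0" by simp
  have "coeff (V' l) k \<in> R" if "l < 3" for l k
    using that a(1) Suc.prems(1) coeff_syz_in_R[OF _ that]
    by (auto simp: V'_def U_def coeff_poly_shift coeff_sum intro!: ring_closed_intros[OF R_closed])
  moreover have "coeff (V' l) k = 0" if "l < 3" "k \<ge> c + m" for l k
    using that Suc.prems(2)[of l "k + 1"] by (simp add: V'_def U_def coeff_poly_shift coeff_sum coeff_syz)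
  ultimately obtain s where s: "\<And>i k. i < 3 \<Longrightarrow> coeff (s i) k \<in> R" "\<And>i k. i < 3 \<Longrightarrow> k \<ge> m \<Longrightarrow> coeff (s i) k = 0"
    "(\<Sum>i<3. smult (splitting i) (s i)) = 0" "\<And>l. l < 3 \<Longrightarrow> (\<Sum>i<3. s i * syz i l) = V' l"
    using Suc.IH[of V'] V'_syz by blast
  show ?case
  proof (intro exI[of _ "\<lambda>i. pCons (a i) (s i)"] conjI allI impI)
    fix i k assume "i < (3::nat)"
    then show "coeff (pCons (a i) (s i)) k \<in> R" using a s by (cases k) auto
  next
    fix i k assume "i < (3::nat)" "k \<ge> Suc m"
    then show "coeff (pCons (a i) (s i)) k = 0" using s by (cases k) auto
  next
    have "(\<Sum>i<3. smult (splitting i) (pCons (a i) (s i))) =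
        pCons (\<Sum>i<3. splitting i * a i) (\<Sum>i<3. smult (splitting i) (s i))"
      by (simp add: sum_lessThan_3)
    then show "(\<Sum>i<3. smult (splitting i) (pCons (a i) (s i))) = 0" using a s by simp
  next
    fix l assume l: "l < (3::nat)"
    have "(\<Sum>i<3. pCons (a i) (s i) * syz i l) = (\<Sum>i<3. smult (a i) (syz i l)) + pCons 0 (\<Sum>i<3. s i * syz i l)"
      by (simp add: sum_lessThan_3 algebra_simps)
    also have "\<dots> = V l" using s(4)[OF l] U[OF l] by (simp add: U_def algebra_simps)
    finally show "(\<Sum>i<3. pCons (a i) (s i) * syz i l) = V l" .
  qed
qed

text \<open>By \<open>lead_coeff_injective\<close> the constant coefficients of the \<open>s\<^sub>i\<close> vanish, so all \<open>s\<^sub>i\<close> can be divided by the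
  variable.\<close>

lemma combination_injective:
  assumes "\<forall>i<3. \<forall>k\<ge>m. coeff (s i) k = 0" "(\<Sum>i<3. smult (splitting i) (s i)) = 0"
    and "\<forall>l<3. (\<Sum>i<3. s i * syz i l) = 0"
  shows "\<forall>i<3. s i = 0"
  using assms
proof (induction m arbitrary: s)
  case 0
  then show ?case by (simp add: poly_eq_iff)
next
  case (Suc m)
  define s' where "s' i = poly_shift 1 (s i)" for i
  have "coeff (\<Sum>i<3. smult (splitting i) (s i)) 0 = 0" using Suc.prems(2) by simp
  then have sigma: "(\<Sum>i<3. splitting i * coeff (s i) 0) = 0" by (simp add: coeff_sum)
  have "(\<Sum>i<3. coeff (s i) 0 * coeff (syz i l) 0) = 0" if l: "l < 3" for l
  proof -
    have "coeff (\<Sum>i<3. s i * syz i l) 0 = 0" using Suc.prems(3) l by simp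
    then show ?thesis by (simp add: coeff_sum coeff_mult)
  qed
  then have zero: "coeff (s i) 0 = 0" if "i < 3" for i
    using lead_coeff_injective[of "\<lambda>i. coeff (s i) 0", OF sigma _ that] by blast
  have s: "s i = pCons 0 (s' i)" if "i < 3" for i
  proof (rule poly_eqI)
    fix k show "coeff (s i) k = coeff (pCons 0 (s' i)) k"
      using zero[OF that] by (cases k) (simp_all add: s'_def coeff_poly_shift)
  qed
  have s_012: "s 0 = pCons 0 (s' 0)" "s 1 = pCons 0 (s' 1)" "s 2 = pCons 0 (s' 2)"
    by (simp_all only: s)
  have "\<forall>i<3. s' i = 0"
  proof (rule Suc.IH)
    show "\<forall>i<3. \<forall>k\<ge>m. coeff (s' i) k = 0"
      using Suc.prems(1) by (simp add: s'_def coeff_poly_shift)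
    have "pCons 0 (\<Sum>i<3. smult (splitting i) (s' i)) = (\<Sum>i<3. smult (splitting i) (s i))"
      unfolding sum_lessThan_3 s_012 by simp
    then show "(\<Sum>i<3. smult (splitting i) (s' i)) = 0"
      using Suc.prems(2) by simp
    have "pCons 0 (\<Sum>i<3. s' i * syz i l) = (\<Sum>i<3. s i * syz i l)" for l
      unfolding sum_lessThan_3 s_012 by simp
    then show "\<forall>l<3. (\<Sum>i<3. s' i * syz i l) = 0"
      using Suc.prems(3) by (metis pCons_eq_0_iff)
  qed
  then show ?case using s by simp
qed

end

section \<open>The specialized complex over the polynomial ring in two variables\<close>

lemma xy_const_mult: "xy_const a * p = Poly_Mapping.map ((*) a) p"
  unfolding mult_map_scale_conv_mult by (simp add: xy_const_def xy_monom_def zero_prod_def)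

lemma coef_xy_const_mult: "coef (xy_const a * p) e = a * coef p e"
  by (auto simp: xy_const_mult coef_map when_def)

lemma xy_const_mult_homogenize: "xy_const a * homogenize n f = homogenize n (smult a f)"
  by (rule poly_mapping_eqI) (auto simp: coef_xy_const_mult coef_homogenize)

lemma slice_xy_const_mult: "slice n (xy_const a * p) = smult a (slice n p)"
  by (rule poly_eqI) (simp add: coeff_slice coef_xy_const_mult)

lemma homogenize_in_coeffs_in:
  assumes "ring_closed R" "\<And>k. coeff f k \<in> R"
  shows "homogenize n f \<in> coeffs_in R"
  using assms by (auto simp: coeffs_in_def coef_homogenize intro: ring_closed_zero)

lemma xy_const_in_coeffs_in: "ring_closed R \<Longrightarrow> a \<in> R \<Longrightarrow> xy_const a \<in> coeffs_in R"
  unfolding xy_const_def xy_monom_def by (rule coeffs_in_single)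

lemma d2_Z_carrier: "d2_Z c \<in> carrier_mat 3 3"
  by (simp add: d2_Z_def carrier_matI)

lemma d2_Z_index:
  assumes l: "l < 3" and i: "i < 3"
  shows "d2_Z c $$ (l, i) = (\<Sum>k\<le>c. xy_monom k (c - k) (b_vec c (lead_col c i) $ ((c + 1) * l + k)))"
proof -
  have lead: "[1, c + 2, 2 * c + 3] ! i = lead_col c i"
    using i by (auto simp: lead_col_def less_Suc_eq numeral_eq_Suc)
  have dim_b: "dim_vec (b_vec c j) = 3 * (c + 1)" for j by (simp add: b_vec_def)
  define cs where "cs = map (\<lambda>j. N_mat c *\<^sub>v map_vec xy_const (b_vec c j)) [1, c + 2, 2 * c + 3]"
  have "d2_Z c $$ (l, i) = cs ! i $ l"
    unfolding d2_Z_def cs_def[symmetric] using l i by (intro mat_of_cols_index) (auto simp: cs_def)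
  also have "cs ! i = N_mat c *\<^sub>v map_vec xy_const (b_vec c (lead_col c i))"
    unfolding cs_def lead[symmetric] using i by (intro nth_map) simp
  also have "\<dots> $ l = (\<Sum>q<3 * (c + 1). N_mat c $$ (l, q) * xy_const (b_vec c (lead_col c i) $ q))"
    using l dim_b by (auto simp: N_mat_def scalar_prod_def lessThan_atLeast0 intro!: sum.cong)
  also have "\<dots> = (\<Sum>l'<3. \<Sum>k<c + 1. N_mat c $$ (l, (c + 1) * l' + k) * xy_const (b_vec c (lead_col c i) $ ((c + 1) * l' + k)))"
    by (rule sum_lessThan_blocks)
  also have "\<dots> = (\<Sum>l'<3. if l' = l then \<Sum>k<c + 1. xy_monom k (c - k) (b_vec c (lead_col c i) $ ((c + 1) * l + k)) else 0)"
  proof (rule sum.cong[OF refl])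
    fix l' :: nat assume l': "l' \<in> {..<3}"
    have "N_mat c $$ (l, (c + 1) * l' + k) * xy_const (b_vec c (lead_col c i) $ ((c + 1) * l' + k)) =
        (if l' = l then xy_monom k (c - k) (b_vec c (lead_col c i) $ ((c + 1) * l + k)) else 0)" if k: "k < c + 1" for k
    proof -
      have "((c + 1) * l' + k) div (c + 1) = l'" "((c + 1) * l' + k) mod (c + 1) = k"
        using k by (auto intro!: div_nat_eqI simp: less_Suc_eq_le simp del: mult_Suc)
      then have "N_mat c $$ (l, (c + 1) * l' + k) = (if l' = l then xy_monom k (c - k) 1 else 0)"
        using l l' k block_index_less[of l' k c] by (cases "l' = l") (simp_all add: N_mat_def Let_def)
      then show ?thesis by (simp add: xy_monom_def xy_const_def mult_single)
    qed
    then show "(\<Sum>k<c + 1. N_mat c $$ (l, (c + 1) * l' + k) * xy_const (b_vec c (lead_col c i) $ ((c + 1) * l' + k))) =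
        (if l' = l then \<Sum>k<c + 1. xy_monom k (c - k) (b_vec c (lead_col c i) $ ((c + 1) * l + k)) else 0)"
      by (simp cong: sum.cong_simp)
  qed
  also have "\<dots> = (\<Sum>k<c + 1. xy_monom k (c - k) (b_vec c (lead_col c i) $ ((c + 1) * l + k)))"
    using l by simp
  finally show ?thesis by (simp only: Suc_eq_plus1[symmetric] lessThan_Suc_atMost)
qed

lemma d1_Z_carrier: "d1_Z c \<in> carrier_mat 1 3"
  by (simp add: d1_Z_def mat_of_rows_list_def)

lemma d1_Z_index: "l < 3 \<Longrightarrow> d1_Z c $$ (0, l) = (\<Sum>i\<le>2 * c. xy_monom i (2 * c - i) (zvar i (l + 1)))"
  by (auto simp: d1_Z_def mat_of_rows_list_def G_Z_def atMost_atLeast0 less_Suc_eq numeral_eq_Suc)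

lemma mult_mat_vec_1_3:
  fixes M :: "'b::comm_ring_1 mat"
  assumes "M \<in> carrier_mat 1 3" "v \<in> carrier_vec 3"
  shows "M *\<^sub>v v = vec 1 (\<lambda>_. \<Sum>l<3. v $ l * M $$ (0, l))"
  using assms by (intro eq_vecI) (auto simp: scalar_prod_def lessThan_atLeast0 mult.commute intro!: sum.cong)

lemma mult_mat_vec_3_3:
  fixes M :: "'b::comm_ring_1 mat"
  assumes "M \<in> carrier_mat 3 3" "v \<in> carrier_vec 3"
  shows "M *\<^sub>v v = vec 3 (\<lambda>l. \<Sum>i<3. v $ i * M $$ (l, i))"
  using assms by (intro eq_vecI) (auto simp: scalar_prod_def lessThan_atLeast0 mult.commute intro!: sum.cong)

context specialization
begin

definition d1_mat :: "'q bipoly mat" where "d1_mat = map_mat (Poly_Mapping.map h) (d1_Z c)"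
definition d2_mat :: "'q bipoly mat" where "d2_mat = map_mat (Poly_Mapping.map h) (d2_Z c)"

definition sigma :: "'q bipoly vec \<Rightarrow> 'q bipoly" where
  "sigma v = (\<Sum>i<3. xy_const (splitting i) * v $ i)"

sublocale total: hom_on UNIV h
  by unfold_locales (auto simp: hom_add hom_mult)

lemma map_h_sum_monoms:
  "Poly_Mapping.map h (\<Sum>k\<le>n. xy_monom k (n - k) (f k)) = (\<Sum>k\<le>n. xy_monom k (n - k) (h (f k)))"
  by (simp add: total.map_hom_sum xy_monom_def total.map_hom_single)

lemma d1_mat_carrier: "d1_mat \<in> carrier_mat 1 3"
  using d1_Z_carrier by (simp add: d1_mat_def)

lemma d2_mat_carrier: "d2_mat \<in> carrier_mat 3 3"
  using d2_Z_carrier by (simp add: d2_mat_def)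

lemma d1_mat_index: "l < 3 \<Longrightarrow> d1_mat $$ (0, l) = homogenize (2 * c) (form l)"
  using d1_Z_carrier[of c]
  by (simp add: d1_mat_def d1_Z_index map_h_sum_monoms homogenize_def coeff_form carrier_matD)

lemma d2_mat_index: "l < 3 \<Longrightarrow> i < 3 \<Longrightarrow> d2_mat $$ (l, i) = homogenize c (syz i l)"
  using d2_Z_carrier[of c]
  by (simp add: d2_mat_def d2_Z_index map_h_sum_monoms homogenize_def coeff_syz carrier_matD)

lemma d1_mat_mult:
  "v \<in> carrier_vec 3 \<Longrightarrow> d1_mat *\<^sub>v v = vec 1 (\<lambda>_. \<Sum>l<3. v $ l * homogenize (2 * c) (form l))"
  by (simp add: mult_mat_vec_1_3[OF d1_mat_carrier] d1_mat_index)

lemma d2_mat_mult: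
  "v \<in> carrier_vec 3 \<Longrightarrow> d2_mat *\<^sub>v v = vec 3 (\<lambda>l. \<Sum>i<3. v $ i * homogenize c (syz i l))"
  by (auto simp: mult_mat_vec_3_3[OF d2_mat_carrier] d2_mat_index)

lemma d1_d2_zero:
  assumes v: "v \<in> carrier_vec 3"
  shows "d1_mat *\<^sub>v (d2_mat *\<^sub>v v) = 0\<^sub>v 1"
proof -
  have entry: "homogenize c (syz i l) * homogenize (2 * c) (form l) = homogenize (c + 2 * c) (syz i l * form l)" for i l
    by (rule homogenize_mult) (auto simp: coeff_syz coeff_form)
  have "(\<Sum>l<3. (\<Sum>i<3. v $ i * homogenize c (syz i l)) * homogenize (2 * c) (form l)) =
      (\<Sum>i<3. v $ i * (\<Sum>l<3. homogenize c (syz i l) * homogenize (2 * c) (form l)))"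
    by (simp add: sum_lessThan_3 algebra_simps)
  also have "\<dots> = (\<Sum>i<3. v $ i * homogenize (c + 2 * c) (\<Sum>l<3. syz i l * form l))"
    by (simp add: entry homogenize_sum)
  also have "\<dots> = 0" by (simp add: syz_relation)
  finally have zero: "(\<Sum>l<3. (\<Sum>i<3. v $ i * homogenize c (syz i l)) * homogenize (2 * c) (form l)) = 0" .
  then show ?thesis
    using v by (auto simp: d2_mat_mult d1_mat_mult)
qed

end

context unit_specialization
begin

text \<open>The homogeneous components of a syzygy are syzygies, because the forms are homogeneous of the same
  degree; they are handled separately by \<open>syzygy_is_combination\<close>.\<close>

lemma d1_kernel_is_combination:
  fixes v :: "'a bipoly vec"
  assumes v: "v \<in> carrier_vec 3" "\<And>l. l < 3 \<Longrightarrow> v $ l \<in> coeffs_in R" and syz: "d1_mat *\<^sub>v v = 0\<^sub>v 1"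
  obtains s where "s \<in> carrier_vec 3" "\<And>i. i < 3 \<Longrightarrow> s $ i \<in> coeffs_in R" "sigma s = 0" "d2_mat *\<^sub>v s = v"
proof -
  have sum_0: "(\<Sum>l<3. v $ l * homogenize (2 * c) (form l)) = 0"
    using arg_cong[OF syz, of "\<lambda>u. u $ 0"] v by (simp add: d1_mat_mult)
  have "\<forall>n. \<exists>s. (\<forall>i<3. \<forall>k. coeff (s i) k \<in> R) \<and> (\<forall>i<3. \<forall>k\<ge>Suc n - c. coeff (s i) k = 0) \<and>
      (\<Sum>i<3. smult (splitting i) (s i)) = 0 \<and> (\<forall>l<3. (\<Sum>i<3. s i * syz i l) = slice n (v $ l))"
  \<comment> \<open>In degree \<open>n < c\<close> the truncated difference makes the bound on the combination \<open>0\<close>.\<close>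
  proof (rule allI, rule syzygy_is_combination)
    fix n
    show "coeff (slice n (v $ l)) k \<in> R" if "l < 3" for l k
      using v(2)[OF that] by (auto simp: coeff_slice coeffs_in_def intro: ring_closed_zero[OF R_closed])
    show "coeff (slice n (v $ l)) k = 0" if "k \<ge> c + (Suc n - c)" for l k
      using that by (auto simp: coeff_slice)
    have "slice (n + 2 * c) (\<Sum>l<3. v $ l * homogenize (2 * c) (form l)) = (\<Sum>l<3. slice n (v $ l) * form l)"
      unfolding slice_sum by (subst slice_mult_homogenize) (auto simp: coeff_form)
    then show "(\<Sum>l<3. slice n (v $ l) * form l) = 0" by (simp add: sum_0)
  qed
  from choice[OF this] obtain s where all: "\<forall>n. (\<forall>i<3. \<forall>k. coeff (s n i) k \<in> R) \<and>
      (\<forall>i<3. \<forall>k\<ge>Suc n - c. coeff (s n i) k = 0) \<and>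
      (\<Sum>i<3. smult (splitting i) (s n i)) = 0 \<and> (\<forall>l<3. (\<Sum>i<3. s n i * syz i l) = slice n (v $ l))"
    by (elim exE)
  have s: "\<And>n i k. i < 3 \<Longrightarrow> coeff (s n i) k \<in> R"
    "\<And>n i k. i < 3 \<Longrightarrow> k \<ge> Suc n - c \<Longrightarrow> coeff (s n i) k = 0"
    "\<And>n. (\<Sum>i<3. smult (splitting i) (s n i)) = 0"
    "\<And>n l. l < 3 \<Longrightarrow> (\<Sum>i<3. s n i * syz i l) = slice n (v $ l)"
    using all by blast+
  define N where "N = (\<Union>l<3. {n. slice n (v $ l) \<noteq> 0})"
  have N: "finite N" unfolding N_def using finite_nonzero_slices by blast
  define S where "S = vec 3 (\<lambda>i. \<Sum>n\<in>N. homogenize (n - c) (s n i))"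
  show thesis
  proof
    show "S \<in> carrier_vec 3" by (simp add: S_def)
    show "S $ i \<in> coeffs_in R" if "i < 3" for i
      using that s(1) by (auto simp: S_def intro!: coeffs_in_sum homogenize_in_coeffs_in R_closed)
    have "sigma S = (\<Sum>i<3. \<Sum>n\<in>N. homogenize (n - c) (smult (splitting i) (s n i)))"
      by (simp add: sigma_def S_def sum_distrib_left xy_const_mult_homogenize)
    also have "\<dots> = (\<Sum>n\<in>N. homogenize (n - c) (\<Sum>i<3. smult (splitting i) (s n i)))"
      by (subst sum.swap) (simp add: homogenize_sum)
    finally show "sigma S = 0" by (simp add: s)
    have "(\<Sum>i<3. S $ i * homogenize c (syz i l)) = v $ l" if l: "l < 3" for l
    proof -
      have entry: "(\<Sum>i<3. homogenize (n - c) (s n i) * homogenize c (syz i l)) = homogenize n (slice n (v $ l))" for n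
      proof (cases "n < c")
        case True
        then have zero: "s n i = 0" if "i < 3" for i using s(2)[OF that, of n] by (intro poly_eqI) simp
        then have "slice n (v $ l) = 0" using s(4)[OF l, of n] by simp
        then show ?thesis using zero by simp
      next
        case False
        have "homogenize (n - c) (s n i) * homogenize c (syz i l) = homogenize (n - c + c) (s n i * syz i l)"
          if "i < 3" for i
          using s(2)[OF that, of n] False by (intro homogenize_mult) (auto simp: coeff_syz)
        then show ?thesis using False s(4)[OF l, of n] by (simp add: homogenize_sum[symmetric])
      qed
      have "(\<Sum>i<3. S $ i * homogenize c (syz i l)) =
          (\<Sum>i<3. \<Sum>n\<in>N. homogenize (n - c) (s n i) * homogenize c (syz i l))"
        by (simp add: S_def sum_distrib_right)
      also have "\<dots> = (\<Sum>n\<in>N. homogenize n (slice n (v $ l)))"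
        by (subst sum.swap) (simp add: entry)
      also have "\<dots> = v $ l"
        using l by (intro sum_homogenize_slices N) (auto simp: N_def)
      finally show ?thesis .
    qed
    then show "d2_mat *\<^sub>v S = v"
      using v by (intro eq_vecI) (auto simp: d2_mat_mult S_def)
  qed
qed

lemma d2_injective_on_kernel_sigma:
  assumes s: "s \<in> carrier_vec 3" "sigma s = 0" "d2_mat *\<^sub>v s = 0\<^sub>v 3"
  shows "s = 0\<^sub>v 3"
proof -
  have rel: "(\<Sum>i<3. s $ i * homogenize c (syz i l)) = 0" if "l < 3" for l
    using arg_cong[OF s(3), of "\<lambda>u. u $ l"] that s(1) by (simp add: d2_mat_mult)
  have "\<forall>i<3. slice n (s $ i) = 0" for n
  proof (rule combination_injective[of "Suc n"])
    show "\<forall>i<3. \<forall>k\<ge>Suc n. coeff (slice n (s $ i)) k = 0" by (simp add: coeff_slice)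
    show "(\<Sum>i<3. smult (splitting i) (slice n (s $ i))) = 0"
      using arg_cong[OF s(2), of "slice n"] by (simp add: sigma_def slice_sum slice_xy_const_mult)
    show "\<forall>l<3. (\<Sum>i<3. slice n (s $ i) * syz i l) = 0"
    proof (intro allI impI)
      fix l :: nat assume l: "l < 3"
      have "slice (n + c) (\<Sum>i<3. s $ i * homogenize c (syz i l)) = (\<Sum>i<3. slice n (s $ i) * syz i l)"
        unfolding slice_sum by (subst slice_mult_homogenize) (auto simp: coeff_syz)
      then show "(\<Sum>i<3. slice n (s $ i) * syz i l) = 0" by (simp add: rel[OF l])
    qed
  qed
  then show ?thesis using s(1) by (intro eq_vecI) (auto intro!: eq_zero_if_slices_zero)
qed

end

section \<open>Evaluation of integer polynomials\<close>

definition monomial_value :: "(nat \<times> nat \<Rightarrow> 'b::comm_ring_1) \<Rightarrow> (nat \<times> nat \<Rightarrow>\<^sub>0 nat) \<Rightarrow> 'b" where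
  "monomial_value val t = (\<Prod>v\<in>supp t. val v ^ coef t v)"

definition zeval :: "(nat \<times> nat \<Rightarrow> 'b::comm_ring_1) \<Rightarrow> zpoly \<Rightarrow> 'b" where
  "zeval val p = (\<Sum>t\<in>supp p. of_int (coef p t) * monomial_value val t)"

lemma monomial_value_add: "monomial_value val (s + t) = monomial_value val s * monomial_value val t"
proof -
  have extend: "monomial_value val u = (\<Prod>v\<in>supp s \<union> supp t. val v ^ coef u v)" if "supp u \<subseteq> supp s \<union> supp t" for u
    unfolding monomial_value_def using that by (intro prod.mono_neutral_left) (auto simp: in_keys_iff)
  show ?thesis
    by (simp add: extend supp_add_exponents lookup_add power_add prod.distrib)
qed

lemma zeval_single: "zeval val (Poly_Mapping.single t a) = of_int a * monomial_value val t"
  by (simp add: zeval_def)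

lemma zeval_add: "zeval val (p + q) = zeval val p + zeval val q"
  unfolding zeval_def by (rule setsum_keys_plus_distrib) (auto simp: algebra_simps)

lemma zeval_mult: "zeval val (p * q) = zeval val p * zeval val q"
proof (induction p rule: poly_mapping_additive_induct)
  case (single s a)
  show ?case
    by (induction q rule: poly_mapping_additive_induct)
      (auto simp: mult_single zeval_single monomial_value_add zeval_add algebra_simps, simp add: zeval_def)
qed (auto simp: zeval_add algebra_simps, simp add: zeval_def)

lemma zeval_zvar: "zeval val (zvar i j) = val (i, j)"
  by (simp add: zvar_def zeval_single monomial_value_def)

lemma comm_ring_hom_zeval: "comm_ring_hom (zeval val)"
  by unfold_locales
    (auto simp: zeval_add zeval_mult zeval_def[of val 0] single_one[symmetric] zeval_single monomial_value_def simp del: single_one)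

text \<open>The forms \<open>x\<^sup>2\<^sup>c\<close>, \<open>y\<^sup>2\<^sup>c\<close>, \<open>x\<^sup>c y\<^sup>c\<close> have no syzygies with entries of degree less than \<open>c\<close>, as their
  multiples by monomials of degree \<open>c - 1\<close> are distinct monomials. So \<open>w\<close> does not vanish there.\<close>

lemma w_Z_nonzero:
  assumes c: "c > 0"
  shows "w_Z c \<noteq> 0"
proof -
  \<comment> \<open>This specializes \<open>G\<^sub>1, G\<^sub>2, G\<^sub>3\<close> to \<open>x\<^sup>2\<^sup>c, y\<^sup>2\<^sup>c, x\<^sup>c y\<^sup>c\<close>.\<close>
  define val :: "nat \<times> nat \<Rightarrow> rat" where
    "val = (\<lambda>(i, j). if j = 1 \<and> i = 2 * c \<or> j = 2 \<and> i = 0 \<or> j = 3 \<and> i = c then 1 else 0)"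
  interpret comm_ring_hom "zeval val" by (rule comm_ring_hom_zeval)
  interpret specialization "zeval val" c by unfold_locales (rule c)
  have form: "form 0 = monom 1 (2 * c)" "form 1 = monom 1 0" "form 2 = monom 1 c"
  proof -
    have coeffs: "coeff (form l) i = (if l = 0 \<and> i = 2 * c \<or> l = 1 \<and> i = 0 \<or> l = 2 \<and> i = c then 1 else 0)" for l i
      unfolding coeff_form zeval_zvar by (auto simp: val_def)
    show "form 0 = monom 1 (2 * c)" by (rule poly_eqI) (auto simp: coeffs)
    show "form 1 = monom 1 0" by (rule poly_eqI) (auto simp: coeffs)
    show "form 2 = monom 1 c" by (rule poly_eqI) (auto simp: coeffs)
  qed
  have "w \<noteq> 0"
    unfolding w_nonzero_iff
  proof (intro allI impI)
    fix V l assume V: "\<forall>l<3. \<forall>k\<ge>c. coeff (V l) k = 0" "(\<Sum>l<3. V l * form l) = 0" and l: "l < (3::nat)"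
    have zero: "coeff (V l) k = 0" if "l < 3" "k \<ge> c" for l k using V that by blast
    have c_k: "coeff (V 0 * form 0 + V 1 * form 1 + V 2 * form 2) k = 0" for k
      using V(2) by (simp only: sum_lessThan_3 coeff_0)
    have coeffs: "(if k < 2 * c then 0 else coeff (V 0) (k - 2 * c)) + coeff (V 1) k
        + (if k < c then 0 else coeff (V 2) (k - c)) = 0" for k
      using c_k[of k] unfolding form mult.commute[of _ "monom _ _"] by (auto simp: coeff_monom_mult split: if_splits)
    have "coeff (V 0) k = 0" for k
      using coeffs[of "2 * c + k"] zero[of 1 "2 * c + k"] zero[of 2 "c + k"] by (simp add: mult_2)
    moreover have "coeff (V 2) k = 0" for k
      using coeffs[of "c + k"] zero[of 1 "c + k"] zero[of 2 k] by (cases "k < c") simp_all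
    moreover have "coeff (V 1) k = 0" for k
      using coeffs[of k] zero[of 1 k] by (cases "k < c") simp_all
    moreover have "l = 0 \<or> l = 1 \<or> l = 2" using l by auto
    ultimately show "V l = 0" by (auto intro: poly_eqI)
  qed
  then show ?thesis by (auto simp: w_def)
qed

section \<open>Homogeneous elements\<close>

text \<open>Every power of \<open>w\<close> is homogeneous, so it does not matter which fraction represents an element.\<close>

definition R_w_deg :: "nat \<Rightarrow> int \<Rightarrow> zfrac set" where
  "R_w_deg c d = {Fract a (w_Z c ^ n) | a n. a \<in> R_Z_deg c (d + int (3 * c * n))}"

text \<open>The graded pieces of \<open>S\<close>, of its localization and of \<open>B\<close> are all of this form.\<close>

definition homog :: "'a::comm_ring_1 set \<Rightarrow> int \<Rightarrow> 'a bipoly set" where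
  "homog D n = {p. (\<forall>(i, j)\<in>supp p. int (i + j) = n) \<and> (\<forall>e. coef p e \<in> D)}"

lemma coef_S_frac: "coef (S_frac c p n) e = Fract (coef p e) (w_Z c ^ n)"
  by (auto simp: S_frac_def coef_xy_const_mult S_emb_def coef_map when_def to_fract_def mult_fract eq_fract
      Zero_fract_def)

context
  fixes c :: nat assumes c: "c > 0"
begin

lemma w_power_nonzero: "w_Z c ^ n \<noteq> 0"
  using w_Z_nonzero[OF c] by simp

lemma Fract_w_power_extend: "Fract a (w_Z c ^ n) = Fract (a * w_Z c ^ k) (w_Z c ^ (n + k))"
  using w_power_nonzero by (simp add: eq_fract power_add)

text \<open>The condition on \<open>P\<close> allows both the full ring and a homogeneous component whose degree grows with the
  exponent of the denominator.\<close>

lemma common_denominator: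
  assumes "finite E" "\<And>e. e \<in> E \<Longrightarrow> \<exists>n. \<exists>a\<in>P n. f e = Fract a (w_Z c ^ n)"
    and P: "\<And>n a k. a \<in> P n \<Longrightarrow> a * w_Z c ^ k \<in> P (n + k)"
  shows "\<exists>n. \<forall>e\<in>E. \<exists>a\<in>P n. f e = Fract a (w_Z c ^ n)"
  using assms(1,2)
proof (induction E rule: finite_induct)
  case (insert x E)
  then obtain n where n: "\<forall>e\<in>E. \<exists>a\<in>P n. f e = Fract a (w_Z c ^ n)" by auto
  obtain m a where m: "a \<in> P m" "f x = Fract a (w_Z c ^ m)" using insert.prems[of x] by auto
  have "\<forall>e\<in>E. \<exists>a\<in>P (n + m). f e = Fract a (w_Z c ^ (n + m))"
    using n P Fract_w_power_extend by metis
  moreover have "\<exists>a\<in>P (n + m). f x = Fract a (w_Z c ^ (n + m))"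
    using m P[of a m n] Fract_w_power_extend[of a m n] by (metis add.commute)
  ultimately show ?case by blast
qed simp

lemma R_w_deg_subset: "R_w_deg c d \<subseteq> R_w c"
  by (auto simp: R_w_deg_def R_w_def R_Z_deg_def)

lemma ring_closed_R_w: "ring_closed (R_w c)"
  unfolding ring_closed_def
proof (intro conjI ballI)
  have "1 = Fract 1 (w_Z c ^ 0)" by (simp add: One_fract_def)
  then show "1 \<in> R_w c" unfolding R_w_def using ring_closed_one[OF ring_closed_R_Z] by blast
  fix p q assume "p \<in> R_w c" "q \<in> R_w c"
  then obtain a m b n where a: "a \<in> R_Z c" "p = Fract a (w_Z c ^ m)" and b: "b \<in> R_Z c" "q = Fract b (w_Z c ^ n)"
    by (auto simp: R_w_def)
  note closed = ring_closed_intros[OF ring_closed_R_Z] w_Z_in_R_Z[OF c]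
  have "p - q = Fract (a * w_Z c ^ n - b * w_Z c ^ m) (w_Z c ^ (m + n))"
    using a b w_power_nonzero by (simp add: power_add)
  then show "p - q \<in> R_w c" unfolding R_w_def using a b by (blast intro: closed)
  have "p * q = Fract (a * b) (w_Z c ^ (m + n))"
    using a b by (simp add: power_add)
  then show "p * q \<in> R_w c" unfolding R_w_def using a b by (blast intro: closed)
qed

lemma w_power_homogeneous: "w_Z c ^ n \<in> R_Z_deg c (int (3 * c * n))"
  using R_Z_deg_power[OF w_Z_homogeneous[OF c], of n] by simp

lemma R_w_deg_zero: "0 \<in> R_w_deg c d"
  unfolding R_w_deg_def using R_Z_deg_zero by (force simp: Zero_fract_def intro: exI[of _ 0])

lemma R_w_deg_add:
  assumes "p \<in> R_w_deg c d" "q \<in> R_w_deg c d"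
  shows "p + q \<in> R_w_deg c d"
proof -
  obtain a m b n where a: "a \<in> R_Z_deg c (d + int (3 * c * m))" "p = Fract a (w_Z c ^ m)"
    and b: "b \<in> R_Z_deg c (d + int (3 * c * n))" "q = Fract b (w_Z c ^ n)"
    using assms by (auto simp: R_w_deg_def)
  have "p + q = Fract (a * w_Z c ^ n + b * w_Z c ^ m) (w_Z c ^ (m + n))"
    using a b w_power_nonzero by (simp add: power_add)
  moreover have "a * w_Z c ^ n + b * w_Z c ^ m \<in> R_Z_deg c (d + int (3 * c * (m + n)))"
    using R_Z_deg_mult[OF a(1) w_power_homogeneous[of n]] R_Z_deg_mult[OF b(1) w_power_homogeneous[of m]]
    by (intro R_Z_deg_add) (simp_all add: algebra_simps)
  ultimately show ?thesis unfolding R_w_deg_def by blast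
qed

lemma R_w_deg_mult:
  assumes "p \<in> R_w_deg c d" "q \<in> R_w_deg c e"
  shows "p * q \<in> R_w_deg c (d + e)"
proof -
  obtain a m b n where a: "a \<in> R_Z_deg c (d + int (3 * c * m))" "p = Fract a (w_Z c ^ m)"
    and b: "b \<in> R_Z_deg c (e + int (3 * c * n))" "q = Fract b (w_Z c ^ n)"
    using assms by (auto simp: R_w_deg_def)
  have "p * q = Fract (a * b) (w_Z c ^ (m + n))"
    using a b by (simp add: power_add)
  moreover have "a * b \<in> R_Z_deg c (d + e + int (3 * c * (m + n)))"
    using R_Z_deg_mult[OF a(1) b(1)] by (simp add: algebra_simps)
  ultimately show ?thesis unfolding R_w_deg_def by blast
qed

lemma to_fract_homogeneous: "a \<in> R_Z_deg c d \<Longrightarrow> to_fract a \<in> R_w_deg c d"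
  unfolding R_w_deg_def by (force simp: to_fract_def intro: exI[of _ 0])

lemma inverse_w_homogeneous: "inverse (to_fract (w_Z c)) \<in> R_w_deg c (- int (3 * c))"
  unfolding R_w_deg_def using R_Z_deg_one[of c] by (force simp: to_fract_def intro: exI[of _ 1])

lemma S_w_eq: "S_w c = coeffs_in (R_w c)"
proof (intro equalityI subsetI)
  fix q assume "q \<in> S_w c"
  then obtain p n where p: "p \<in> S_Z c" "q = S_frac c p n" by (auto simp: S_w_def)
  then have "coef q e = Fract (coef p e) (w_Z c ^ n) \<and> coef p e \<in> R_Z c" for e
    by (cases e) (simp add: coef_S_frac S_Z_def)
  then show "q \<in> coeffs_in (R_w c)" unfolding coeffs_in_def R_w_def by blast
next
  fix q :: "zfrac bipoly" assume q: "q \<in> coeffs_in (R_w c)"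
  have "\<exists>n. \<forall>e\<in>supp q. \<exists>a\<in>R_Z c. coef q e = Fract a (w_Z c ^ n)"
  proof (rule common_denominator)
    show "\<exists>n. \<exists>a\<in>R_Z c. coef q e = Fract a (w_Z c ^ n)" for e
    proof -
      have "coef q e \<in> R_w c" using q unfolding coeffs_in_def by blast
      then show ?thesis unfolding R_w_def by blast
    qed
    show "a * w_Z c ^ k \<in> R_Z c" if "a \<in> R_Z c" for a k
      using that w_Z_in_R_Z[OF c] by (intro ring_closed_mult[OF ring_closed_R_Z] ring_closed_power[OF ring_closed_R_Z])
  qed simp
  then obtain n a where a: "\<And>e. e \<in> supp q \<Longrightarrow> a e \<in> R_Z c" "\<And>e. e \<in> supp q \<Longrightarrow> coef q e = Fract (a e) (w_Z c ^ n)"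
    by metis
  define p where "p = (\<Sum>e\<in>supp q. Poly_Mapping.single e (a e))"
  have coef_p: "coef p e = (if e \<in> supp q then a e else 0)" for e
    by (simp add: p_def lookup_sum lookup_single when_def)
  have "p \<in> S_Z c" using a ring_closed_zero[OF ring_closed_R_Z] by (auto simp: S_Z_def coef_p)
  moreover have "q = S_frac c p n"
    by (rule poly_mapping_eqI) (use a in \<open>auto simp: coef_S_frac coef_p in_keys_iff fract_collapse\<close>)
  ultimately show "q \<in> S_w c" unfolding S_w_def by blast
qed

lemma S_Z_deg_eq: "S_Z_deg c g = homog (R_Z_deg c (snd g)) (fst g)"
proof (intro equalityI subsetI)
  fix p assume "p \<in> S_Z_deg c g"
  then show "p \<in> homog (R_Z_deg c (snd g)) (fst g)"
    using R_Z_deg_zero[of c] by (force simp: S_Z_deg_def homog_def S_Z_def R_Z_deg_def in_keys_iff)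
next
  fix p assume "p \<in> homog (R_Z_deg c (snd g)) (fst g)"
  then show "p \<in> S_Z_deg c g"
    by (force simp: S_Z_deg_def homog_def S_Z_def R_Z_deg_def)
qed

lemma S_w_deg_eq: "S_w_deg c g = homog (R_w_deg c (snd g)) (fst g)"
proof (intro equalityI subsetI)
  fix q assume "q \<in> S_w_deg c g"
  then obtain p n where p: "p \<in> S_Z_deg c (g + (0, int (3 * c * n)))" "q = S_frac c p n"
    by (auto simp: S_w_deg_def)
  have "supp q \<subseteq> supp p" by (auto simp: p in_keys_iff coef_S_frac fract_collapse)
  then show "q \<in> homog (R_w_deg c (snd g)) (fst g)"
    using p(1) unfolding S_Z_deg_eq by (fastforce simp: homog_def p(2) coef_S_frac R_w_deg_def)
next
  fix q assume q: "q \<in> homog (R_w_deg c (snd g)) (fst g)"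
  have "\<exists>n. \<forall>e\<in>supp q. \<exists>a\<in>R_Z_deg c (snd g + int (3 * c * n)). coef q e = Fract a (w_Z c ^ n)"
  proof (rule common_denominator)
    show "\<exists>n. \<exists>a\<in>R_Z_deg c (snd g + int (3 * c * n)). coef q e = Fract a (w_Z c ^ n)" for e
    proof -
      have "coef q e \<in> R_w_deg c (snd g)" using q by (cases e) (simp add: homog_def)
      then show ?thesis unfolding R_w_deg_def by blast
    qed
    show "a * w_Z c ^ k \<in> R_Z_deg c (snd g + int (3 * c * (n + k)))"
      if "a \<in> R_Z_deg c (snd g + int (3 * c * n))" for n a k
      using R_Z_deg_mult[OF that w_power_homogeneous[of k]] by (simp add: algebra_simps)
  qed simp
  then obtain n a where a: "\<And>e. e \<in> supp q \<Longrightarrow> a e \<in> R_Z_deg c (snd g + int (3 * c * n))"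
      "\<And>e. e \<in> supp q \<Longrightarrow> coef q e = Fract (a e) (w_Z c ^ n)"
    by metis
  define p where "p = (\<Sum>e\<in>supp q. Poly_Mapping.single e (a e))"
  have coef_p: "coef p e = (if e \<in> supp q then a e else 0)" for e
    by (simp add: p_def lookup_sum lookup_single when_def)
  have "p \<in> S_Z_deg c (g + (0, int (3 * c * n)))"
    unfolding S_Z_deg_eq using a q R_Z_deg_zero by (fastforce simp: homog_def coef_p in_keys_iff[of _ p] split: if_splits)
  moreover have "q = S_frac c p n"
    by (rule poly_mapping_eqI) (use a in \<open>auto simp: coef_S_frac coef_p in_keys_iff fract_collapse\<close>)
  ultimately show "q \<in> S_w_deg c g" unfolding S_w_deg_def by blast
qed

end

lemma B_deg_eq: "B_deg n = homog UNIV n"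
  by (simp add: B_deg_def homog_def)

lemma homog_zero: "0 \<in> D \<Longrightarrow> 0 \<in> homog D n"
  by (simp add: homog_def)

lemma homog_single: "0 \<in> D \<Longrightarrow> a \<in> D \<Longrightarrow> int (i + j) = n \<Longrightarrow> Poly_Mapping.single (i, j) a \<in> homog D n"
  by (auto simp: homog_def lookup_single when_def)

lemma homog_add:
  assumes "\<And>a b. a \<in> D \<Longrightarrow> b \<in> D \<Longrightarrow> a + b \<in> D" "p \<in> homog D n" "q \<in> homog D n"
  shows "p + q \<in> homog D n"
  using assms keys_add[of p q] by (fastforce simp: homog_def lookup_add)

lemma homog_sum:
  assumes "0 \<in> D" "\<And>a b. a \<in> D \<Longrightarrow> b \<in> D \<Longrightarrow> a + b \<in> D" "\<And>i. i \<in> I \<Longrightarrow> f i \<in> homog D n"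
  shows "sum f I \<in> homog D n"
  using assms(3) by (induction I rule: infinite_finite_induct) (auto intro: homog_zero homog_add assms(1,2))

lemma homog_mult:
  assumes p: "p \<in> homog D m" and q: "q \<in> homog E n" and "0 \<in> F" "\<And>a b. a \<in> F \<Longrightarrow> b \<in> F \<Longrightarrow> a + b \<in> F"
    and "\<And>a b. a \<in> D \<Longrightarrow> b \<in> E \<Longrightarrow> a * b \<in> F"
  shows "p * q \<in> homog F (m + n)"
  unfolding mult_sum_singles
proof (intro homog_sum assms)
  fix e e' assume e: "e \<in> supp p" "e' \<in> supp q"
  obtain i j i' j' where ij: "e = (i, j)" "e' = (i', j')" by (cases e, cases e')
  show "Poly_Mapping.single (e + e') (coef p e * coef q e') \<in> homog F (m + n)"
    unfolding ij add_Pair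
  proof (rule homog_single[OF assms(3)])
    show "coef p (i, j) * coef q (i', j') \<in> F" using p q assms(5) by (simp add: homog_def)
    have "int (i + j) = m" "int (i' + j') = n" using p q e unfolding ij homog_def by auto
    then show "int (i + i' + (j + j')) = m + n" by simp
  qed
qed

lemma homogenize_homog: "0 \<in> D \<Longrightarrow> (\<And>k. coeff f k \<in> D) \<Longrightarrow> homogenize n f \<in> homog D (int n)"
  by (auto simp: homog_def coef_homogenize in_keys_iff split: if_splits)

section \<open>Graded modules of vectors\<close>

lemma ring_on_simps [simp]:
  "carrier (ring_on K) = K" "x \<otimes>\<^bsub>ring_on K\<^esub> y = x * y" "\<one>\<^bsub>ring_on K\<^esub> = 1"
  "\<zero>\<^bsub>ring_on K\<^esub> = 0" "x \<oplus>\<^bsub>ring_on K\<^esub> y = x + y"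
  by (simp_all add: ring_on_def)

lemma cring_ring_on:
  assumes K: "ring_closed K"
  shows "cring (ring_on K)"
proof (rule cringI)
  show "abelian_group (ring_on K)"
  proof (rule abelian_groupI)
    fix x assume "x \<in> carrier (ring_on K)"
    then show "\<exists>y\<in>carrier (ring_on K). y \<oplus>\<^bsub>ring_on K\<^esub> x = \<zero>\<^bsub>ring_on K\<^esub>"
      by (intro bexI[of _ "- x"]) (auto intro: ring_closed_uminus[OF K])
  qed (auto intro: ring_closed_intros[OF K])
  show "comm_monoid (ring_on K)"
    by (rule comm_monoidI) (auto intro: ring_closed_intros[OF K])
qed (auto simp: distrib_right)

text \<open>The condition \<open>C\<close> cuts a submodule out of \<open>K\<^sup>n\<close>; it is a condition on vectors over the whole type,
  which is how both kernels and modules of fixed points arise below.\<close>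

definition vec_module_on :: "'r::comm_ring_1 set \<Rightarrow> nat \<Rightarrow> ('r vec \<Rightarrow> bool) \<Rightarrow> ('r, 'r vec, 'g) graded_module \<Rightarrow> bool" where
  "vec_module_on K n C M \<longleftrightarrow> carrier M = {v \<in> carrier_vec n. (\<forall>i<n. v $ i \<in> K) \<and> C v} \<and>
     ring.zero M = 0\<^sub>v n \<and> ring.add M = (+) \<and> module.smult M = (\<cdot>\<^sub>v) \<and> C (0\<^sub>v n) \<and>
     (\<forall>u\<in>carrier_vec n. \<forall>v\<in>carrier_vec n. C u \<longrightarrow> C v \<longrightarrow> C (u + v)) \<and>
     (\<forall>r. \<forall>v\<in>carrier_vec n. C v \<longrightarrow> C (r \<cdot>\<^sub>v v))"

lemma module_vec_module_on:
  assumes K: "ring_closed K" and M: "vec_module_on K n C M"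
  shows "module (ring_on K) M"
proof (rule moduleI)
  show "cring (ring_on K)" by (rule cring_ring_on[OF K])
  show "abelian_group M"
  proof (rule abelian_groupI)
    fix x assume x: "x \<in> carrier M"
    have "(- 1) \<cdot>\<^sub>v x + x = 0\<^sub>v n" using x M by (auto simp: vec_module_on_def intro!: eq_vecI)
    moreover have "(- 1) \<cdot>\<^sub>v x \<in> carrier M"
      using x M by (auto simp: vec_module_on_def carrier_vecD intro!: ring_closed_uminus[OF K])
    ultimately show "\<exists>y\<in>carrier M. y \<oplus>\<^bsub>M\<^esub> x = \<zero>\<^bsub>M\<^esub>"
      using M by (auto simp: vec_module_on_def)
  qed (use M in \<open>auto simp: vec_module_on_def comm_add_vec intro!: assoc_add_vec ring_closed_intros[OF K]\<close>)
qed (use M in \<open>auto simp: vec_module_on_def smult_smult_assoc add_smult_distrib_vec smult_add_distrib_vec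
       intro!: ring_closed_intros[OF K]\<close>)

lemma gr_free_simps:
  "carrier (gr_free K H ds) = {v \<in> carrier_vec (length ds). \<forall>i<length ds. v $ i \<in> K}"
  "\<zero>\<^bsub>gr_free K H ds\<^esub> = 0\<^sub>v (length ds)" "u \<oplus>\<^bsub>gr_free K H ds\<^esub> v = u + v" "r \<odot>\<^bsub>gr_free K H ds\<^esub> v = r \<cdot>\<^sub>v v"
  "deg_part (gr_free K H ds) g = {v \<in> carrier_vec (length ds). \<forall>i<length ds. v $ i \<in> H (g - ds ! i)}"
  by (simp_all add: gr_free_def)

lemma vec_module_on_gr_free: "vec_module_on K (length ds) (\<lambda>_. True) (gr_free K H ds)"
  by (auto simp: vec_module_on_def gr_free_def)

lemma mult_mat_vec_smult:
  fixes A :: "'b::comm_ring_1 mat"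
  assumes "A \<in> carrier_mat m n" "v \<in> carrier_vec n"
  shows "A *\<^sub>v (r \<cdot>\<^sub>v v) = r \<cdot>\<^sub>v (A *\<^sub>v v)"
  using assms by (intro eq_vecI) (auto simp: scalar_prod_def sum_distrib_left mult_ac intro!: sum.cong)

lemma graded_hom_mult_mat_vec:
  assumes K: "ring_closed K" and H: "\<And>g. 0 \<in> H g" "\<And>g a b. a \<in> H g \<Longrightarrow> b \<in> H g \<Longrightarrow> a + b \<in> H g"
    and M: "M \<in> carrier_mat (length ds') (length ds)"
    and in_K: "\<And>i j. i < length ds' \<Longrightarrow> j < length ds \<Longrightarrow> M $$ (i, j) \<in> K"
    and deg: "\<And>i j g a. i < length ds' \<Longrightarrow> j < length ds \<Longrightarrow> a \<in> H (g - ds ! j) \<Longrightarrow> M $$ (i, j) * a \<in> H (g - ds' ! i)"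
  shows "(\<lambda>v. M *\<^sub>v v) \<in> graded_hom (ring_on K) (gr_free K H ds) (gr_free K H ds')"
proof -
  have entry: "(M *\<^sub>v v) $ i = (\<Sum>j<length ds. M $$ (i, j) * v $ j)"
    if "v \<in> carrier_vec (length ds)" "i < length ds'" for v i
    using that M by (auto simp: scalar_prod_def lessThan_atLeast0 intro!: sum.cong)
  have sum_H: "sum f I \<in> H g" if "\<And>j. j \<in> I \<Longrightarrow> f j \<in> H g" for f :: "nat \<Rightarrow> 'a" and I g
    using that by (induction I rule: infinite_finite_induct) (auto intro: H)
  show ?thesis
    unfolding graded_hom_def gr_free_simps ring_on_simps
  proof (intro CollectI conjI ballI allI funcsetI subsetI)
    fix v assume "v \<in> {v \<in> carrier_vec (length ds). \<forall>i<length ds. v $ i \<in> K}"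
    then show "M *\<^sub>v v \<in> carrier_vec (length ds')" "\<And>i. i < length ds' \<longrightarrow> (M *\<^sub>v v) $ i \<in> K"
      using M in_K by (auto simp: entry simp del: index_mult_mat_vec intro!: ring_closed_sum[OF K] ring_closed_mult[OF K])
  next
    fix g u assume "u \<in> (\<lambda>v. M *\<^sub>v v) ` {v \<in> carrier_vec (length ds). \<forall>i<length ds. v $ i \<in> H (g - ds ! i)}"
    then show "u \<in> carrier_vec (length ds')" "\<And>i. i < length ds' \<longrightarrow> u $ i \<in> H (g - ds' ! i)"
      using M deg by (auto simp: entry simp del: index_mult_mat_vec intro!: sum_H)
  next
    fix u v assume "u \<in> {v \<in> carrier_vec (length ds). \<forall>i<length ds. v $ i \<in> K}"
      "v \<in> {v \<in> carrier_vec (length ds). \<forall>i<length ds. v $ i \<in> K}"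
    then show "M *\<^sub>v (u + v) = M *\<^sub>v u + M *\<^sub>v v" using M by (auto intro: mult_add_distrib_mat_vec)
  next
    fix r v assume "v \<in> {v \<in> carrier_vec (length ds). \<forall>i<length ds. v $ i \<in> K}"
    then show "M *\<^sub>v (r \<cdot>\<^sub>v v) = r \<cdot>\<^sub>v (M *\<^sub>v v)" using M by (auto intro: mult_mat_vec_smult)
  qed
qed

lemma graded_projective_gr_free:
  assumes "ring_closed K"
  shows "graded_projective K H (gr_free K H ds)"
proof -
  have "id \<in> graded_hom (ring_on K) (gr_free K H ds) (gr_free K H ds)"
    by (auto simp: graded_hom_def)
  then show ?thesis
    unfolding graded_projective_def
    using module_vec_module_on[OF assms vec_module_on_gr_free] by (metis id_apply)
qed

lemma graded_hom_restrict:
  assumes "f \<in> graded_hom R M N" "carrier M' \<subseteq> carrier M"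
    and "\<And>v. v \<in> carrier M' \<Longrightarrow> f v \<in> carrier N'" "\<And>g v. v \<in> deg_part M' g \<Longrightarrow> f v \<in> deg_part N' g"
    and "ring.add M' = ring.add M" "ring.add N' = ring.add N"
    and "module.smult M' = module.smult M" "module.smult N' = module.smult N"
  shows "f \<in> graded_hom R M' N'"
  unfolding graded_hom_def
proof (intro CollectI conjI ballI allI)
  show "f \<in> carrier M' \<rightarrow> carrier N'" using assms(3) by blast
  show "f ` deg_part M' g \<subseteq> deg_part N' g" for g using assms(4) by blast
  fix u v assume "u \<in> carrier M'" "v \<in> carrier M'"
  then show "f (u \<oplus>\<^bsub>M'\<^esub> v) = f u \<oplus>\<^bsub>N'\<^esub> f v"
    using assms(1,2) unfolding assms(5-8) graded_hom_def by blast
next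
  fix r v assume "r \<in> carrier R" "v \<in> carrier M'"
  then show "f (r \<odot>\<^bsub>M'\<^esub> v) = r \<odot>\<^bsub>N'\<^esub> f v"
    using assms(1,2) unfolding assms(5-8) graded_hom_def by blast
qed

lemma graded_hom_image:
  assumes "f \<in> graded_hom R M N"
  shows "v \<in> carrier M \<Longrightarrow> f v \<in> carrier N" "v \<in> deg_part M g \<Longrightarrow> f v \<in> deg_part N g"
  using assms unfolding graded_hom_def by blast+

section \<open>The universal complex is a projective resolution\<close>

context specialization
begin

lemma sigma_add: "u \<in> carrier_vec 3 \<Longrightarrow> v \<in> carrier_vec 3 \<Longrightarrow> sigma (u + v) = sigma u + sigma v"
  and sigma_minus: "u \<in> carrier_vec 3 \<Longrightarrow> v \<in> carrier_vec 3 \<Longrightarrow> sigma (u - v) = sigma u - sigma v"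
  and sigma_smult: "v \<in> carrier_vec 3 \<Longrightarrow> sigma (r \<cdot>\<^sub>v v) = r * sigma v"
  by (simp_all add: sigma_def sum_lessThan_3 algebra_simps)

text \<open>The matrix \<open>1 - d\<^sub>3 \<sigma>\<close> projects onto the kernel of \<open>\<sigma>\<close> because \<open>\<sigma> d\<^sub>3 = 1\<close>.\<close>

definition d3_entry :: "nat \<Rightarrow> 'q" where
  "d3_entry l = (if l = 1 then (-1) ^ (c + 1) else 1) * z0 l"

definition projector :: "'q bipoly mat" where
  "projector = mat 3 3 (\<lambda>(l, i). xy_const ((if l = i then 1 else 0) - d3_entry l * splitting i))"

lemma projector_carrier [simp]: "projector \<in> carrier_mat 3 3"
  by (simp add: projector_def)

lemma sum_splitting_d3: "w \<noteq> 0 \<Longrightarrow> (\<Sum>i<3. splitting i * d3_entry i) = 1"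
proof -
  assume w: "w \<noteq> 0"
  have "splitting i * d3_entry i = z0 i * h (Z_cof c (i + 1)) * inverse w" for i
  proof -
    have "(-1) ^ (c + 1) * (-1) ^ (c + 1) = (1 :: 'q)" by (simp add: power_add[symmetric])
    then show ?thesis by (auto simp: splitting_def d3_entry_def divide_inverse mult_ac)
      (simp add: mult.assoc[symmetric])?
  qed
  then have "(\<Sum>i<3. splitting i * d3_entry i) = w * inverse w"
    by (simp only: sum_distrib_right[symmetric] sum_z0_Z_cof)
  then show ?thesis using w by simp
qed

lemma xy_const_simps: "xy_const (a + b) = xy_const a + xy_const b" "xy_const (a - b) = xy_const a - xy_const b"
    "xy_const (a * b) = xy_const a * xy_const b" "xy_const 1 = 1" "xy_const 0 = 0"
  by (simp_all add: xy_const_def xy_monom_def single_add single_diff mult_single zero_prod_def[symmetric])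

lemma projector_mult:
  assumes v: "v \<in> carrier_vec 3"
  shows "projector *\<^sub>v v = v - sigma v \<cdot>\<^sub>v vec 3 (\<lambda>l. xy_const (d3_entry l))"
proof (rule eq_vecI)
  fix l assume "l < dim_vec (v - sigma v \<cdot>\<^sub>v vec 3 (\<lambda>l. xy_const (d3_entry l)))"
  then have l: "l < 3" by simp
  have "(projector *\<^sub>v v) $ l = (\<Sum>i<3. v $ i * xy_const ((if l = i then 1 else 0) - d3_entry l * splitting i))"
    using l v by (simp add: mult_mat_vec_3_3) (simp add: projector_def)
  also have "\<dots> = (\<Sum>i<3. (if l = i then v $ i else 0) - xy_const (d3_entry l) * (xy_const (splitting i) * v $ i))"
    by (intro sum.cong refl) (simp add: xy_const_simps algebra_simps)
  also have "\<dots> = v $ l - xy_const (d3_entry l) * sigma v"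
    using l by (simp add: sum_subtractf sum_distrib_left sigma_def)
  finally show "(projector *\<^sub>v v) $ l = (v - sigma v \<cdot>\<^sub>v vec 3 (\<lambda>l. xy_const (d3_entry l))) $ l"
    using l v by (simp add: mult.commute)
qed (use v in \<open>simp add: projector_def\<close>)

lemma sigma_projector:
  assumes "v \<in> carrier_vec 3" "w \<noteq> 0"
  shows "sigma (projector *\<^sub>v v) = 0"
proof -
  have "sigma (projector *\<^sub>v v) = sigma v - sigma v * (\<Sum>i<3. xy_const (splitting i * d3_entry i))"
    using assms(1) by (simp add: projector_mult sigma_def[of "_ - _"] sum_lessThan_3 algebra_simps xy_const_simps)
      (simp add: sigma_def sum_lessThan_3)
  also have "(\<Sum>i<3. xy_const (splitting i * d3_entry i)) = xy_const (\<Sum>i<3. splitting i * d3_entry i)"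
    by (simp add: sum_lessThan_3 xy_const_simps)
  finally show ?thesis using sum_splitting_d3[OF assms(2)] by (simp add: xy_const_simps)
qed

lemma sigma_zero_iff_projector_fixed:
  assumes "v \<in> carrier_vec 3" "w \<noteq> 0"
  shows "sigma v = 0 \<longleftrightarrow> projector *\<^sub>v v = v"
proof
  assume "sigma v = 0"
  then show "projector *\<^sub>v v = v"
    using assms(1) by (intro eq_vecI) (auto simp: projector_mult)
next
  assume "projector *\<^sub>v v = v"
  then show "sigma v = 0" using sigma_projector[OF assms] by simp
qed

end

context
  fixes c :: nat assumes c: "c > 0"
begin

lemma comm_ring_hom_to_fract: "comm_ring_hom (to_fract :: zpoly \<Rightarrow> zfrac)"
  by unfold_locales auto

lemma unit_specialization_to_fract: "unit_specialization (to_fract :: zpoly \<Rightarrow> zfrac) c (R_w c)"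
proof -
  interpret comm_ring_hom "to_fract :: zpoly \<Rightarrow> zfrac" by (rule comm_ring_hom_to_fract)
  interpret specialization "to_fract :: zpoly \<Rightarrow> zfrac" c by unfold_locales (rule c)
  show ?thesis
  proof unfold_locales
    show "ring_closed (R_w c)" by (rule ring_closed_R_w[OF c])
    show "to_fract p \<in> R_w c" if "p \<in> R_Z c" for p
      using that unfolding R_w_def by (force simp: to_fract_def intro: exI[of _ 0])
    show "w \<noteq> 0" using w_Z_nonzero[OF c] by (simp add: w_def)
    show "inverse w \<in> R_w c"
      using inverse_w_homogeneous[OF c] R_w_deg_subset[OF c] by (auto simp: w_def)
  qed
qed

interpretation U: unit_specialization "to_fract :: zpoly \<Rightarrow> zfrac" c "R_w c"
  by (rule unit_specialization_to_fract)

lemma UPR_d1_eq: "UPR_d1 c v = U.d1_mat *\<^sub>v v"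
  by (simp add: UPR_d1_def U.d1_mat_def S_emb_def[abs_def])

lemma UPR_d2_eq: "UPR_d2 c v = U.d2_mat *\<^sub>v v"
  by (simp add: UPR_d2_def U.d2_mat_def S_emb_def[abs_def])

lemma UPR_d1_fun: "UPR_d1 c = (\<lambda>v. U.d1_mat *\<^sub>v v)"
  and UPR_d2_fun: "UPR_d2 c = (\<lambda>v. U.d2_mat *\<^sub>v v)"
  by (simp_all add: fun_eq_iff UPR_d1_eq UPR_d2_eq)

lemma sigma_Z_eq_zero_iff:
  assumes v: "v \<in> carrier_vec 3"
  shows "sigma_Z c *\<^sub>v v = 0\<^sub>v 1 \<longleftrightarrow> U.sigma v = 0"
proof -
  have entry: "S_frac c (xy_const a) 1 = xy_const (to_fract a / U.w)" for a
    by (rule poly_mapping_eqI)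
      (auto simp: coef_S_frac xy_const_def xy_monom_def lookup_single when_def Fract_conv_to_fract U.w_def)
  have carrier: "sigma_Z c \<in> carrier_mat 1 3"
    by (simp add: sigma_Z_def mat_of_rows_list_def)
  have "sigma_Z c $$ (0, l) = xy_const (U.splitting l)" if "l < 3" for l
    using that by (auto simp: sigma_Z_def mat_of_rows_list_def entry entry[simplified] U.splitting_def less_Suc_eq numeral_eq_Suc
        U.hom_mult U.hom_uminus U.hom_power)
  then have "sigma_Z c *\<^sub>v v = vec 1 (\<lambda>_. U.sigma v)"
    using mult_mat_vec_1_3[OF carrier v] by (simp add: U.sigma_def mult.commute)
  then show ?thesis by (auto simp: vec_eq_iff)
qed

lemma S_w_deg_zero: "0 \<in> S_w_deg c g"
  unfolding S_w_deg_eq[OF c] by (intro homog_zero R_w_deg_zero[OF c])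

lemma S_w_deg_add: "p \<in> S_w_deg c g \<Longrightarrow> q \<in> S_w_deg c g \<Longrightarrow> p + q \<in> S_w_deg c g"
  unfolding S_w_deg_eq[OF c] by (rule homog_add) (rule R_w_deg_add[OF c])

lemma S_w_deg_mult: "p \<in> S_w_deg c g \<Longrightarrow> q \<in> S_w_deg c g' \<Longrightarrow> p * q \<in> S_w_deg c (g + g')"
  unfolding S_w_deg_eq[OF c] using homog_mult[of p "R_w_deg c (snd g)" "fst g" q "R_w_deg c (snd g')" "fst g'" "R_w_deg c (snd g + snd g')"]
    R_w_deg_zero[OF c] R_w_deg_add[OF c] R_w_deg_mult[OF c] by auto

lemma S_w_deg_xy_const: "a \<in> R_w_deg c d \<Longrightarrow> xy_const a \<in> S_w_deg c (0, d)"
  unfolding S_w_deg_eq[OF c] xy_const_def xy_monom_def by (rule homog_single) (auto intro: R_w_deg_zero[OF c])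

lemma S_w_deg_subset: "S_w_deg c g \<subseteq> S_w c"
  unfolding S_w_deg_eq[OF c] S_w_eq[OF c] by (auto simp: homog_def coeffs_in_def intro: subsetD[OF R_w_deg_subset[OF c]])

lemma ring_closed_S_w: "ring_closed (S_w c)"
  unfolding S_w_eq[OF c] by (rule ring_closed_coeffs_in[OF ring_closed_R_w[OF c]])

lemma d1_entry_deg: "l < 3 \<Longrightarrow> U.d1_mat $$ (0, l) \<in> S_w_deg c (2 * int c, 1)"
  using homogenize_homog[of "R_w_deg c 1" "U.form l" "2 * c"] R_w_deg_zero[OF c]
  by (simp add: U.d1_mat_index S_w_deg_eq[OF c] U.coeff_form to_fract_homogeneous[OF c] zvar_homogeneous[simplified])

lemma d2_entry_deg:
  assumes "l < 3" "i < 3"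
  shows "U.d2_mat $$ (l, i) \<in> S_w_deg c (int c, 3 * int c + 1)"
proof -
  have "coeff (U.syz i l) k \<in> R_w_deg c (3 * int c + 1)" for k
    using block_index_less[of l k c] assms lead_col_bounds[of i c] R_w_deg_zero[OF c]
      to_fract_homogeneous[OF c b_vec_homogeneous[of "lead_col c i" c "(c + 1) * l + k"]]
    by (auto simp: U.coeff_syz add.commute[of 1])
  then show ?thesis
    using homogenize_homog[of "R_w_deg c (3 * int c + 1)" "U.syz i l" c] R_w_deg_zero[OF c] assms
    by (simp add: U.d2_mat_index S_w_deg_eq[OF c])
qed

lemma splitting_deg: "l < 3 \<Longrightarrow> U.splitting l \<in> R_w_deg c (- 1)"
proof -
  assume l: "l < 3"
  have "to_fract ((if l = 1 then (-1) ^ (c + 1) else 1) * Z_cof c (l + 1)) * inverse (to_fract (w_Z c))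
      \<in> R_w_deg c (int (3 * c - 1) + (- int (3 * c)))"
    using Z_cof_homogeneous[OF c l] R_Z_deg_sign[of "Z_cof c (l + 1)" c "int (3 * c - 1)" "c + 1"]
    by (intro R_w_deg_mult[OF c] to_fract_homogeneous[OF c] inverse_w_homogeneous[OF c]) auto
  also have "int (3 * c - 1) + (- int (3 * c)) = - 1" using c by simp
  also have "to_fract ((if l = 1 then (-1) ^ (c + 1) else 1) * Z_cof c (l + 1)) * inverse (to_fract (w_Z c)) = U.splitting l"
    by (simp add: U.splitting_def U.w_def divide_inverse U.hom_uminus U.hom_mult U.hom_power)
  finally show ?thesis .
qed

lemma d3_entry_deg: "l < 3 \<Longrightarrow> U.d3_entry l \<in> R_w_deg c 1"
proof -
  assume l: "l < 3"
  have "to_fract ((if l = 1 then (-1) ^ (c + 1) else 1) * zvar 0 (l + 1)) \<in> R_w_deg c 1"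
    using zvar_homogeneous[of 0 c l] l R_Z_deg_sign[of "zvar 0 (l + 1)" c 1 "c + 1"]
    by (intro to_fract_homogeneous[OF c]) auto
  then show ?thesis
    by (simp add: U.d3_entry_def U.z0_def U.hom_mult U.hom_uminus U.hom_power split: if_splits)
qed

lemma projector_entry_deg:
  assumes "l < 3" "i < 3"
  shows "(if l = i then 1 else 0) - U.d3_entry l * U.splitting i \<in> R_w_deg c 0"
proof -
  have "- 1 \<in> R_w_deg c 0" using to_fract_homogeneous[OF c R_Z_deg_uminus[OF R_Z_deg_one[of c]]] by (simp add: U.hom_uminus)
  moreover have "U.d3_entry l * U.splitting i \<in> R_w_deg c 0"
    using R_w_deg_mult[OF c d3_entry_deg[OF assms(1)] splitting_deg[OF assms(2)]] by simp
  ultimately have "- 1 * (U.d3_entry l * U.splitting i) \<in> R_w_deg c 0"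
    using R_w_deg_mult[OF c, of "- 1" 0] by force
  moreover have "(if l = i then 1 else 0) \<in> R_w_deg c 0"
    using R_w_deg_zero[OF c] to_fract_homogeneous[OF c R_Z_deg_one[of c]] by simp
  ultimately show ?thesis using R_w_deg_add[OF c] by force
qed

lemma UPR2_simps:
  "carrier (UPR2 c) = {v \<in> carrier_vec 3. (\<forall>i<3. v $ i \<in> S_w c) \<and> U.sigma v = 0}"
  "\<zero>\<^bsub>UPR2 c\<^esub> = 0\<^sub>v 3" "ring.add (UPR2 c) = (+)" "module.smult (UPR2 c) = (\<cdot>\<^sub>v)"
  "deg_part (UPR2 c) g = {v \<in> carrier_vec 3. (\<forall>i<3. v $ i \<in> S_w_deg c (g - (3 * int c, 3 * int c + 2))) \<and> U.sigma v = 0}"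
  by (auto simp: UPR2_def Let_def gr_free_def sigma_Z_eq_zero_iff[simplified])

lemma vec_module_on_UPR2: "vec_module_on (S_w c) 3 (\<lambda>v. U.sigma v = 0) (UPR2 c)"
  unfolding vec_module_on_def
proof (intro conjI ballI allI impI)
  fix u v :: "zfrac bipoly vec" assume "u \<in> carrier_vec 3" "v \<in> carrier_vec 3" "U.sigma u = 0" "U.sigma v = 0"
  then show "U.sigma (u + v) = 0" by (simp add: U.sigma_add)
next
  fix r and v :: "zfrac bipoly vec" assume "v \<in> carrier_vec 3" "U.sigma v = 0"
  then show "U.sigma (r \<cdot>\<^sub>v v) = 0" by (simp add: U.sigma_smult)
qed (auto simp: UPR2_simps U.sigma_def)

abbreviation "UPR2_ambient \<equiv> gr_free (S_w c) (S_w_deg c) (replicate 3 (3 * int c, 3 * int c + 2))"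

text \<open>The projection with matrix \<open>1 - d\<^sub>3 \<sigma>\<close> is homogeneous: \<open>d\<^sub>3\<close> and \<open>\<sigma>\<close> have entries of degree \<open>1\<close> and \<open>-1\<close>
  in the variables \<open>z\<close>.\<close>

lemma graded_projective_UPR2: "graded_projective (S_w c) (S_w_deg c) (UPR2 c)"
proof -
  have id: "id \<in> graded_hom (ring_on (S_w c)) (UPR2 c) UPR2_ambient"
    by (auto simp: graded_hom_def UPR2_simps gr_free_simps)
  have P: "(\<lambda>v. U.projector *\<^sub>v v) \<in> graded_hom (ring_on (S_w c)) UPR2_ambient UPR2_ambient"
  proof (rule graded_hom_mult_mat_vec[OF ring_closed_S_w S_w_deg_zero S_w_deg_add])
    fix l i assume li: "l < length (replicate 3 (3 * int c, 3 * int c + 2))" "i < length (replicate 3 (3 * int c, 3 * int c + 2))"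
    then have deg: "U.projector $$ (l, i) \<in> S_w_deg c (0, 0)"
      using S_w_deg_xy_const[OF projector_entry_deg[of l i]] by (simp add: U.projector_def)
    then show "U.projector $$ (l, i) \<in> S_w c" using S_w_deg_subset by auto
    fix g a assume "a \<in> S_w_deg c (g - replicate 3 (3 * int c, 3 * int c + 2) ! i)"
    then show "U.projector $$ (l, i) * a \<in> S_w_deg c (g - replicate 3 (3 * int c, 3 * int c + 2) ! l)"
      using S_w_deg_mult[OF deg] li by (simp add: zero_prod_def[symmetric])
  qed simp_all
  have "(\<lambda>v. U.projector *\<^sub>v v) \<in> graded_hom (ring_on (S_w c)) UPR2_ambient (UPR2 c)"
  proof (rule graded_hom_restrict[OF P])
    show "U.projector *\<^sub>v v \<in> carrier (UPR2 c)" if "v \<in> carrier UPR2_ambient" for v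
      using graded_hom_image(1)[OF P that] U.sigma_projector[OF _ U.w_nonzero, of v] that
      by (simp add: UPR2_simps gr_free_simps del: index_mult_mat_vec)
    show "U.projector *\<^sub>v v \<in> deg_part (UPR2 c) g" if "v \<in> deg_part UPR2_ambient g" for v g
      using graded_hom_image(2)[OF P that] U.sigma_projector[OF _ U.w_nonzero, of v] that
      by (simp add: UPR2_simps gr_free_simps del: index_mult_mat_vec)
  qed (auto simp: UPR2_simps gr_free_def)
  moreover have "U.projector *\<^sub>v id v = v" if "v \<in> carrier (UPR2 c)" for v
    using U.sigma_zero_iff_projector_fixed[OF _ U.w_nonzero, of v] that by (auto simp: UPR2_simps)
  ultimately show ?thesis
    unfolding graded_projective_def
    using module_vec_module_on[OF ring_closed_S_w vec_module_on_UPR2] id by blast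
qed

lemma projective_resolution_UPR:
  "projective_resolution (S_w c) (S_w_deg c) (UPR2 c) (UPR_d2 c) (UPR1 c) (UPR_d1 c) (UPR0 c)"
proof -
  have d1: "UPR_d1 c \<in> graded_hom (ring_on (S_w c)) (UPR1 c) (UPR0 c)"
    unfolding UPR1_def UPR0_def UPR_d1_fun
  proof (rule graded_hom_mult_mat_vec[OF ring_closed_S_w S_w_deg_zero S_w_deg_add])
    fix i j assume ij: "i < length [(0 :: int, 0 :: int)]" "j < length (replicate 3 (2 * int c, 1 :: int))"
    then have deg: "U.d1_mat $$ (i, j) \<in> S_w_deg c (2 * int c, 1)" using d1_entry_deg[of j] by simp
    then show "U.d1_mat $$ (i, j) \<in> S_w c" using S_w_deg_subset by auto
    fix g :: "int \<times> int" and a assume a: "a \<in> S_w_deg c (g - replicate 3 (2 * int c, 1) ! j)"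
    have eq: "(2 * int c, 1) + (g - (2 * int c, 1)) = g - (0, 0)" by (cases g) simp
    have "a \<in> S_w_deg c (g - (2 * int c, 1))" using a ij by simp
    from S_w_deg_mult[OF deg this] show "U.d1_mat $$ (i, j) * a \<in> S_w_deg c (g - [(0, 0)] ! i)"
      unfolding eq using ij by simp
  qed (use U.d1_mat_carrier in simp_all)
  have d2': "UPR_d2 c \<in> graded_hom (ring_on (S_w c)) UPR2_ambient (UPR1 c)"
    unfolding UPR1_def UPR_d2_fun
  proof (rule graded_hom_mult_mat_vec[OF ring_closed_S_w S_w_deg_zero S_w_deg_add])
    fix i j assume ij: "i < length (replicate 3 (2 * int c, 1 :: int))" "j < length (replicate 3 (3 * int c, 3 * int c + 2))"
    then have deg: "U.d2_mat $$ (i, j) \<in> S_w_deg c (int c, 3 * int c + 1)" using d2_entry_deg[of i j] by simp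
    then show "U.d2_mat $$ (i, j) \<in> S_w c" using S_w_deg_subset by auto
    fix g :: "int \<times> int" and a assume a: "a \<in> S_w_deg c (g - replicate 3 (3 * int c, 3 * int c + 2) ! j)"
    have eq: "(int c, 3 * int c + 1) + (g - (3 * int c, 3 * int c + 2)) = g - (2 * int c, 1)"
      by (cases g) simp
    have "a \<in> S_w_deg c (g - (3 * int c, 3 * int c + 2))" using a ij by simp
    from S_w_deg_mult[OF deg this] show "U.d2_mat $$ (i, j) * a \<in> S_w_deg c (g - replicate 3 (2 * int c, 1) ! i)"
      unfolding eq using ij by simp
  qed (use U.d2_mat_carrier in simp_all)
  have d2: "UPR_d2 c \<in> graded_hom (ring_on (S_w c)) (UPR2 c) (UPR1 c)"
  proof (rule graded_hom_restrict[OF d2'])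
    show sub: "carrier (UPR2 c) \<subseteq> carrier UPR2_ambient" by (auto simp: UPR2_simps gr_free_simps)
    show "UPR_d2 c v \<in> carrier (UPR1 c)" if "v \<in> carrier (UPR2 c)" for v
      using graded_hom_image(1)[OF d2'] sub that by blast
    show "UPR_d2 c v \<in> deg_part (UPR1 c) g" if "v \<in> deg_part (UPR2 c) g" for v g
    proof -
      have "v \<in> deg_part UPR2_ambient g" using that by (simp add: UPR2_simps gr_free_simps)
      then show ?thesis by (rule graded_hom_image(2)[OF d2'])
    qed
  qed (simp_all add: UPR2_simps gr_free_def)
  have inj: "inj_on (UPR_d2 c) (carrier (UPR2 c))"
  proof (rule inj_onI)
    fix u v assume uv: "u \<in> carrier (UPR2 c)" "v \<in> carrier (UPR2 c)" "UPR_d2 c u = UPR_d2 c v"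
    then have carr: "u \<in> carrier_vec 3" "v \<in> carrier_vec 3" by (auto simp: UPR2_simps)
    have "U.d2_mat *\<^sub>v (u - v) = U.d2_mat *\<^sub>v u - U.d2_mat *\<^sub>v v"
      using carr U.d2_mat_carrier by (intro mult_minus_distrib_mat_vec) auto
    also have "\<dots> = 0\<^sub>v 3" using uv(3) carr U.d2_mat_carrier by (simp add: UPR_d2_eq)
    finally have "U.d2_mat *\<^sub>v (u - v) = 0\<^sub>v 3" .
    moreover have "U.sigma (u - v) = U.sigma u - U.sigma v" using carr by (rule U.sigma_minus)
    ultimately have "u - v = 0\<^sub>v 3"
      using U.d2_injective_on_kernel_sigma[of "u - v"] carr uv by (simp add: UPR2_simps)
    then show "u = v" using carr by (intro eq_vecI) (auto simp: vec_eq_iff)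
  qed
  have "UPR_d2 c ` carrier (UPR2 c) = {v \<in> carrier (UPR1 c). UPR_d1 c v = \<zero>\<^bsub>UPR0 c\<^esub>}"
  proof (intro equalityI subsetI)
    fix v assume "v \<in> UPR_d2 c ` carrier (UPR2 c)"
    then obtain s where s: "s \<in> carrier (UPR2 c)" "v = UPR_d2 c s" by blast
    then have "v \<in> carrier (UPR1 c)" using d2 by (auto simp: graded_hom_def)
    moreover have "UPR_d1 c v = 0\<^sub>v 1"
      using U.d1_d2_zero[of s] s by (auto simp: UPR2_simps UPR_d1_eq UPR_d2_eq)
    ultimately show "v \<in> {v \<in> carrier (UPR1 c). UPR_d1 c v = \<zero>\<^bsub>UPR0 c\<^esub>}"
      by (simp add: UPR0_def gr_free_simps)
  next
    fix v assume "v \<in> {v \<in> carrier (UPR1 c). UPR_d1 c v = \<zero>\<^bsub>UPR0 c\<^esub>}"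
    then have "v \<in> carrier_vec 3" "\<And>l. l < 3 \<Longrightarrow> v $ l \<in> coeffs_in (R_w c)" "U.d1_mat *\<^sub>v v = 0\<^sub>v 1"
      by (auto simp: UPR1_def UPR0_def gr_free_simps UPR_d1_eq S_w_eq[OF c])
    then obtain s where "s \<in> carrier_vec 3" "\<And>i. i < 3 \<Longrightarrow> s $ i \<in> coeffs_in (R_w c)" "U.sigma s = 0" "U.d2_mat *\<^sub>v s = v"
      using U.d1_kernel_is_combination by blast
    then show "v \<in> UPR_d2 c ` carrier (UPR2 c)"
      by (auto simp: UPR2_simps UPR_d2_eq S_w_eq[OF c] intro!: image_eqI[of v _ s])
  qed
  moreover have "graded_projective (S_w c) (S_w_deg c) (UPR1 c)" "graded_projective (S_w c) (S_w_deg c) (UPR0 c)"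
    unfolding UPR1_def UPR0_def by (rule graded_projective_gr_free[OF ring_closed_S_w])+
  ultimately show ?thesis
    unfolding projective_resolution_def acyclic_complex_def
    using d1 d2 inj graded_projective_UPR2 by blast
qed

end

section \<open>Base change to a field\<close>

definition frag_sum :: "('p \<Rightarrow> 'b::comm_ring_1) \<Rightarrow> ('p \<Rightarrow>\<^sub>0 int) \<Rightarrow> 'b" where
  "frag_sum f x = (\<Sum>p\<in>supp x. of_int (coef x p) * f p)"

lemma frag_sum_zero [simp]: "frag_sum f 0 = 0"
  by (simp add: frag_sum_def)

lemma frag_sum_add: "frag_sum f (x + y) = frag_sum f x + frag_sum f y"
  unfolding frag_sum_def by (rule setsum_keys_plus_distrib) (auto simp: algebra_simps)

lemma frag_sum_of [simp]: "frag_sum f (frag_of p) = f p"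
  by (simp add: frag_sum_def)

lemma frag_sum_diff: "frag_sum f (x - y) = frag_sum f x - frag_sum f y"
  using frag_sum_add[of f "x - y" y] by simp

lemma frag_sum_sum: "frag_sum f (sum g I) = (\<Sum>i\<in>I. frag_sum f (g i))"
  by (induction I rule: infinite_finite_induct) (auto simp: frag_sum_add)

text \<open>The map \<open>S\<^sub>w\<^sup>n \<otimes> k \<rightarrow> B\<^sup>n\<close>, \<open>m \<otimes> a \<mapsto> a \<phi>(m)\<close>, on representatives of the tensors, and its fibers.\<close>

definition tensor_value :: "(zfrac \<Rightarrow> 'k::field) \<Rightarrow> nat \<Rightarrow> ((zfrac bipoly vec \<times> 'k) \<Rightarrow>\<^sub>0 int) \<Rightarrow> 'k bipoly vec" where
  "tensor_value \<phi> n x = vec n (\<lambda>i. frag_sum (\<lambda>(m, a). xy_const a * Poly_Mapping.map \<phi> (m $ i)) x)"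

definition tensor_class :: "(zfrac \<Rightarrow> 'k::field) \<Rightarrow> nat \<Rightarrow> zfrac bipoly vec set \<Rightarrow> 'k bipoly vec \<Rightarrow>
    ((zfrac bipoly vec \<times> 'k) \<Rightarrow>\<^sub>0 int) set" where
  "tensor_class \<phi> n C v = {x. supp x \<subseteq> C \<times> UNIV \<and> tensor_value \<phi> n x = v}"

lemma tensor_value_carrier [simp]: "tensor_value \<phi> n x \<in> carrier_vec n" "dim_vec (tensor_value \<phi> n x) = n"
  by (simp_all add: tensor_value_def)

lemma tensor_value_zero: "tensor_value \<phi> n 0 = 0\<^sub>v n"
  and tensor_value_add: "tensor_value \<phi> n (x + y) = tensor_value \<phi> n x + tensor_value \<phi> n y"
  and tensor_value_diff: "tensor_value \<phi> n (x - y) = tensor_value \<phi> n x - tensor_value \<phi> n y"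
  and tensor_value_of: "tensor_value \<phi> n (frag_of (m, a)) = vec n (\<lambda>i. xy_const a * Poly_Mapping.map \<phi> (m $ i))"
  by (auto simp: tensor_value_def frag_sum_add frag_sum_diff intro!: eq_vecI)

lemma frag_extend_supp:
  assumes "supp x \<subseteq> S" "\<And>p. p \<in> S \<Longrightarrow> supp (f p) \<subseteq> T"
  shows "supp (frag_extend f x) \<subseteq> T"
  using keys_frag_extend[of f x] assms by blast

text \<open>The base change of the module of fixed points of an idempotent matrix \<open>P\<close> with constant
  entries of degree \<open>0\<close> is the module of fixed points of \<open>\<phi>(P)\<close>. All tensors that occur in the
  construction can therefore be handled through their values.\<close>

locale fixed_point_module =
  fixes c :: nat and \<phi> :: "zfrac \<Rightarrow> 'k::field" and n :: nat and P :: "zfrac mat" and g0 :: "int \<times> int"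
    and M :: "(zfrac bipoly, zfrac bipoly vec, int \<times> int) graded_module"
  assumes c_pos: "c > 0"
    and \<phi>: "\<phi> \<in> Ring.ring_hom (ring_on (R_w c)) (ring_on UNIV)"
    and P: "P \<in> carrier_mat n n" "\<And>i j. i < n \<Longrightarrow> j < n \<Longrightarrow> P $$ (i, j) \<in> R_w_deg c 0"
    and P_idem: "\<And>v. v \<in> carrier_vec n \<Longrightarrow> map_mat xy_const P *\<^sub>v (map_mat xy_const P *\<^sub>v v) = map_mat xy_const P *\<^sub>v v"
    and M: "carrier M = {v \<in> carrier_vec n. (\<forall>i<n. v $ i \<in> S_w c) \<and> map_mat xy_const P *\<^sub>v v = v}"
      "\<zero>\<^bsub>M\<^esub> = 0\<^sub>v n" "ring.add M = (+)" "module.smult M = (\<cdot>\<^sub>v)"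
      "\<And>g. deg_part M g = {v \<in> carrier_vec n. (\<forall>i<n. v $ i \<in> S_w_deg c (g - g0)) \<and> map_mat xy_const P *\<^sub>v v = v}"
begin

definition P_k :: "'k bipoly mat" where
  "P_k = map_mat (\<lambda>a. xy_const (\<phi> a)) P"

definition M_k :: "('k bipoly, 'k bipoly vec, int) graded_module" where
  "M_k = \<lparr>carrier = {v \<in> carrier_vec n. P_k *\<^sub>v v = v}, monoid.mult = undefined, monoid.one = undefined,
     ring.zero = 0\<^sub>v n, ring.add = (+), module.smult = (\<cdot>\<^sub>v),
     deg_part = (\<lambda>d. {v \<in> carrier_vec n. (\<forall>i<n. v $ i \<in> B_deg (d - fst g0)) \<and> P_k *\<^sub>v v = v})\<rparr>"

abbreviation "PP \<equiv> map_mat xy_const P"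
abbreviation "\<phi>B \<equiv> (Poly_Mapping.map \<phi> :: zfrac bipoly \<Rightarrow> 'k bipoly)"
abbreviation "R \<equiv> ring_on (R_w c)"
abbreviation "M' \<equiv> restrict_scalars xy_const M"
abbreviation "k \<equiv> field_module \<phi>"
abbreviation "rel \<equiv> tensor_rel R M' k"
abbreviation "free \<equiv> tensor_free M' k"
abbreviation "val \<equiv> tensor_value \<phi> n"
abbreviation "cls \<equiv> tensor_class \<phi> n (carrier M)"

sublocale \<phi>: hom_on "R_w c" \<phi>
proof
  show "ring_closed (R_w c)" by (rule ring_closed_R_w[OF c_pos])
qed (use \<phi> in \<open>auto simp: Ring.ring_hom_def\<close>)

sublocale \<phi>B: hom_on "coeffs_in (R_w c) :: zfrac bipoly set" \<phi>B
  by (rule \<phi>.map_hom_on)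

lemma map_\<phi>_xy_const: "\<phi>B (xy_const a) = xy_const (\<phi> a)"
  by (simp add: xy_const_def xy_monom_def \<phi>.map_hom_single)

lemma P_in_R_w: "i < n \<Longrightarrow> j < n \<Longrightarrow> P $$ (i, j) \<in> R_w c"
  using P(2) R_w_deg_subset[OF c_pos] by blast

lemma PP_in_S: "i < n \<Longrightarrow> j < n \<Longrightarrow> xy_const (P $$ (i, j)) \<in> coeffs_in (R_w c)"
  by (intro xy_const_in_coeffs_in \<phi>.closed P_in_R_w)

lemma M_carrier: "carrier M = {v \<in> carrier_vec n. (\<forall>i<n. v $ i \<in> coeffs_in (R_w c)) \<and> PP *\<^sub>v v = v}"
  by (simp add: M(1) S_w_eq[OF c_pos])

lemma PP_mult: "v \<in> carrier_vec n \<Longrightarrow> i < n \<Longrightarrow> (PP *\<^sub>v v) $ i = (\<Sum>j<n. xy_const (P $$ (i, j)) * v $ j)"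
  using P(1) by (auto simp: scalar_prod_def lessThan_atLeast0 intro!: sum.cong)

lemma P_k_mult: "v \<in> carrier_vec n \<Longrightarrow> i < n \<Longrightarrow> (P_k *\<^sub>v v) $ i = (\<Sum>j<n. xy_const (\<phi> (P $$ (i, j))) * v $ j)"
  using P(1) by (auto simp: P_k_def scalar_prod_def lessThan_atLeast0 intro!: sum.cong)

lemma P_k_carrier: "P_k \<in> carrier_mat n n"
  using P(1) by (simp add: P_k_def)

lemma PP_carrier: "PP \<in> carrier_mat n n"
  using P(1) by simp

lemma M_zero: "0\<^sub>v n \<in> carrier M"
  using PP_carrier ring_closed_zero[OF \<phi>B.closed] by (auto simp: M_carrier)

lemma M_add: "u \<in> carrier M \<Longrightarrow> v \<in> carrier M \<Longrightarrow> u + v \<in> carrier M"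
  using PP_carrier by (auto simp: M_carrier mult_add_distrib_mat_vec[of _ n n] intro!: ring_closed_add[OF \<phi>B.closed])

lemma M_smult: "r \<in> coeffs_in (R_w c) \<Longrightarrow> v \<in> carrier M \<Longrightarrow> r \<cdot>\<^sub>v v \<in> carrier M"
  by (auto simp: M_carrier mult_mat_vec_smult[OF PP_carrier] intro!: ring_closed_mult[OF \<phi>B.closed])

text \<open>The entries of \<open>P\<close> are constants, so \<open>\<phi>\<close> can be applied to the equation \<open>P m = m\<close>.\<close>

lemma map_\<phi>_fixed:
  assumes m: "m \<in> carrier M"
  shows "P_k *\<^sub>v vec n (\<lambda>i. \<phi>B (m $ i)) = vec n (\<lambda>i. \<phi>B (m $ i))"
proof (rule eq_vecI)
  fix i assume "i < dim_vec (vec n (\<lambda>i. \<phi>B (m $ i)))"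
  then have i: "i < n" by simp
  have "\<phi>B (m $ i) = \<phi>B ((PP *\<^sub>v m) $ i)" using m by (simp add: M_carrier)
  also have "\<dots> = \<phi>B (\<Sum>j<n. xy_const (P $$ (i, j)) * m $ j)"
    using PP_mult[of m i] m i by (simp add: M_carrier)
  also have "\<dots> = (\<Sum>j<n. \<phi>B (xy_const (P $$ (i, j)) * m $ j))"
    using m i PP_in_S by (intro \<phi>B.hom_sum ring_closed_mult[OF \<phi>B.closed]) (auto simp: M_carrier)
  also have "\<dots> = (\<Sum>j<n. xy_const (\<phi> (P $$ (i, j))) * \<phi>B (m $ j))"
    using m i PP_in_S by (intro sum.cong refl) (auto simp: M_carrier \<phi>B.hom_mult map_\<phi>_xy_const)
  finally show "(P_k *\<^sub>v vec n (\<lambda>i. \<phi>B (m $ i))) $ i = vec n (\<lambda>i. \<phi>B (m $ i)) $ i"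
    using i P_k_mult[of "vec n (\<lambda>i. \<phi>B (m $ i))" i] by (simp del: index_mult_mat_vec)
qed (use P_k_carrier in simp)

lemma tensor_simps:
  "carrier M' = carrier M" "u \<oplus>\<^bsub>M'\<^esub> v = u + v" "r \<odot>\<^bsub>M'\<^esub> v = xy_const r \<cdot>\<^sub>v v"
  "carrier k = UNIV" "a \<oplus>\<^bsub>k\<^esub> b = a + b" "r \<odot>\<^bsub>k\<^esub> a = \<phi> r * a"
  by (simp_all add: restrict_scalars_def field_module_def M)

lemma free_eq: "free = free_Abelian_group (carrier M \<times> UNIV)"
  by (simp add: tensor_free_def tensor_simps)

definition tensor_relators :: "((zfrac bipoly vec \<times> 'k) \<Rightarrow>\<^sub>0 int) set" where
  "tensor_relators =
    ({frag_of (m + m', a) - frag_of (m, a) - frag_of (m', a) | m m' a. m \<in> carrier M \<and> m' \<in> carrier M} \<union>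
     {frag_of (m, a + a') - frag_of (m, a) - frag_of (m, a') | m a a'. m \<in> carrier M} \<union>
     {frag_of (xy_const r \<cdot>\<^sub>v m, a) - frag_of (m, \<phi> r * a) | r m a. r \<in> R_w c \<and> m \<in> carrier M})"

lemma rel_eq: "rel = generate free tensor_relators"
  unfolding tensor_rel_def tensor_simps ring_on_simps tensor_relators_def by simp

lemma relators_subset:
  assumes "x \<in> tensor_relators"
  shows "x \<in> cls (0\<^sub>v n)"
proof -
  have supp3: "supp (frag_of p - frag_of q - frag_of r) \<subseteq> {p, q, r}" for p q r :: "zfrac bipoly vec \<times> 'k"
    using keys_diff[of "frag_of p - frag_of q" "frag_of r"] keys_diff[of "frag_of p" "frag_of q"] by auto
  have supp2: "supp (frag_of p - frag_of q) \<subseteq> {p, q}" for p q :: "zfrac bipoly vec \<times> 'k"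
    using keys_diff[of "frag_of p" "frag_of q"] by auto
  from assms consider
    (1) m m' a where "x = frag_of (m + m', a) - frag_of (m, a) - frag_of (m', a)" "m \<in> carrier M" "m' \<in> carrier M"
    | (2) m a a' where "x = frag_of (m, a + a') - frag_of (m, a) - frag_of (m, a')" "m \<in> carrier M"
    | (3) r m a where "x = frag_of (xy_const r \<cdot>\<^sub>v m, a) - frag_of (m, \<phi> r * a)" "r \<in> R_w c" "m \<in> carrier M"
    unfolding tensor_relators_def by blast
  then show ?thesis
  proof cases
    case 1
    have "supp x \<subseteq> carrier M \<times> UNIV"
      using supp3[of "(m + m', a)" "(m, a)" "(m', a)"] 1 M_add by fastforce
    moreover have "val x = 0\<^sub>v n"
      unfolding 1(1) using 1(2,3) by (intro eq_vecI) (auto simp: tensor_value_diff tensor_value_of M_carrier \<phi>B.hom_add distrib_left)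
    ultimately show ?thesis by (simp add: tensor_class_def)
  next
    case 2
    have "supp x \<subseteq> carrier M \<times> UNIV"
      using supp3[of "(m, a + a')" "(m, a)" "(m, a')"] 2 by fastforce
    moreover have "val x = 0\<^sub>v n"
      unfolding 2(1) by (intro eq_vecI) (auto simp: tensor_value_diff tensor_value_of xy_const_def xy_monom_def single_add distrib_right)
    ultimately show ?thesis by (simp add: tensor_class_def)
  next
    case 3
    have r: "xy_const r \<in> coeffs_in (R_w c)" by (intro xy_const_in_coeffs_in \<phi>.closed 3)
    then have "supp x \<subseteq> carrier M \<times> UNIV"
      using supp2[of "(xy_const r \<cdot>\<^sub>v m, a)" "(m, \<phi> r * a)"] 3 M_smult[OF r] by fastforce
    moreover have "val x = 0\<^sub>v n"
    proof (rule eq_vecI)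
      fix i assume "i < dim_vec (0\<^sub>v n :: 'k bipoly vec)"
      then have i: "i < n" by simp
      have "\<phi>B (xy_const r * m $ i) = xy_const (\<phi> r) * \<phi>B (m $ i)"
        using r i 3 by (subst \<phi>B.hom_mult) (auto simp: M_carrier map_\<phi>_xy_const)
      moreover have "xy_const (\<phi> r * a) = xy_const (\<phi> r) * xy_const a"
        by (simp add: xy_const_def xy_monom_def mult_single)
      ultimately show "val x $ i = 0\<^sub>v n $ i"
          unfolding 3(1) using 3(3) i by (auto simp: tensor_value_diff tensor_value_of M_carrier mult_ac)
      qed simp
    ultimately show ?thesis by (simp add: tensor_class_def)
  qed
qed

lemma cls_zero_uminus: "x \<in> cls (0\<^sub>v n) \<Longrightarrow> - x \<in> cls (0\<^sub>v n)"
  using tensor_value_diff[of \<phi> n 0 x] by (auto simp: tensor_class_def tensor_value_zero)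

lemma cls_add: "x \<in> cls u \<Longrightarrow> y \<in> cls v \<Longrightarrow> x + y \<in> cls (u + v)"
  using keys_add[of x y] by (auto simp: tensor_class_def tensor_value_add)

lemma rel_subset: "rel \<subseteq> cls (0\<^sub>v n)"
proof
  fix x assume "x \<in> rel"
  then show "x \<in> cls (0\<^sub>v n)"
    unfolding rel_eq
  proof (induction x rule: generate.induct)
    case one
    show ?case by (simp add: free_eq tensor_class_def tensor_value_zero)
  next
    case (incl x)
    then show ?case by (rule relators_subset)
  next
    case (inv x)
    then have x: "x \<in> cls (0\<^sub>v n)" by (rule relators_subset)
    then have "inv\<^bsub>free\<^esub> x = - x" by (simp add: free_eq tensor_class_def)
    then show ?case using cls_zero_uminus[OF x] by simp
  next
    case (eng x y)
    then show ?case using cls_add[of x "0\<^sub>v n" y "0\<^sub>v n"] by (simp add: free_eq)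
  qed
qed

lemma rel_zero: "0 \<in> rel"
  unfolding rel_eq using generate.one[of free] by (simp add: free_eq)

lemma rel_add: "x \<in> rel \<Longrightarrow> y \<in> rel \<Longrightarrow> x + y \<in> rel"
  unfolding rel_eq using generate.eng[of x free] by (simp add: free_eq)

lemma rel_uminus:
  assumes "x \<in> rel"
  shows "- x \<in> rel"
proof -
  interpret group free by (simp add: free_eq)
  have "tensor_relators \<subseteq> carrier free"
    using relators_subset by (auto simp: free_eq tensor_class_def)
  then have "inv\<^bsub>free\<^esub> x \<in> rel"
    using generate_m_inv_closed assms unfolding rel_eq by blast
  moreover have "supp x \<subseteq> carrier M \<times> UNIV" using rel_subset assms by (auto simp: tensor_class_def)
  ultimately show ?thesis by (simp add: free_eq)
qed

lemma rel_diff: "x \<in> rel \<Longrightarrow> y \<in> rel \<Longrightarrow> x - y \<in> rel"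
  using rel_add[of x "- y"] rel_uminus[of y] by simp

lemma rel_sum: "(\<And>i. i \<in> I \<Longrightarrow> f i \<in> rel) \<Longrightarrow> sum f I \<in> rel"
  by (induction I rule: infinite_finite_induct) (auto intro: rel_zero rel_add)

lemma relator_add_left: "m \<in> carrier M \<Longrightarrow> m' \<in> carrier M \<Longrightarrow>
    frag_of (m + m', a) - frag_of (m, a) - frag_of (m', a) \<in> rel"
  and relator_add_right: "m \<in> carrier M \<Longrightarrow> frag_of (m, a + a') - frag_of (m, a) - frag_of (m, a') \<in> rel"
  and relator_smult: "r \<in> R_w c \<Longrightarrow> m \<in> carrier M \<Longrightarrow> frag_of (xy_const r \<cdot>\<^sub>v m, a) - frag_of (m, \<phi> r * a) \<in> rel"
  unfolding rel_eq by (rule generate.incl; unfold tensor_relators_def; blast)+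

lemma frag_of_zero_left: "frag_of (0\<^sub>v n, a) \<in> rel"
  using rel_uminus[OF relator_add_left[OF M_zero M_zero, of a]] by simp

lemma frag_of_zero_right: "m \<in> carrier M \<Longrightarrow> frag_of (m, 0) \<in> rel"
  using rel_uminus[OF relator_add_right[of m 0 0]] by simp

text \<open>The elements \<open>P (x\<^sup>i y\<^sup>j e\<^sub>l)\<close> span the module over \<open>R\<^sub>w\<close>.\<close>

definition basis :: "nat \<times> nat \<times> nat \<Rightarrow> zfrac bipoly vec" where
  "basis = (\<lambda>(l, i, j). PP *\<^sub>v vec n (\<lambda>l'. if l' = l then xy_monom i j 1 else 0))"

lemma basis_index: "l' < n \<Longrightarrow> l < n \<Longrightarrow> basis (l, i, j) $ l' = xy_const (P $$ (l', l)) * xy_monom i j 1"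
  by (simp add: basis_def PP_mult if_distrib[of "\<lambda>x. _ * x"] sum.delta del: index_mult_mat_vec cong: if_cong)

lemma basis_in_M:
  assumes "l < n"
  shows "basis (l, e) \<in> carrier M"
proof -
  obtain i j where e: "e = (i, j)" by (cases e)
  have "xy_monom i j 1 \<in> coeffs_in (R_w c)"
    unfolding xy_monom_def by (intro coeffs_in_single \<phi>.closed ring_closed_one[OF \<phi>.closed])
  then have "basis (l, i, j) $ l' \<in> coeffs_in (R_w c)" if "l' < n" for l'
    using that assms by (auto simp: basis_index intro!: ring_closed_mult[OF \<phi>B.closed] PP_in_S)
  moreover have "basis (l, i, j) \<in> carrier_vec n" using PP_carrier by (simp add: basis_def)
  moreover have "PP *\<^sub>v basis (l, i, j) = basis (l, i, j)"
    unfolding basis_def prod.case by (rule P_idem) simp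
  ultimately show ?thesis by (simp add: M_carrier e del: index_mult_mat_vec)
qed

lemma basis_in_deg_part:
  assumes "l < n"
  shows "basis (l, i, j) \<in> deg_part M (int (i + j) + fst g0, snd g0)"
proof -
  have "xy_monom i j 1 \<in> S_w_deg c (int (i + j), 0)"
    unfolding S_w_deg_eq[OF c_pos] xy_monom_def
    using to_fract_homogeneous[OF c_pos R_Z_deg_one] R_w_deg_zero[OF c_pos] by (intro homog_single) auto
  then have "basis (l, i, j) $ l' \<in> S_w_deg c ((0, 0) + (int (i + j), 0))" if "l' < n" for l'
    using that assms unfolding basis_index[OF that assms]
    by (intro S_w_deg_mult[OF c_pos] S_w_deg_xy_const[OF c_pos] P)
  moreover have "(0, 0) + (int (i + j), 0 :: int) = (int (i + j) + fst g0, snd g0) - g0"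
    by (cases g0) simp
  ultimately show ?thesis
    using basis_in_M[OF assms, of "(i, j)"] by (simp add: M(5) M_carrier)
qed

definition combination :: "(nat \<times> nat \<times> nat \<Rightarrow> zfrac) \<Rightarrow> (nat \<times> nat \<times> nat) set \<Rightarrow> zfrac bipoly vec" where
  "combination r J = vec n (\<lambda>l. \<Sum>j\<in>J. xy_const (r j) * basis j $ l)"

lemma combination_tensor:
  assumes "finite J" "\<And>l e. (l, e) \<in> J \<Longrightarrow> l < n" "\<And>j. j \<in> J \<Longrightarrow> r j \<in> R_w c"
  shows "combination r J \<in> carrier M \<and> frag_of (combination r J, a) - (\<Sum>j\<in>J. frag_of (basis j, \<phi> (r j) * a)) \<in> rel"
  using assms
proof (induction J rule: finite_induct)
  case empty
  have "combination r {} = 0\<^sub>v n" by (intro eq_vecI) (auto simp: combination_def)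
  then show ?case using M_zero frag_of_zero_left by simp
next
  case (insert j J)
  obtain l e where j: "j = (l, e)" by (cases j)
  have l: "l < n" and r: "r j \<in> R_w c" using insert.prems(1)[of l e] insert.prems(2)[of j] by (auto simp: j)
  have b: "basis j \<in> carrier M" unfolding j by (rule basis_in_M[OF l])
  have rb: "xy_const (r j) \<cdot>\<^sub>v basis j \<in> carrier M"
    using M_smult[OF xy_const_in_coeffs_in[OF \<phi>.closed r] b] .
  have IH: "combination r J \<in> carrier M" "frag_of (combination r J, a) - (\<Sum>j\<in>J. frag_of (basis j, \<phi> (r j) * a)) \<in> rel"
    using insert by auto
  have eq: "combination r (insert j J) = xy_const (r j) \<cdot>\<^sub>v basis j + combination r J"
    using insert.hyps b by (intro eq_vecI) (auto simp: combination_def M_carrier)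
  have "frag_of (combination r (insert j J), a) - (\<Sum>j\<in>insert j J. frag_of (basis j, \<phi> (r j) * a)) =
      (frag_of (xy_const (r j) \<cdot>\<^sub>v basis j + combination r J, a) - frag_of (xy_const (r j) \<cdot>\<^sub>v basis j, a) - frag_of (combination r J, a))
      + (frag_of (xy_const (r j) \<cdot>\<^sub>v basis j, a) - frag_of (basis j, \<phi> (r j) * a))
      + (frag_of (combination r J, a) - (\<Sum>j\<in>J. frag_of (basis j, \<phi> (r j) * a)))"
    using insert.hyps by (simp add: eq)
  also have "\<dots> \<in> rel"
    by (intro rel_add relator_add_left relator_smult IH rb b r)
  finally show ?case using eq M_add[OF rb IH(1)] by simp
qed

lemma M_eq_combination:
  assumes m: "m \<in> carrier M" and E: "finite E" "\<And>l. l < n \<Longrightarrow> supp (m $ l) \<subseteq> E"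
  shows "m = combination (\<lambda>(l, e). coef (m $ l) e) ({..<n} \<times> E)"
proof (rule eq_vecI)
  fix l' assume "l' < dim_vec (combination (\<lambda>(l, e). coef (m $ l) e) ({..<n} \<times> E))"
  then have l': "l' < n" by (simp add: combination_def)
  have entry: "xy_const (coef (m $ l) e) * basis (l, e) $ l' = xy_const (P $$ (l', l)) * Poly_Mapping.single e (coef (m $ l) e)"
    if "l < n" for l e
    using that l' by (cases e) (simp add: basis_index xy_const_def xy_monom_def mult_single mult.commute)
  have "combination (\<lambda>(l, e). coef (m $ l) e) ({..<n} \<times> E) $ l' =
      (\<Sum>l<n. \<Sum>e\<in>E. xy_const (coef (m $ l) e) * basis (l, e) $ l')"
    using l' by (simp add: combination_def sum.cartesian_product case_prod_beta)
  also have "\<dots> = (\<Sum>l<n. xy_const (P $$ (l', l)) * (\<Sum>e\<in>E. Poly_Mapping.single e (coef (m $ l) e)))"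
    by (simp add: entry sum_distrib_left)
  also have "\<dots> = (\<Sum>l<n. xy_const (P $$ (l', l)) * m $ l)"
    using E by (simp add: sum_singles)
  also have "\<dots> = m $ l'" using m l' PP_mult[of m l'] by (simp add: M_carrier)
  finally show "m $ l' = combination (\<lambda>(l, e). coef (m $ l) e) ({..<n} \<times> E) $ l'" by simp
qed (use m in \<open>simp add: combination_def M_carrier\<close>)

text \<open>A preimage of \<open>v\<close>, for \<open>v\<close> fixed by \<open>\<phi>(P)\<close>, under the map that takes a tensor to its value. The set \<open>E\<close>
  of exponents is a parameter so that the lift is additive up to relations.\<close>

definition lift :: "(nat \<times> nat) set \<Rightarrow> 'k bipoly vec \<Rightarrow> (zfrac bipoly vec \<times> 'k) \<Rightarrow>\<^sub>0 int" where
  "lift E v = (\<Sum>(l, e)\<in>{..<n} \<times> E. frag_of (basis (l, e), coef (v $ l) e))"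

lemma lift_diff:
  assumes "u \<in> carrier_vec n" "v \<in> carrier_vec n"
  shows "lift E u - lift E v - lift E (u - v) \<in> rel"
proof -
  have "lift E u - lift E v - lift E (u - v) =
      (\<Sum>(l, e)\<in>{..<n} \<times> E. frag_of (basis (l, e), coef (u $ l) e) - frag_of (basis (l, e), coef (v $ l) e)
         - frag_of (basis (l, e), coef ((u - v) $ l) e))"
    by (simp add: lift_def sum_subtractf case_prod_beta)
  also have "\<dots> \<in> rel"
  proof (rule rel_sum, clarify)
    fix l e1 e2 assume l: "l < n"
    have "coef (u $ l) (e1, e2) = coef (v $ l) (e1, e2) + coef ((u - v) $ l) (e1, e2)"
      using l assms by (simp add: lookup_minus)
    then show "frag_of (basis (l, e1, e2), coef (u $ l) (e1, e2)) - frag_of (basis (l, e1, e2), coef (v $ l) (e1, e2))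
         - frag_of (basis (l, e1, e2), coef ((u - v) $ l) (e1, e2)) \<in> rel"
      using relator_add_right[OF basis_in_M[OF l]] by metis
  qed
  finally show ?thesis .
qed

lemma lift_zero: "lift E (0\<^sub>v n) \<in> rel"
  unfolding lift_def by (rule rel_sum) (auto intro!: frag_of_zero_right basis_in_M)

text \<open>Expanding \<open>m = P m\<close> in terms of the elements \<open>P (x\<^sup>i y\<^sup>j e\<^sub>l)\<close> and moving the coefficients, which are in
  \<open>R\<^sub>w\<close>, across the tensor sign turns \<open>m \<otimes> a\<close> into the lift of its value.\<close>

lemma equals_lift_value:
  assumes "finite E" "supp x \<subseteq> {(m, a). m \<in> carrier M \<and> (\<forall>l<n. supp (m $ l) \<subseteq> E)}"
  shows "x - lift E (val x) \<in> rel"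
  using assms(2)
proof (induction x rule: frag_induction)
  case zero
  show ?case using rel_uminus[OF lift_zero] by (simp add: tensor_value_zero)
next
  case (one p)
  obtain m a where p: "p = (m, a)" by (cases p)
  have m: "m \<in> carrier M" "\<And>l. l < n \<Longrightarrow> supp (m $ l) \<subseteq> E" using one p by auto
  define r where "r = (\<lambda>(l, e). coef (m $ l) e)"
  have "m = combination r ({..<n} \<times> E)"
    unfolding r_def by (rule M_eq_combination[OF m(1) assms(1) m(2)])
  moreover have "frag_of (combination r ({..<n} \<times> E), a) - (\<Sum>j\<in>{..<n} \<times> E. frag_of (basis j, \<phi> (r j) * a)) \<in> rel"
    using combination_tensor[of "{..<n} \<times> E" r a] assms(1) m by (auto simp: r_def M_carrier coeffs_in_def)
  moreover have "(\<Sum>j\<in>{..<n} \<times> E. frag_of (basis j, \<phi> (r j) * a)) = lift E (val (frag_of p))"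
    unfolding lift_def by (rule sum.cong) (auto simp: p tensor_value_of coef_xy_const_mult \<phi>.coef_map_hom r_def mult.commute)
  ultimately show ?case by (simp add: p)
next
  case (diff x y)
  have "x - y - lift E (val (x - y)) =
      (x - lift E (val x)) - (y - lift E (val y)) + (lift E (val x) - lift E (val y) - lift E (val x - val y))"
    by (simp add: tensor_value_diff)
  also have "\<dots> \<in> rel" by (intro rel_add rel_diff diff lift_diff) simp_all
  finally show ?case .
qed

text \<open>So two representatives define the same tensor precisely if they have the same value, and a tensor is
  a fiber of the value map.\<close>

lemma rel_eq_class: "rel = cls (0\<^sub>v n)"
proof (intro equalityI rel_subset subsetI)
  fix x assume x: "x \<in> cls (0\<^sub>v n)"
  define E where "E = (\<Union>p\<in>supp x. \<Union>l<n. supp (fst p $ l))"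
  have "x - lift E (val x) \<in> rel"
  proof (rule equals_lift_value)
    show "finite E" by (simp add: E_def)
    have "supp (m $ l) \<subseteq> E" if "(m, a) \<in> supp x" "l < n" for m a l
      unfolding E_def
    proof (intro subsetI UN_I)
      show "(m, a) \<in> supp x" "l \<in> {..<n}" using that by simp_all
    qed simp
    then show "supp x \<subseteq> {(m, a). m \<in> carrier M \<and> (\<forall>l<n. supp (m $ l) \<subseteq> E)}"
      using x by (auto simp: tensor_class_def)
  qed
  then show "x \<in> rel" using rel_add[OF _ lift_zero, of "x - lift E (0\<^sub>v n)" E] x by (simp add: tensor_class_def)
qed

lemma M_k_simps:
  "carrier M_k = {v \<in> carrier_vec n. P_k *\<^sub>v v = v}" "\<zero>\<^bsub>M_k\<^esub> = 0\<^sub>v n"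
  "u \<oplus>\<^bsub>M_k\<^esub> v = u + v" "r \<odot>\<^bsub>M_k\<^esub> v = r \<cdot>\<^sub>v v"
  "deg_part M_k d = {v \<in> carrier_vec n. (\<forall>i<n. v $ i \<in> B_deg (d - fst g0)) \<and> P_k *\<^sub>v v = v}"
  by (simp_all add: M_k_def)

lemma P_k_mult_zero: "P_k *\<^sub>v 0\<^sub>v n = 0\<^sub>v n"
  using P_k_carrier by (intro eq_vecI) (auto simp: scalar_prod_def)

lemma vec_module_on_M_k: "vec_module_on UNIV n (\<lambda>v. P_k *\<^sub>v v = v) M_k"
  using P_k_carrier by (auto simp: vec_module_on_def M_k_def mult_add_distrib_mat_vec[of _ n n] mult_mat_vec_smult[OF P_k_carrier])

lemma val_in_M_k:
  assumes "supp x \<subseteq> carrier M \<times> UNIV"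
  shows "val x \<in> carrier M_k"
  using assms
proof (induction x rule: frag_induction)
  case zero
  show ?case by (simp add: tensor_value_zero M_k_simps P_k_mult_zero)
next
  case (one p)
  obtain m a where p: "p = (m, a)" by (cases p)
  have "val (frag_of p) = xy_const a \<cdot>\<^sub>v vec n (\<lambda>i. \<phi>B (m $ i))"
    by (intro eq_vecI) (auto simp: p tensor_value_of)
  then show ?case using map_\<phi>_fixed[of m] one by (simp add: p M_k_simps mult_mat_vec_smult[OF P_k_carrier])
next
  case (diff x y)
  then show ?case using P_k_carrier
    by (simp add: M_k_simps tensor_value_diff mult_minus_distrib_mat_vec[of _ n n])
qed

lemma lift_supp: "supp (lift E v) \<subseteq> carrier M \<times> UNIV"
proof -
  have "supp (frag_of (basis (l, e), a)) \<subseteq> carrier M \<times> UNIV" if "l < n" for l e and a :: 'k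
    using basis_in_M[OF that] by simp
  then show ?thesis
    unfolding lift_def using keys_sum[of "\<lambda>(l, e). frag_of (basis (l, e), coef (v $ l) e)" "{..<n} \<times> E"]
    by fastforce
qed

lemma val_lift:
  assumes v: "v \<in> carrier M_k" and E: "finite E" "\<And>l. l < n \<Longrightarrow> supp (v $ l) \<subseteq> E"
  shows "val (lift E v) = v"
proof (rule eq_vecI)
  fix i assume "i < dim_vec v"
  then have i: "i < n" using v by (auto simp: M_k_simps)
  have entry: "xy_const (coef (v $ l) e) * \<phi>B (basis (l, e) $ i) =
      xy_const (\<phi> (P $$ (i, l))) * Poly_Mapping.single e (coef (v $ l) e)" if l: "l < n" for l e
  proof -
    obtain a b where e: "e = (a, b)" by (cases e)
    have "xy_monom a b 1 \<in> coeffs_in (R_w c)"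
      unfolding xy_monom_def by (intro coeffs_in_single \<phi>.closed ring_closed_one[OF \<phi>.closed])
    then have "\<phi>B (basis (l, e) $ i) = xy_const (\<phi> (P $$ (i, l))) * xy_monom a b 1"
      using i l PP_in_S[OF i l]
      by (simp add: e basis_index \<phi>B.hom_mult map_\<phi>_xy_const) (simp add: xy_monom_def \<phi>.map_hom_single \<phi>.hom_one)
    then show ?thesis by (simp add: e xy_const_def xy_monom_def mult_single mult.commute)
  qed
  have "val (lift E v) $ i = (\<Sum>l<n. \<Sum>e\<in>E. xy_const (coef (v $ l) e) * \<phi>B (basis (l, e) $ i))"
    using i by (simp add: tensor_value_def lift_def frag_sum_sum case_prod_beta sum.cartesian_product)
  also have "\<dots> = (\<Sum>l<n. xy_const (\<phi> (P $$ (i, l))) * (\<Sum>e\<in>E. Poly_Mapping.single e (coef (v $ l) e)))"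
    by (simp add: entry sum_distrib_left)
  also have "\<dots> = (\<Sum>l<n. xy_const (\<phi> (P $$ (i, l))) * v $ l)"
    using E by (simp add: sum_singles)
  also have "\<dots> = v $ i" using v i P_k_mult[of v i] by (simp add: M_k_simps)
  finally show "val (lift E v) $ i = v $ i" .
qed (use v in \<open>auto simp: M_k_simps\<close>)

definition exponents :: "'k bipoly vec \<Rightarrow> (nat \<times> nat) set" where
  "exponents v = (\<Union>l<n. supp (v $ l))"

lemma lift_in_cls: "v \<in> carrier M_k \<Longrightarrow> lift (exponents v) v \<in> cls v"
  using lift_supp[of "exponents v" v] val_lift[of v "exponents v"] by (auto simp: tensor_class_def exponents_def)

lemma inj_on_cls: "inj_on cls (carrier M_k)"
proof (rule inj_onI)
  fix u v assume "u \<in> carrier M_k" "cls u = cls v"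
  then have "lift (exponents u) u \<in> cls v" using lift_in_cls by blast
  then show "u = v" using lift_in_cls[OF \<open>u \<in> carrier M_k\<close>] by (simp add: tensor_class_def)
qed

text \<open>A nonempty part \<open>C\<close> of a fiber suffices on one side, as the other factor contributes all differences.\<close>

lemma set_mult_cls:
  assumes "C \<noteq> {}" "C \<subseteq> cls u" "u \<in> carrier_vec n" "v \<in> carrier_vec n"
  shows "cls v <#>\<^bsub>free\<^esub> C = cls (v + u)"
proof (intro equalityI subsetI)
  fix x assume "x \<in> cls v <#>\<^bsub>free\<^esub> C"
  then show "x \<in> cls (v + u)" using assms cls_add by (auto simp: set_mult_def free_eq)
next
  fix x assume x: "x \<in> cls (v + u)"
  obtain y where y: "y \<in> C" "y \<in> cls u" using assms by blast
  have "v + u - u = v" using assms(3,4) by (intro eq_vecI) auto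
  then have "x - y \<in> cls v"
    using x y keys_diff[of x y] by (auto simp: tensor_class_def tensor_value_diff)
  then show "x \<in> cls v <#>\<^bsub>free\<^esub> C"
    using y by (force simp: set_mult_def free_eq)
qed

lemma coset_eq:
  assumes "supp x \<subseteq> carrier M \<times> UNIV"
  shows "rel #>\<^bsub>free\<^esub> x = cls (val x)"
proof -
  have "rel #>\<^bsub>free\<^esub> x = cls (0\<^sub>v n) <#>\<^bsub>free\<^esub> {x}"
    by (simp add: r_coset_eq_set_mult rel_eq_class)
  also have "\<dots> = cls (0\<^sub>v n + val x)"
    using assms by (intro set_mult_cls) (auto simp: tensor_class_def)
  finally show ?thesis by simp
qed

text \<open>Adding all relations to the image of a single fiber fills up a fiber, so that a map induced on tensors
  is determined by its effect on values.\<close>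

lemma tensor_induced_eq:
  assumes v: "v \<in> carrier M_k" and "u \<in> carrier_vec n"
    and f: "\<And>x. supp x \<subseteq> C \<times> UNIV \<Longrightarrow> supp (frag_extend f x) \<subseteq> carrier M \<times> UNIV"
      "\<And>x. supp x \<subseteq> C \<times> UNIV \<Longrightarrow> tensor_value \<phi> n' x = v' \<Longrightarrow> val (frag_extend f x) = u"
    and ne: "tensor_class \<phi> n' C v' \<noteq> {}"
  shows "tensor_induced R M' k f (tensor_class \<phi> n' C v') = cls u"
proof -
  have "frag_extend f ` tensor_class \<phi> n' C v' \<subseteq> cls u"
    using f by (auto simp: tensor_class_def)
  then have "cls (0\<^sub>v n) <#>\<^bsub>free\<^esub> (frag_extend f ` tensor_class \<phi> n' C v') = cls (0\<^sub>v n + u)"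
    using ne assms(2) by (intro set_mult_cls) auto
  then show ?thesis using assms(2) by (simp add: tensor_induced_def rel_eq_class)
qed

definition M_tensor :: "('k bipoly, ((zfrac bipoly vec \<times> 'k) \<Rightarrow>\<^sub>0 int) set, int) graded_module" where
  "M_tensor = base_change c \<phi> M"

abbreviation "T \<equiv> tensor R M' k"

lemma T_carrier: "carrier T = cls ` carrier M_k"
proof -
  have "carrier T = (\<lambda>x. rel #>\<^bsub>free\<^esub> x) ` carrier free"
    by (auto simp: tensor_def FactGroup_def RCOSETS_def)
  also have "\<dots> = (\<lambda>x. cls (val x)) ` carrier free"
    by (intro image_cong refl coset_eq) (simp add: free_eq)
  also have "\<dots> = cls ` carrier M_k"
  proof (intro equalityI subsetI)
    fix C assume "C \<in> cls ` carrier M_k"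
    then obtain v where v: "v \<in> carrier M_k" "C = cls v" by blast
    then have "C = cls (val (lift (exponents v) v))" using lift_in_cls[of v] by (simp add: tensor_class_def)
    moreover have "lift (exponents v) v \<in> carrier free" using lift_supp by (simp add: free_eq)
    ultimately show "C \<in> (\<lambda>x. cls (val x)) ` carrier free" by blast
  qed (use val_in_M_k in \<open>auto simp: free_eq\<close>)
  finally show ?thesis .
qed

lemma T_mult: "u \<in> carrier M_k \<Longrightarrow> v \<in> carrier M_k \<Longrightarrow> cls u \<otimes>\<^bsub>T\<^esub> cls v = cls (u + v)"
  using set_mult_cls[of "cls v" v u] lift_in_cls[of v] by (auto simp: tensor_def FactGroup_def M_k_simps)

lemma T_one: "\<one>\<^bsub>T\<^esub> = cls (0\<^sub>v n)"
  by (simp add: tensor_def FactGroup_def rel_eq_class)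

lemma group_T: "group T"
proof -
  interpret free: comm_group free by (simp add: free_eq abelian_free_Abelian_group)
  have "tensor_relators \<subseteq> carrier free"
    using relators_subset by (auto simp: free_eq tensor_class_def)
  then have "subgroup rel free" unfolding rel_eq by (rule free.generate_is_subgroup)
  then have "rel \<lhd> free" by (rule free.subgroup_imp_normal)
  then show ?thesis unfolding tensor_def by (rule normal.factorgroup_is_group)
qed

lemma M_k_uminus: "v \<in> carrier M_k \<Longrightarrow> - v \<in> carrier M_k"
proof -
  assume v: "v \<in> carrier M_k"
  have "(- 1) \<cdot>\<^sub>v v = - v" by (intro eq_vecI) auto
  then show ?thesis using v mult_mat_vec_smult[OF P_k_carrier, of v "- 1"] by (simp add: M_k_simps)
qed

lemma T_inv:
  assumes v: "v \<in> carrier M_k"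
  shows "inv\<^bsub>T\<^esub> (cls v) = cls (- v)"
proof (rule group.inv_equality[OF group_T])
  have "- v + v = 0\<^sub>v n" using v by (auto simp: M_k_simps)
  then show "cls (- v) \<otimes>\<^bsub>T\<^esub> cls v = \<one>\<^bsub>T\<^esub>" by (simp add: T_mult M_k_uminus v T_one)
qed (use v M_k_uminus in \<open>auto simp: T_carrier\<close>)

lemma M_tensor_simps: "carrier M_tensor = cls ` carrier M_k" "\<zero>\<^bsub>M_tensor\<^esub> = cls (0\<^sub>v n)"
    "u \<in> carrier M_k \<Longrightarrow> v \<in> carrier M_k \<Longrightarrow> cls u \<oplus>\<^bsub>M_tensor\<^esub> cls v = cls (u + v)"
  by (simp_all add: M_tensor_def base_change_def Let_def T_carrier T_one T_mult)

lemma M_tensor_smult: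
  assumes v: "v \<in> carrier M_k"
  shows "p \<odot>\<^bsub>M_tensor\<^esub> cls v = cls (p \<cdot>\<^sub>v v)"
proof -
  define f where "f = (\<lambda>(m, a). \<Sum>(i, j)\<in>supp p. frag_of (xy_monom i j 1 \<odot>\<^bsub>M\<^esub> m, coef p (i, j) * a))"
  have f_supp: "supp (f q) \<subseteq> carrier M \<times> UNIV" if "q \<in> carrier M \<times> UNIV" for q
  proof -
    obtain m a where q: "q = (m, a)" by (cases q)
    have "xy_monom i j 1 \<odot>\<^bsub>M\<^esub> m \<in> carrier M" for i j
      using that M_smult[of "xy_monom i j 1" m] coeffs_in_single[OF \<phi>.closed ring_closed_one[OF \<phi>.closed], of "(i, j)"]
      by (simp add: q M(4) xy_monom_def)
    then show ?thesis
      using keys_sum[of "\<lambda>(i, j). frag_of (xy_monom i j 1 \<odot>\<^bsub>M\<^esub> m, coef p (i, j) * a)" "supp p"]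
      by (fastforce simp: f_def q)
  qed
  have f_val: "val (f (m, a)) = p \<cdot>\<^sub>v val (frag_of (m, a))" if m: "m \<in> carrier M" for m a
  proof (rule eq_vecI)
    fix i assume "i < dim_vec (p \<cdot>\<^sub>v val (frag_of (m, a)))"
    then have i: "i < n" by simp
    have entry: "xy_const (coef p e * a) * \<phi>B ((xy_monom (fst e) (snd e) 1 \<cdot>\<^sub>v m) $ i) =
        Poly_Mapping.single e (coef p e) * (xy_const a * \<phi>B (m $ i))" for e
    proof -
      have "xy_monom (fst e) (snd e) 1 \<in> coeffs_in (R_w c)"
        unfolding xy_monom_def by (intro coeffs_in_single \<phi>.closed ring_closed_one[OF \<phi>.closed])
      then have "\<phi>B ((xy_monom (fst e) (snd e) 1 \<cdot>\<^sub>v m) $ i) = Poly_Mapping.single e 1 * \<phi>B (m $ i)"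
        using m i by (auto simp: M_carrier \<phi>B.hom_mult) (simp add: xy_monom_def \<phi>.map_hom_single \<phi>.hom_one)
      then show ?thesis
        by (simp add: xy_const_def xy_monom_def mult.assoc[symmetric] mult_single zero_prod_def[symmetric])
    qed
    have "val (f (m, a)) $ i = (\<Sum>e\<in>supp p. xy_const (coef p e * a) * \<phi>B ((xy_monom (fst e) (snd e) 1 \<cdot>\<^sub>v m) $ i))"
      using i by (simp add: tensor_value_def f_def frag_sum_sum case_prod_beta M(4) del: index_smult_vec)
    also have "\<dots> = p * (xy_const a * \<phi>B (m $ i))"
      unfolding entry sum_distrib_right[symmetric] by (simp add: sum_singles)
    finally show "val (f (m, a)) $ i = (p \<cdot>\<^sub>v val (frag_of (m, a))) $ i"
      using i by (simp add: tensor_value_of)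
  qed simp
  have val_f: "val (frag_extend f x) = p \<cdot>\<^sub>v val x" if "supp x \<subseteq> carrier M \<times> UNIV" for x
    using that
  proof (induction x rule: frag_induction)
    case (one q)
    then show ?case using f_val by (cases q) simp
  next
    case (diff x y)
    then show ?case
      by (auto simp: frag_extend_diff tensor_value_diff algebra_simps intro!: eq_vecI)
  qed (auto simp: tensor_value_zero)
  have "p \<odot>\<^bsub>M_tensor\<^esub> cls v = tensor_induced R M' k f (cls v)"
    by (simp add: M_tensor_def base_change_def Let_def f_def)
  also have "\<dots> = cls (p \<cdot>\<^sub>v v)"
  proof (rule tensor_induced_eq[OF v])
    show "supp (frag_extend f x) \<subseteq> carrier M \<times> UNIV" if "supp x \<subseteq> carrier M \<times> UNIV" for x
      using frag_extend_supp[OF that f_supp] .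
    show "val (frag_extend f x) = p \<cdot>\<^sub>v v" if "supp x \<subseteq> carrier M \<times> UNIV" "val x = v" for x
      using val_f[OF that(1)] that(2) by simp
  qed (use v lift_in_cls[OF v] in \<open>auto simp: M_k_simps\<close>)
  finally show ?thesis .
qed

text \<open>The generators \<open>m \<otimes> a\<close> of a graded piece have homogeneous values. Conversely, the lift of a homogeneous
  vector involves only elements \<open>P (x\<^sup>i y\<^sup>j e\<^sub>l)\<close> of the same degree in \<open>x, y\<close>.\<close>

lemma M_tensor_deg_part: "deg_part M_tensor d = cls ` deg_part M_k d"
proof -
  define X where "X = {tensor_elem R M' k m a | m a. \<exists>l. m \<in> deg_part M (d, l)}"
  have deg_sub: "deg_part M g \<subseteq> carrier M" for g
    by (auto simp: M intro: subsetD[OF S_w_deg_subset[OF c_pos]])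
  have deg_k_sub: "deg_part M_k d \<subseteq> carrier M_k" by (auto simp: M_k_simps)
  have elem: "tensor_elem R M' k m a = cls (val (frag_of (m, a)))" if "m \<in> carrier M" for m a
    using that by (simp add: tensor_elem_def coset_eq)
  have X: "X = {cls (val (frag_of (m, a))) | m a. \<exists>l. m \<in> deg_part M (d, l)}"
    unfolding X_def using elem deg_sub by blast
  have X_sub: "X \<subseteq> cls ` deg_part M_k d"
  proof
    fix C assume "C \<in> X"
    then obtain m a l where m: "m \<in> deg_part M (d, l)" "C = cls (val (frag_of (m, a)))" unfolding X by blast
    have "val (frag_of (m, a)) $ i \<in> B_deg (d - fst g0)" if "i < n" for i
    proof -
      have "m $ i \<in> homog (R_w_deg c (l - snd g0)) (d - fst g0)"
        using m that by (simp add: M S_w_deg_eq[OF c_pos])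
      then have "supp (xy_const a * \<phi>B (m $ i)) \<subseteq> supp (m $ i)" "\<forall>(i', j)\<in>supp (m $ i). int (i' + j) = d - fst g0"
        by (auto simp: homog_def in_keys_iff coef_xy_const_mult \<phi>.coef_map_hom \<phi>.hom_zero)
      then show ?thesis using that by (auto simp: B_deg_def tensor_value_of)
    qed
    moreover have "val (frag_of (m, a)) \<in> carrier M_k" using m deg_sub by (intro val_in_M_k) auto
    ultimately show "C \<in> cls ` deg_part M_k d" using m by (auto simp: M_k_simps)
  qed
  have zero: "0\<^sub>v n \<in> deg_part M_k d"
    by (simp add: M_k_simps B_deg_def P_k_mult_zero)
  have add: "u + v \<in> deg_part M_k d" if "u \<in> deg_part M_k d" "v \<in> deg_part M_k d" for u v
    using that P_k_carrier by (auto simp: M_k_simps B_deg_eq mult_add_distrib_mat_vec[of _ n n] intro!: homog_add)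
  have uminus: "- v \<in> deg_part M_k d" if "v \<in> deg_part M_k d" for v
    using that M_k_uminus[of v] by (fastforce simp: M_k_simps B_deg_def)
  have "generate T X = cls ` deg_part M_k d"
  proof (intro equalityI subsetI)
    fix C assume "C \<in> generate T X"
    then show "C \<in> cls ` deg_part M_k d"
    proof (induction C rule: generate.induct)
      case one
      show ?case using zero by (auto simp: T_one)
    next
      case (incl C)
      then show ?case using X_sub by blast
    next
      case (inv C)
      then obtain v where v: "v \<in> deg_part M_k d" "C = cls v" using X_sub by blast
      then show ?case using uminus[OF v(1)] T_inv[of v] deg_k_sub by auto
    next
      case (eng C D)
      then obtain u v where uv: "u \<in> deg_part M_k d" "C = cls u" "v \<in> deg_part M_k d" "D = cls v" by blast
      then show ?case using add[OF uv(1,3)] T_mult[of u v] deg_k_sub by auto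
    qed
  next
    fix C assume "C \<in> cls ` deg_part M_k d"
    then obtain v where v: "v \<in> deg_part M_k d" "C = cls v" by blast
    have deg_basis: "\<exists>l'. basis (l, i, j) \<in> deg_part M (d, l')" if l: "l < n" and ij: "(i, j) \<in> exponents v" for l i j
    proof -
      obtain l' where "l' < n" "(i, j) \<in> supp (v $ l')" using ij by (auto simp: exponents_def)
      then have "int (i + j) = d - fst g0" using v(1) by (auto simp: M_k_simps B_deg_def)
      then show ?thesis using basis_in_deg_part[OF l, of i j] by auto
    qed
    have partial: "supp (\<Sum>(l, e)\<in>J. frag_of (basis (l, e), coef (v $ l) e)) \<subseteq> carrier M \<times> UNIV \<and>
        cls (val (\<Sum>(l, e)\<in>J. frag_of (basis (l, e), coef (v $ l) e))) \<in> generate T X"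
      if "finite J" "J \<subseteq> {..<n} \<times> exponents v" for J
      using that
    proof (induction J rule: finite_induct)
      case empty
      show ?case using generate.one[of T X] by (simp add: tensor_value_zero T_one)
    next
      case (insert j J)
      obtain l e where j: "j = (l, e)" "l < n" "e \<in> exponents v" using insert.prems by auto
      let ?x = "frag_of (basis (l, e), coef (v $ l) e)" and ?y = "\<Sum>(l, e)\<in>J. frag_of (basis (l, e), coef (v $ l) e)"
      have y: "supp ?y \<subseteq> carrier M \<times> UNIV" "cls (val ?y) \<in> generate T X" using insert by auto
      have x: "supp ?x \<subseteq> carrier M \<times> UNIV" using basis_in_M[OF j(2)] by simp
      have "cls (val ?x) \<in> X" unfolding X using deg_basis[OF j(2), of "fst e" "snd e"] j(3) by fastforce
      then have "cls (val ?x) \<otimes>\<^bsub>T\<^esub> cls (val ?y) \<in> generate T X"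
        by (intro generate.eng generate.incl y)
      then have "cls (val (?x + ?y)) \<in> generate T X"
        using T_mult[OF val_in_M_k[OF x] val_in_M_k[OF y(1)]] by (simp add: tensor_value_add)
      moreover have "supp (?x + ?y) \<subseteq> carrier M \<times> UNIV" using x y keys_add[of ?x ?y] by blast
      moreover have "(\<Sum>(l, e)\<in>insert j J. frag_of (basis (l, e), coef (v $ l) e)) = ?x + ?y"
        using insert.hyps by (simp add: j)
      ultimately show ?case by simp
    qed
    have "cls (val (lift (exponents v) v)) \<in> generate T X"
      unfolding lift_def using partial[of "{..<n} \<times> exponents v"] by (auto simp: exponents_def)
    moreover have "val (lift (exponents v) v) = v" using lift_in_cls[of v] v deg_k_sub by (auto simp: tensor_class_def)
    ultimately show "C \<in> generate T X" using v by simp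
  qed
  then show ?thesis by (simp add: M_tensor_def base_change_def Let_def X_def)
qed

lemma graded_iso_cls: "graded_iso (ring_on UNIV) M_k M_tensor cls"
proof -
  have add: "u + v \<in> carrier M_k" if "u \<in> carrier M_k" "v \<in> carrier M_k" for u v
    using that P_k_carrier by (auto simp: M_k_simps mult_add_distrib_mat_vec[of _ n n])
  show ?thesis
    unfolding graded_iso_def graded_hom_def
    using inj_on_cls by (auto simp: bij_betw_def M_tensor_simps M_tensor_smult M_tensor_deg_part M_k_simps(3,4))
qed

end

text \<open>Base change of a homomorphism given by a matrix \<open>D\<close> is given by \<open>\<phi>(D)\<close>.\<close>

locale fixed_point_map = A: fixed_point_module c \<phi> n P g0 M + B: fixed_point_module c \<phi> n' P' g0' M'
  for c \<phi> n P g0 M n' P' g0' M' +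
  fixes D :: "zfrac bipoly mat"
  assumes D: "D \<in> carrier_mat n' n" "\<And>i j. i < n' \<Longrightarrow> j < n \<Longrightarrow> D $$ (i, j) \<in> S_w c"
    and D_image: "\<And>m. m \<in> carrier M \<Longrightarrow> D *\<^sub>v m \<in> carrier M'"
begin

definition D_k :: "'a bipoly mat" where "D_k = map_mat A.\<phi>B D"

lemma D_k_carrier: "D_k \<in> carrier_mat n' n"
  using D(1) by (simp add: D_k_def)

lemma base_change_map_cls:
  assumes v: "v \<in> carrier A.M_k"
  shows "base_change_map c \<phi> M' (\<lambda>m. D *\<^sub>v m) (A.cls v) = B.cls (D_k *\<^sub>v v)"
proof -
  define f where "f = (\<lambda>(m :: zfrac bipoly vec, a :: 'a). frag_of (D *\<^sub>v m, a))"
  have f_supp: "supp (f q) \<subseteq> carrier M' \<times> UNIV" if "q \<in> carrier M \<times> UNIV" for q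
    using that D_image by (auto simp: f_def)
  have f_val: "B.val (f (m, a)) = D_k *\<^sub>v A.val (frag_of (m, a))" if m: "m \<in> carrier M" for m a
  proof (rule eq_vecI)
    fix i assume "i < dim_vec (D_k *\<^sub>v A.val (frag_of (m, a)))"
    then have i: "i < n'" using D_k_carrier by simp
    have mD: "A.\<phi>B (D $$ (i, j) * m $ j) = A.\<phi>B (D $$ (i, j)) * A.\<phi>B (m $ j)" "D $$ (i, j) * m $ j \<in> coeffs_in (R_w c)" if "j < n" for j
      using m D(2)[OF i that] that
      by (auto simp: A.M_carrier S_w_eq[OF A.c_pos] intro!: A.\<phi>B.hom_mult ring_closed_mult[OF A.\<phi>B.closed])
    have "(D *\<^sub>v m) $ i = (\<Sum>j<n. D $$ (i, j) * m $ j)"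
      using D(1) i m by (auto simp: scalar_prod_def lessThan_atLeast0 A.M_carrier intro!: sum.cong)
    then have "A.\<phi>B ((D *\<^sub>v m) $ i) = (\<Sum>j<n. A.\<phi>B (D $$ (i, j)) * A.\<phi>B (m $ j))"
      using mD A.\<phi>B.hom_sum[of "{..<n}" "\<lambda>j. D $$ (i, j) * m $ j"]
      by (simp del: index_mult_mat_vec)
    then have "B.val (f (m, a)) $ i = xy_const a * (\<Sum>j<n. A.\<phi>B (D $$ (i, j)) * A.\<phi>B (m $ j))"
      using i by (simp add: f_def tensor_value_of del: index_mult_mat_vec)
    also have "\<dots> = (\<Sum>j<n. D_k $$ (i, j) * A.val (frag_of (m, a)) $ j)"
      using i D(1) by (auto simp: D_k_def tensor_value_of sum_distrib_left mult_ac intro!: sum.cong)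
    also have "\<dots> = (D_k *\<^sub>v A.val (frag_of (m, a))) $ i"
      using D_k_carrier i by (auto simp: scalar_prod_def lessThan_atLeast0 intro!: sum.cong)
    finally show "B.val (f (m, a)) $ i = (D_k *\<^sub>v A.val (frag_of (m, a))) $ i" .
  qed (use D_k_carrier in simp)
  have val_f: "B.val (frag_extend f x) = D_k *\<^sub>v A.val x" if "supp x \<subseteq> carrier M \<times> UNIV" for x
    using that
  proof (induction x rule: frag_induction)
    case zero
    show ?case using D_k_carrier
      by (intro eq_vecI) (auto simp: tensor_value_zero scalar_prod_def)
  next
    case (one q)
    then show ?case using f_val by (cases q) simp
  next
    case (diff x y)
    then show ?case
      using D_k_carrier by (simp add: frag_extend_diff tensor_value_diff mult_minus_distrib_mat_vec[of _ n' n])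
  qed
  have "base_change_map c \<phi> M' (\<lambda>m. D *\<^sub>v m) (A.cls v) = tensor_induced B.R B.M' B.k f (A.cls v)"
    by (simp add: base_change_map_def f_def)
  also have "\<dots> = B.cls (D_k *\<^sub>v v)"
  proof (rule B.tensor_induced_eq)
    show "supp (frag_extend f x) \<subseteq> carrier M' \<times> UNIV" if "supp x \<subseteq> carrier M \<times> UNIV" for x
      using frag_extend_supp[OF that f_supp] .
    show "B.val (frag_extend f x) = D_k *\<^sub>v v" if "supp x \<subseteq> carrier M \<times> UNIV" "A.val x = v" for x
      using val_f[OF that(1)] that(2) by simp
    show "A.cls v \<noteq> {}" using A.lift_in_cls[OF v] by blast
    show "D_k *\<^sub>v v \<in> carrier_vec n'" using D_k_carrier v by (auto simp: A.M_k_simps)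
    show "0\<^sub>v n' \<in> carrier B.M_k" by (simp add: B.M_k_simps B.P_k_mult_zero)
  qed
  finally show ?thesis .
qed

end

section \<open>Transport along graded isomorphisms\<close>

lemma module_transport:
  assumes A: "module R A" and f: "bij_betw f (carrier A) (carrier B)"
    and zero: "f \<zero>\<^bsub>A\<^esub> = \<zero>\<^bsub>B\<^esub>"
    and add: "\<And>u v. u \<in> carrier A \<Longrightarrow> v \<in> carrier A \<Longrightarrow> f (u \<oplus>\<^bsub>A\<^esub> v) = f u \<oplus>\<^bsub>B\<^esub> f v"
    and smult: "\<And>r v. r \<in> carrier R \<Longrightarrow> v \<in> carrier A \<Longrightarrow> f (r \<odot>\<^bsub>A\<^esub> v) = r \<odot>\<^bsub>B\<^esub> f v"
  shows "module R B"
proof -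
  interpret A: module R A by (rule A)
  have B: "carrier B = f ` carrier A" using f by (simp add: bij_betw_def)
  show ?thesis
  proof (rule moduleI)
    show "cring R" by (rule A.R.cring_axioms)
    show "abelian_group B"
    proof (rule abelian_groupI)
      show "\<exists>y\<in>carrier B. y \<oplus>\<^bsub>B\<^esub> x = \<zero>\<^bsub>B\<^esub>" if x: "x \<in> carrier B" for x
      proof -
        obtain v where v: "v \<in> carrier A" "x = f v" using x B by blast
        then have "f (\<ominus>\<^bsub>A\<^esub> v) \<oplus>\<^bsub>B\<^esub> x = \<zero>\<^bsub>B\<^esub>"
          using add[of "\<ominus>\<^bsub>A\<^esub> v" v] zero by (simp add: A.M.l_neg)
        then show ?thesis using v B by blast
      qed
    qed (auto simp: B add[symmetric] zero[symmetric] A.M.a_assoc, simp add: A.M.a_comm)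
  qed (auto simp: B add[symmetric] smult[symmetric] A.smult_l_distr A.smult_r_distr A.smult_assoc1)
qed

lemma graded_iso_compose:
  assumes f: "graded_iso R A B f" and g: "graded_iso R B C g"
  shows "graded_iso R A C (g \<circ> f)"
proof -
  have "\<And>d. f ` deg_part A d = deg_part B d" "\<And>d. g ` deg_part B d = deg_part C d"
    using f g by (auto simp: graded_iso_def)
  then have deg: "(g \<circ> f) ` deg_part A d = deg_part C d" for d by (simp only: image_comp[symmetric])
  have bij: "bij_betw (g \<circ> f) (carrier A) (carrier C)"
    by (rule bij_betw_trans[of f _ "carrier B"]) (use f g in \<open>simp_all add: graded_iso_def\<close>)
  have mem: "f v \<in> carrier B" if "v \<in> carrier A" for v
    using f that by (auto simp: graded_iso_def graded_hom_def)
  have "g \<circ> f \<in> graded_hom R A C"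
    unfolding graded_hom_def
  proof (intro CollectI conjI ballI allI)
    show "g \<circ> f \<in> carrier A \<rightarrow> carrier C" using bij by (auto simp: bij_betw_def)
    show "(g \<circ> f) ` deg_part A d \<subseteq> deg_part C d" for d using deg by simp
  qed (use f g mem in \<open>simp_all add: graded_iso_def graded_hom_def\<close>)
  then show ?thesis using bij deg by (simp add: graded_iso_def)
qed

lemma graded_iso_ideal_times:
  assumes A: "module R A" and B: "module R B" and f: "graded_iso R A B f" and J: "J \<subseteq> carrier R"
  shows "f ` ideal_times J A \<subseteq> ideal_times J B"
proof -
  interpret A: module R A by (rule A)
  interpret B: module R B by (rule B)
  have hom: "\<And>v. v \<in> carrier A \<Longrightarrow> f v \<in> carrier B"
      "\<And>u v. u \<in> carrier A \<Longrightarrow> v \<in> carrier A \<Longrightarrow> f (u \<oplus>\<^bsub>A\<^esub> v) = f u \<oplus>\<^bsub>B\<^esub> f v"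
      "\<And>r v. r \<in> carrier R \<Longrightarrow> v \<in> carrier A \<Longrightarrow> f (r \<odot>\<^bsub>A\<^esub> v) = r \<odot>\<^bsub>B\<^esub> f v"
    using f by (auto simp: graded_iso_def graded_hom_def)
  interpret f: group_hom "add_monoid A" "add_monoid B" f
    by (rule group_hom.intro[OF A.M.a_group B.M.a_group])
      (use hom in \<open>auto simp: group_hom_axioms_def hom_def\<close>)
  define X where "X = {r \<odot>\<^bsub>A\<^esub> v | r v. r \<in> J \<and> v \<in> carrier A}"
  have "X \<subseteq> carrier A" using J by (auto simp: X_def)
  then have "f ` ideal_times J A = generate (add_monoid B) (f ` X)"
    using f.generate_img[of X] by (simp add: ideal_times_def X_def)
  also have "\<dots> \<subseteq> ideal_times J B"
    unfolding ideal_times_def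
  proof (intro B.M.add.mono_generate subsetI)
    fix y assume "y \<in> f ` X"
    then obtain r v where "r \<in> J" "v \<in> carrier A" "y = f (r \<odot>\<^bsub>A\<^esub> v)" by (auto simp: X_def)
    then have "y = r \<odot>\<^bsub>B\<^esub> f v" "r \<in> J" "f v \<in> carrier B" using J hom(1,3) by blast+
    then show "y \<in> {r \<odot>\<^bsub>B\<^esub> v | r v. r \<in> J \<and> v \<in> carrier B}" by blast
  qed
  finally show ?thesis .
qed

text \<open>The augmentation of the new complex is the old one composed with the inverse of the isomorphism in
  degree \<open>0\<close>.\<close>

lemma minimal_resolution_transport:
  fixes F2 :: "('k::field bipoly, 'm2, int) graded_module" and F1 :: "('k bipoly, 'm1, int) graded_module"
    and F0 :: "('k bipoly, 'm0, int) graded_module"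
  assumes res: "minimal_resolution F2 d2 F1 d1 F0 Q"
    and iso: "graded_iso (ring_on UNIV) F2 N2 \<iota>2" "graded_iso (ring_on UNIV) F1 N1 \<iota>1" "graded_iso (ring_on UNIV) F0 N0 \<iota>0"
    and mods: "module (ring_on UNIV) N2" "module (ring_on UNIV) N1" "module (ring_on UNIV) N0"
    and zero: "\<iota>0 \<zero>\<^bsub>F0\<^esub> = \<zero>\<^bsub>N0\<^esub>"
    and deg: "\<And>g. deg_part F2 g \<subseteq> carrier F2" "\<And>g. deg_part F1 g \<subseteq> carrier F1" "\<And>g. deg_part F0 g \<subseteq> carrier F0"
    and e2: "\<And>v. v \<in> carrier F2 \<Longrightarrow> e2 (\<iota>2 v) = \<iota>1 (d2 v)"
    and e1: "\<And>v. v \<in> carrier F1 \<Longrightarrow> e1 (\<iota>1 v) = \<iota>0 (d1 v)"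
  shows "minimal_resolution N2 e2 N1 e1 N0 Q"
proof -
  have free: "graded_free UNIV B_deg F2" "graded_free UNIV B_deg F1" "graded_free UNIV B_deg F0"
    and acyc: "acyclic_complex (ring_on UNIV) F2 d2 F1 d1 F0"
    and min: "d2 ` carrier F2 \<subseteq> ideal_times B_irrel F1" "d1 ` carrier F1 \<subseteq> ideal_times B_irrel F0"
    using res by (auto simp: minimal_resolution_def)
  obtain \<epsilon> where eps: "\<epsilon> \<in> graded_hom (ring_on UNIV) F0 Q" "\<epsilon> ` carrier F0 = carrier Q"
      "d1 ` carrier F1 = {v \<in> carrier F0. \<epsilon> v = \<zero>\<^bsub>Q\<^esub>}"
    using res by (auto simp: minimal_resolution_def)
  have F_mods: "module (ring_on UNIV) F1" "module (ring_on UNIV) F0" "module (ring_on UNIV) F2"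
    using free by (simp_all add: graded_free_def)
  have d: "d2 \<in> graded_hom (ring_on UNIV) F2 F1" "d1 \<in> graded_hom (ring_on UNIV) F1 F0" "inj_on d2 (carrier F2)"
      "d2 ` carrier F2 = {v \<in> carrier F1. d1 v = \<zero>\<^bsub>F0\<^esub>}"
    using acyc by (auto simp: acyclic_complex_def)
  have im: "carrier N2 = \<iota>2 ` carrier F2" "carrier N1 = \<iota>1 ` carrier F1" "carrier N0 = \<iota>0 ` carrier F0"
    "inj_on \<iota>2 (carrier F2)" "inj_on \<iota>1 (carrier F1)" "inj_on \<iota>0 (carrier F0)"
    using iso by (auto simp: graded_iso_def bij_betw_def)
  have d_in: "\<And>v. v \<in> carrier F2 \<Longrightarrow> d2 v \<in> carrier F1" "\<And>v. v \<in> carrier F1 \<Longrightarrow> d1 v \<in> carrier F0"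
    using graded_hom_image(1)[OF d(1)] graded_hom_image(1)[OF d(2)] by blast+
  have free_N: "graded_free UNIV B_deg N" if "graded_free UNIV B_deg F" "graded_iso (ring_on UNIV) F N \<iota>" "module (ring_on UNIV) N"
    for F :: "('k bipoly, 'x, int) graded_module" and N :: "('k bipoly, 'y, int) graded_module" and \<iota>
    using that graded_iso_compose unfolding graded_free_def by blast
  have transfer_hom: "e \<in> graded_hom (ring_on UNIV) N N'"
    if f: "f \<in> graded_hom (ring_on UNIV) F F'" and i: "graded_iso (ring_on UNIV) F N \<iota>" and i': "graded_iso (ring_on UNIV) F' N' \<iota>'"
      and e: "\<And>v. v \<in> carrier F \<Longrightarrow> e (\<iota> v) = \<iota>' (f v)" and mF: "module (ring_on UNIV) F" and dF: "\<And>g. deg_part F g \<subseteq> carrier F"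
    for F :: "('k bipoly, 'x, int) graded_module" and N :: "('k bipoly, 'y, int) graded_module" and \<iota>
      and F' :: "('k bipoly, 'x', int) graded_module" and N' :: "('k bipoly, 'y', int) graded_module" and \<iota>' f e
  proof -
    interpret F: module "ring_on UNIV" F by (rule mF)
    have N: "carrier N = \<iota> ` carrier F" "\<And>g. deg_part N g = \<iota> ` deg_part F g" using i by (auto simp: graded_iso_def bij_betw_def)
    have hi: "\<iota> \<in> graded_hom (ring_on UNIV) F N" "\<iota>' \<in> graded_hom (ring_on UNIV) F' N'" using i i' by (auto simp: graded_iso_def)
    have lin: "\<And>u v. u \<in> carrier F \<Longrightarrow> v \<in> carrier F \<Longrightarrow> \<iota> u \<oplus>\<^bsub>N\<^esub> \<iota> v = \<iota> (u \<oplus>\<^bsub>F\<^esub> v)"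
        "\<And>r v. v \<in> carrier F \<Longrightarrow> r \<odot>\<^bsub>N\<^esub> \<iota> v = \<iota> (r \<odot>\<^bsub>F\<^esub> v)"
        "\<And>u v. u \<in> carrier F' \<Longrightarrow> v \<in> carrier F' \<Longrightarrow> \<iota>' u \<oplus>\<^bsub>N'\<^esub> \<iota>' v = \<iota>' (u \<oplus>\<^bsub>F'\<^esub> v)"
        "\<And>r v. v \<in> carrier F' \<Longrightarrow> r \<odot>\<^bsub>N'\<^esub> \<iota>' v = \<iota>' (r \<odot>\<^bsub>F'\<^esub> v)"
        "\<And>u v. u \<in> carrier F \<Longrightarrow> v \<in> carrier F \<Longrightarrow> f (u \<oplus>\<^bsub>F\<^esub> v) = f u \<oplus>\<^bsub>F'\<^esub> f v"
        "\<And>r v. v \<in> carrier F \<Longrightarrow> f (r \<odot>\<^bsub>F\<^esub> v) = r \<odot>\<^bsub>F'\<^esub> f v"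
      using hi f by (auto simp: graded_hom_def)
    have mem: "\<And>v. v \<in> carrier F \<Longrightarrow> f v \<in> carrier F'" "\<And>v. v \<in> carrier F' \<Longrightarrow> \<iota>' v \<in> carrier N'"
        "\<And>v g. v \<in> deg_part F g \<Longrightarrow> f v \<in> deg_part F' g" "\<And>v g. v \<in> deg_part F' g \<Longrightarrow> \<iota>' v \<in> deg_part N' g"
      using graded_hom_image[OF f] graded_hom_image[OF hi(2)] by blast+
    have smult: "r \<odot>\<^bsub>F\<^esub> v \<in> carrier F" if "v \<in> carrier F" for r v using that F.smult_closed[of r v] by simp
    show ?thesis
      unfolding graded_hom_def
    proof (intro CollectI conjI ballI allI funcsetI subsetI)
      show "e x \<in> carrier N'" if "x \<in> carrier N" for x using that e mem N by auto
      show "e (x \<oplus>\<^bsub>N\<^esub> y) = e x \<oplus>\<^bsub>N'\<^esub> e y" if "x \<in> carrier N" "y \<in> carrier N" for x y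
        using that e mem lin by (auto simp: N(1))
      show "e (r \<odot>\<^bsub>N\<^esub> x) = r \<odot>\<^bsub>N'\<^esub> e x" if "x \<in> carrier N" for r x
        using that e mem lin smult by (auto simp: N(1))
      show "y \<in> deg_part N' g" if y: "y \<in> e ` deg_part N g" for y g
      proof -
        obtain v where v: "v \<in> deg_part F g" "y = e (\<iota> v)" using y unfolding N(2) by blast
        then have "y = \<iota>' (f v)" using e dF by blast
        then show ?thesis using mem(3,4) v(1) by simp
      qed
    qed
  qed
  have e2_hom: "e2 \<in> graded_hom (ring_on UNIV) N2 N1"
    by (rule transfer_hom[OF d(1) iso(1,2) e2 F_mods(3) deg(1)])
  have e1_hom: "e1 \<in> graded_hom (ring_on UNIV) N1 N0"
    by (rule transfer_hom[OF d(2) iso(2,3) e1 F_mods(1) deg(2)])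
  have e2_inj: "inj_on e2 (carrier N2)"
  proof (rule inj_onI)
    fix x y assume "x \<in> carrier N2" "y \<in> carrier N2" "e2 x = e2 y"
    then obtain u v where uv: "u \<in> carrier F2" "v \<in> carrier F2" "x = \<iota>2 u" "y = \<iota>2 v" "\<iota>1 (d2 u) = \<iota>1 (d2 v)"
      using im(1) e2 by force
    then have "u = v" using im(5) d(3) d_in(1) by (meson inj_onD)
    then show "x = y" using uv by simp
  qed
  have e2_img: "e2 ` carrier N2 = \<iota>1 ` d2 ` carrier F2" and e1_img: "e1 ` carrier N1 = \<iota>0 ` d1 ` carrier F1"
    using e2 e1 im by (force simp: image_image)+
  have F0_zero: "\<zero>\<^bsub>F0\<^esub> \<in> carrier F0"
  proof -
    interpret F0: module "ring_on UNIV" F0 by (rule F_mods(2))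
    show ?thesis by simp
  qed
  have e2_ker: "e2 ` carrier N2 = {x \<in> carrier N1. e1 x = \<zero>\<^bsub>N0\<^esub>}"
    unfolding e2_img d(4)
  proof (intro equalityI subsetI)
    fix x assume "x \<in> \<iota>1 ` {v \<in> carrier F1. d1 v = \<zero>\<^bsub>F0\<^esub>}"
    then show "x \<in> {x \<in> carrier N1. e1 x = \<zero>\<^bsub>N0\<^esub>}" using im(2) e1 zero by auto
  next
    fix x assume "x \<in> {x \<in> carrier N1. e1 x = \<zero>\<^bsub>N0\<^esub>}"
    then obtain v where v: "v \<in> carrier F1" "x = \<iota>1 v" "\<iota>0 (d1 v) = \<iota>0 \<zero>\<^bsub>F0\<^esub>" using im(2) e1 zero by auto
    then have "d1 v = \<zero>\<^bsub>F0\<^esub>" using im(6) d_in(2) F0_zero by (meson inj_onD)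
    then show "x \<in> \<iota>1 ` {v \<in> carrier F1. d1 v = \<zero>\<^bsub>F0\<^esub>}" using v by blast
  qed
  define \<epsilon>' where "\<epsilon>' = \<epsilon> \<circ> inv_into (carrier F0) \<iota>0"
  have eps': "\<epsilon>' (\<iota>0 v) = \<epsilon> v" if "v \<in> carrier F0" for v
    using that im(6) by (simp add: \<epsilon>'_def inv_into_f_f)
  have id_iso: "graded_iso (ring_on UNIV) Q Q id" by (auto simp: graded_iso_def graded_hom_def)
  have eps'_hom: "\<epsilon>' \<in> graded_hom (ring_on UNIV) N0 Q"
    by (rule transfer_hom[OF eps(1) iso(3) id_iso _ F_mods(2) deg(3)]) (simp add: eps')
  have eps'_img: "\<epsilon>' ` carrier N0 = carrier Q"
    unfolding im(3) eps(2)[symmetric] using eps' by (force simp: image_image)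
  have eps'_ker: "e1 ` carrier N1 = {x \<in> carrier N0. \<epsilon>' x = \<zero>\<^bsub>Q\<^esub>}"
    unfolding e1_img eps(3) im(3) using eps' by auto
  have irrel: "B_irrel \<subseteq> carrier (ring_on UNIV)" by simp
  have "e2 ` carrier N2 \<subseteq> ideal_times B_irrel N1"
    unfolding e2_img using min(1) graded_iso_ideal_times[OF F_mods(1) mods(2) iso(2) irrel] by blast
  moreover have "e1 ` carrier N1 \<subseteq> ideal_times B_irrel N0"
    unfolding e1_img using min(2) graded_iso_ideal_times[OF F_mods(2) mods(3) iso(3) irrel] by blast
  ultimately show ?thesis
    unfolding minimal_resolution_def acyclic_complex_def
    using free_N[OF free(1) iso(1) mods(1)] free_N[OF free(2) iso(2) mods(2)] free_N[OF free(3) iso(3) mods(3)]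
      e2_hom e1_hom e2_inj e2_ker eps'_hom eps'_img eps'_ker by blast
qed

context fixed_point_module
begin

lemma module_M_tensor: "module (ring_on UNIV) M_tensor"
proof (rule module_transport[OF module_vec_module_on[OF ring_closed_UNIV vec_module_on_M_k]])
  show "bij_betw cls (carrier M_k) (carrier M_tensor)" using graded_iso_cls by (simp add: graded_iso_def)
qed (use graded_iso_cls in \<open>auto simp: graded_iso_def graded_hom_def M_tensor_simps M_k_simps\<close>)

lemma deg_part_M_k_subset: "deg_part M_k d \<subseteq> carrier M_k"
  by (auto simp: M_k_simps)

end

section \<open>Specializations with minimal resolutions\<close>

context
  fixes h :: "zpoly \<Rightarrow> 'k::field" and c :: nat
  assumes h: "comm_ring_hom h" and w: "h (w_Z c) \<noteq> 0"
begin

interpretation comm_ring_hom h by (rule h)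

text \<open>The value is well-defined on all fractions that have a representation with denominator outside the
  kernel of \<open>h\<close>; these include the localization at \<open>w\<close>.\<close>

definition fraction_value :: "zfrac \<Rightarrow> 'k" where
  "fraction_value q = (THE y. \<exists>a b. h b \<noteq> 0 \<and> q = Fract a b \<and> y = h a / h b)"

lemma fraction_value_Fract:
  assumes "h b \<noteq> 0"
  shows "fraction_value (Fract a b) = h a / h b"
  unfolding fraction_value_def
proof (rule the_equality)
  show "\<exists>a' b'. h b' \<noteq> 0 \<and> Fract a b = Fract a' b' \<and> h a / h b = h a' / h b'" using assms by blast
  fix y assume "\<exists>a' b'. h b' \<noteq> 0 \<and> Fract a b = Fract a' b' \<and> y = h a' / h b'"
  then obtain a' b' where ab: "h b' \<noteq> 0" "Fract a b = Fract a' b'" "y = h a' / h b'" by blast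
  have "b \<noteq> 0" "b' \<noteq> 0" using assms ab(1) by auto
  then have "h (a * b') = h (a' * b)" using ab(2) by (simp add: eq_fract)
  then show "y = h a / h b" using ab assms by (simp add: hom_mult frac_eq_eq)
qed

lemma h_w_power: "h (w_Z c ^ n) \<noteq> 0"
  using w by (simp add: hom_power)

lemma fraction_value_to_fract: "fraction_value (to_fract a) = h a"
  using fraction_value_Fract[of 1 a] by (simp add: to_fract_def)

lemma fraction_value_ring_hom: "fraction_value \<in> Ring.ring_hom (ring_on (R_w c)) (ring_on UNIV)"
proof (rule ring_hom_memI)
  show "fraction_value \<one>\<^bsub>ring_on (R_w c)\<^esub> = \<one>\<^bsub>ring_on UNIV\<^esub>"
    using fraction_value_to_fract[of 1] by simp
  fix p q assume "p \<in> carrier (ring_on (R_w c))" "q \<in> carrier (ring_on (R_w c))"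
  then obtain a m b n where ab: "p = Fract a (w_Z c ^ m)" "q = Fract b (w_Z c ^ n)"
    by (auto simp: R_w_def)
  have "w_Z c \<noteq> 0" using w by auto
  then have nz: "w_Z c ^ j \<noteq> 0" for j by simp
  have "h (w_Z c ^ m * w_Z c ^ n) \<noteq> 0" using h_w_power by (simp add: hom_mult)
  then show "fraction_value (p \<otimes>\<^bsub>ring_on (R_w c)\<^esub> q) = fraction_value p \<otimes>\<^bsub>ring_on UNIV\<^esub> fraction_value q"
    and "fraction_value (p \<oplus>\<^bsub>ring_on (R_w c)\<^esub> q) = fraction_value p \<oplus>\<^bsub>ring_on UNIV\<^esub> fraction_value q"
    using ab h_w_power[of m] h_w_power[of n] nz by (simp_all add: fraction_value_Fract hom_mult hom_add field_simps)
qed simp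

end

lemma sum_three:
  fixes f :: "nat \<Rightarrow> 'b::comm_monoid_add"
  assumes "{i, j, k} = {..<3}"
  shows "(\<Sum>l<3. f l) = f i + (f j + f k)"
proof -
  have "card {i, j, k} = 3" using assms by simp
  then have "i \<noteq> j" "i \<noteq> k" "j \<noteq> k" by (auto simp: card_insert_if split: if_splits)
  then show ?thesis unfolding assms[symmetric] by simp
qed

lemma vec_eq_combination_unit_vecs:
  fixes v :: "'b::comm_ring_1 vec"
  assumes "v \<in> carrier_vec 3"
  shows "v = v $ 0 \<cdot>\<^sub>v unit_vec 3 0 + (v $ 1 \<cdot>\<^sub>v unit_vec 3 1 + v $ 2 \<cdot>\<^sub>v unit_vec 3 2)"
proof (rule eq_vecI)
  fix i assume "i < dim_vec (v $ 0 \<cdot>\<^sub>v unit_vec 3 0 + (v $ 1 \<cdot>\<^sub>v unit_vec 3 1 + v $ 2 \<cdot>\<^sub>v unit_vec 3 2))"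
  then have "i = 0 \<or> i = 1 \<or> i = 2" by auto
  then show "v $ i = (v $ 0 \<cdot>\<^sub>v unit_vec 3 0 + (v $ 1 \<cdot>\<^sub>v unit_vec 3 1 + v $ 2 \<cdot>\<^sub>v unit_vec 3 2)) $ i" by auto
qed (use assms in simp)

lemma vec_eq_combination_unit_vecs_2:
  fixes v :: "'b::comm_ring_1 vec"
  assumes "v \<in> carrier_vec 2"
  shows "v = v $ 0 \<cdot>\<^sub>v unit_vec 2 0 + v $ 1 \<cdot>\<^sub>v unit_vec 2 1"
proof (rule eq_vecI)
  fix i assume "i < dim_vec (v $ 0 \<cdot>\<^sub>v unit_vec 2 0 + v $ 1 \<cdot>\<^sub>v unit_vec 2 1)"
  then have "i = 0 \<or> i = 1" by auto
  then show "v $ i = (v $ 0 \<cdot>\<^sub>v unit_vec 2 0 + v $ 1 \<cdot>\<^sub>v unit_vec 2 1) $ i" by auto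
qed (use assms in simp)

lemma B_deg_zero: "0 \<in> B_deg n"
  by (simp add: B_deg_def)

lemma B_deg_add: "a \<in> B_deg n \<Longrightarrow> b \<in> B_deg n \<Longrightarrow> a + b \<in> B_deg n"
  unfolding B_deg_eq by (rule homog_add) auto

lemma B_deg_mult: "a \<in> B_deg m \<Longrightarrow> b \<in> B_deg n \<Longrightarrow> a * b \<in> B_deg (m + n)"
  unfolding B_deg_eq by (erule homog_mult) auto

lemma B_deg_xy_const: "xy_const a \<in> B_deg 0"
  by (simp add: B_deg_def xy_const_def xy_monom_def)

lemma B_deg_eq_homogenize:
  assumes "p \<in> B_deg (int n)"
  shows "p = homogenize n (slice n p)"
proof (rule poly_mapping_eqI)
  fix e :: "nat \<times> nat" obtain i j where e: "e = (i, j)" by (cases e)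
  show "coef p e = coef (homogenize n (slice n p)) e"
  proof (cases "i + j = n")
    case False
    then have "(i, j) \<notin> supp p" using assms unfolding B_deg_def by fastforce
    then have "coef p (i, j) = 0" by (simp add: in_keys_iff)
    then show ?thesis using False by (simp add: e coef_homogenize)
  qed (auto simp: e coef_homogenize coeff_slice)
qed

lemma coef_mult_B_deg_zero:
  assumes "q \<in> B_deg (int n)" "i + j < n"
  shows "coef (p * q) (i, j) = 0"
proof (rule ccontr)
  assume "coef (p * q) (i, j) \<noteq> 0"
  then have "(i, j) \<in> supp (p * q)" by (simp add: in_keys_iff)
  then obtain a b where ab: "(i, j) = a + b" "b \<in> supp q" using keys_mult[of p q] by blast
  obtain b1 b2 where b: "b = (b1, b2)" by (cases b)
  have "int (b1 + b2) = int n" using assms(1) ab(2) unfolding b B_deg_def by fastforce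
  moreover have "b1 \<le> i" "b2 \<le> j" using ab(1) by (cases a; simp add: b)+
  ultimately show False using assms(2) by simp
qed

lemma map_mat_xy_const_one: "map_mat xy_const (1\<^sub>m n) = (1\<^sub>m n :: 'b::comm_ring_1 bipoly mat)"
  by (rule eq_matI) (auto simp: xy_const_def xy_monom_def zero_prod_def[symmetric])

context
  fixes h :: "zpoly \<Rightarrow> 'k::field" and c :: nat
  assumes h: "comm_ring_hom h" and w: "h (w_Z c) \<noteq> 0" and c: "c > 0"
begin

interpretation H: comm_ring_hom h by (rule h)
interpretation H: specialization h c by unfold_locales (rule c)
interpretation H: unit_specialization h c UNIV
  by unfold_locales (auto simp: H.w_def w)
interpretation U: unit_specialization "to_fract :: zpoly \<Rightarrow> zfrac" c "R_w c"
  by (rule unit_specialization_to_fract[OF c])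

abbreviation "\<phi>\<^sub>h \<equiv> fraction_value h"

lemma \<phi>_hom: "\<phi>\<^sub>h \<in> Ring.ring_hom (ring_on (R_w c)) (ring_on UNIV)"
  by (rule fraction_value_ring_hom[OF h w])

interpretation \<phi>: hom_on "R_w c" \<phi>\<^sub>h
proof
  show "ring_closed (R_w c)" by (rule ring_closed_R_w[OF c])
qed (use \<phi>_hom in \<open>auto simp: Ring.ring_hom_def\<close>)

lemma \<phi>_to_fract: "\<phi>\<^sub>h (to_fract a) = h a"
  by (rule fraction_value_to_fract[OF h w])

lemma map_\<phi>_to_fract: "Poly_Mapping.map \<phi>\<^sub>h (Poly_Mapping.map to_fract p) = Poly_Mapping.map h p"
  by (rule poly_mapping_eqI) (simp add: \<phi>.coef_map_hom U.total.coef_map_hom H.total.coef_map_hom \<phi>_to_fract)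

lemma map_\<phi>_d1: "map_mat (Poly_Mapping.map \<phi>\<^sub>h) U.d1_mat = H.d1_mat"
  unfolding U.d1_mat_def H.d1_mat_def by (rule eq_matI) (auto simp: map_\<phi>_to_fract)

lemma map_\<phi>_d2: "map_mat (Poly_Mapping.map \<phi>\<^sub>h) U.d2_mat = H.d2_mat"
  unfolding U.d2_mat_def H.d2_mat_def by (rule eq_matI) (auto simp: map_\<phi>_to_fract)

lemma \<phi>_splitting: "\<phi>\<^sub>h (U.splitting l) = H.splitting l"
proof -
  have "U.splitting l = Fract ((if l = 1 then (-1) ^ (c + 1) else 1) * Z_cof c (l + 1)) (w_Z c)"
    by (simp add: U.splitting_def U.w_def Fract_conv_to_fract U.hom_mult U.hom_uminus U.hom_power)
  then show ?thesis
    by (simp add: fraction_value_Fract[OF h w w] H.splitting_def H.w_def H.hom_mult H.hom_uminus H.hom_power)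
qed

lemma \<phi>_d3_entry: "\<phi>\<^sub>h (U.d3_entry l) = H.d3_entry l"
proof -
  have "U.d3_entry l = to_fract ((if l = 1 then (-1) ^ (c + 1) else 1) * zvar 0 (l + 1))"
    by (simp add: U.d3_entry_def U.z0_def U.hom_mult U.hom_uminus U.hom_power)
  then show ?thesis
    by (simp only: \<phi>_to_fract) (simp add: H.d3_entry_def H.z0_def H.hom_mult H.hom_uminus H.hom_power)
qed

lemma fixed_point_module_free:
  "fixed_point_module c \<phi>\<^sub>h n (1\<^sub>m n) g (gr_free (S_w c) (S_w_deg c) (replicate n g))"
proof
  show "(1\<^sub>m n :: zfrac mat) $$ (i, j) \<in> R_w_deg c 0" if "i < n" "j < n" for i j
    using that R_w_deg_zero[OF c] to_fract_homogeneous[OF c R_Z_deg_one[of c]] by simp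
qed (use c \<phi>_hom in \<open>auto simp: map_mat_xy_const_one gr_free_def\<close>)

definition projector_coeffs :: "zfrac mat" where
  "projector_coeffs = mat 3 3 (\<lambda>(l, i). (if l = i then 1 else 0) - U.d3_entry l * U.splitting i)"

lemma map_projector_coeffs: "map_mat xy_const projector_coeffs = U.projector"
  by (rule eq_matI) (auto simp: projector_coeffs_def U.projector_def)

lemma fixed_point_module_UPR2: "fixed_point_module c \<phi>\<^sub>h 3 projector_coeffs (3 * int c, 3 * int c + 2) (UPR2 c)"
proof
  show "projector_coeffs $$ (i, j) \<in> R_w_deg c 0" if "i < 3" "j < 3" for i j
    using projector_entry_deg[OF c that] that by (simp add: projector_coeffs_def)
  show "map_mat xy_const projector_coeffs *\<^sub>v (map_mat xy_const projector_coeffs *\<^sub>v v) = map_mat xy_const projector_coeffs *\<^sub>v v" if "v \<in> carrier_vec 3" for v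
    using that U.sigma_projector[OF that U.w_nonzero] U.sigma_zero_iff_projector_fixed[of "U.projector *\<^sub>v v", OF _ U.w_nonzero]
    unfolding map_projector_coeffs by (simp add: mult_mat_vec_carrier[OF U.projector_carrier])
  have fixed: "U.sigma v = 0 \<longleftrightarrow> map_mat xy_const projector_coeffs *\<^sub>v v = v" if "v \<in> carrier_vec 3" for v
    unfolding map_projector_coeffs by (rule U.sigma_zero_iff_projector_fixed[OF that U.w_nonzero])
  show "carrier (UPR2 c) = {v \<in> carrier_vec 3. (\<forall>i<3. v $ i \<in> S_w c) \<and> map_mat xy_const projector_coeffs *\<^sub>v v = v}"
    using fixed by (auto simp: UPR2_simps(1)[OF c])
  show "deg_part (UPR2 c) g = {v \<in> carrier_vec 3. (\<forall>i<3. v $ i \<in> S_w_deg c (g - (3 * int c, 3 * int c + 2))) \<and>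
      map_mat xy_const projector_coeffs *\<^sub>v v = v}" for g
    using fixed by (auto simp: UPR2_simps(5)[OF c])
  show "\<phi>\<^sub>h \<in> Ring.ring_hom (ring_on (R_w c)) (ring_on UNIV)" by (rule \<phi>_hom)
  show "projector_coeffs \<in> carrier_mat 3 3" by (simp add: projector_coeffs_def)
qed (use c in \<open>simp_all add: UPR2_simps[OF c]\<close>)

interpretation A0: fixed_point_module c \<phi>\<^sub>h 1 "1\<^sub>m 1" "(0, 0)" "UPR0 c"
  using fixed_point_module_free[of 1 "(0, 0)"] by (simp add: UPR0_def)

interpretation A1: fixed_point_module c \<phi>\<^sub>h 3 "1\<^sub>m 3" "(2 * int c, 1)" "UPR1 c"
  using fixed_point_module_free[of 3 "(2 * int c, 1)"] by (simp add: UPR1_def)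

interpretation A2: fixed_point_module c \<phi>\<^sub>h 3 projector_coeffs "(3 * int c, 3 * int c + 2)" "UPR2 c"
  by (rule fixed_point_module_UPR2)

lemma UPR_hom: "UPR_d2 c \<in> graded_hom (ring_on (S_w c)) (UPR2 c) (UPR1 c)"
    "UPR_d1 c \<in> graded_hom (ring_on (S_w c)) (UPR1 c) (UPR0 c)"
  using projective_resolution_UPR[OF c] by (simp_all add: projective_resolution_def acyclic_complex_def)

interpretation M2: fixed_point_map c \<phi>\<^sub>h 3 projector_coeffs "(3 * int c, 3 * int c + 2)" "UPR2 c" 3 "1\<^sub>m 3" "(2 * int c, 1)" "UPR1 c" U.d2_mat
proof
  show "U.d2_mat $$ (i, j) \<in> S_w c" if "i < 3" "j < 3" for i j
    using d2_entry_deg[OF c that] S_w_deg_subset[OF c] by blast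
  show "U.d2_mat *\<^sub>v m \<in> carrier (UPR1 c)" if "m \<in> carrier (UPR2 c)" for m
    using graded_hom_image(1)[OF UPR_hom(1) that] by (simp add: UPR_d2_eq[OF c])
qed (rule U.d2_mat_carrier)

interpretation M1: fixed_point_map c \<phi>\<^sub>h 3 "1\<^sub>m 3" "(2 * int c, 1)" "UPR1 c" 1 "1\<^sub>m 1" "(0, 0)" "UPR0 c" U.d1_mat
proof
  show "U.d1_mat $$ (i, j) \<in> S_w c" if "i < 1" "j < 3" for i j
    using d1_entry_deg[OF c that(2)] that(1) S_w_deg_subset[OF c] by auto
  show "U.d1_mat *\<^sub>v m \<in> carrier (UPR0 c)" if "m \<in> carrier (UPR1 c)" for m
    using graded_hom_image(1)[OF UPR_hom(2) that] by (simp add: UPR_d1_eq[OF c])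
qed (rule U.d1_mat_carrier)

lemma A0_M_k: "A0.M_k = gr_free UNIV B_deg [0]"
proof -
  have "A0.P_k = 1\<^sub>m 1" unfolding A0.P_k_def
    by (rule eq_matI) (auto simp: \<phi>.hom_one H.xy_const_simps)
  then show ?thesis unfolding A0.M_k_def gr_free_def by auto
qed

lemma A1_M_k: "A1.M_k = gr_free UNIV B_deg (replicate 3 (2 * int c))"
proof -
  have "A1.P_k = 1\<^sub>m 3" unfolding A1.P_k_def
    by (rule eq_matI) (auto simp: \<phi>.hom_one \<phi>.hom_zero H.xy_const_simps)
  then show ?thesis unfolding A1.M_k_def gr_free_def by auto
qed

lemma A2_P_k: "A2.P_k = H.projector"
proof (rule eq_matI)
  fix i j assume "i < dim_row H.projector" "j < dim_col H.projector"
  then have ij: "i < 3" "j < 3" by (simp_all add: H.projector_def)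
  have "U.d3_entry i \<in> R_w c" "U.splitting j \<in> R_w c"
    using d3_entry_deg[OF c ij(1)] R_w_deg_subset[OF c] U.splitting_in_R[OF ij(2)] by auto
  then have "\<phi>\<^sub>h ((if i = j then 1 else 0) - U.d3_entry i * U.splitting j) = (if i = j then 1 else 0) - H.d3_entry i * H.splitting j"
    using ring_closed_zero[OF \<phi>.closed] ring_closed_one[OF \<phi>.closed] ring_closed_mult[OF \<phi>.closed]
    by (simp add: \<phi>.hom_diff \<phi>.hom_mult \<phi>_splitting \<phi>_d3_entry \<phi>.hom_one \<phi>.hom_zero)
  moreover have "projector_coeffs $$ (i, j) = (if i = j then 1 else 0) - U.d3_entry i * U.splitting j"
    using ij by (simp add: projector_coeffs_def)
  ultimately show "A2.P_k $$ (i, j) = H.projector $$ (i, j)"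
    using ij A2.P(1) by (simp add: A2.P_k_def H.projector_def)
qed (use A2.P_k_carrier in \<open>simp_all add: H.projector_def\<close>)

lemma A2_M_k:
  "carrier A2.M_k = {v \<in> carrier_vec 3. H.sigma v = 0}"
  "deg_part A2.M_k d = {v \<in> carrier_vec 3. (\<forall>i<3. v $ i \<in> B_deg (d - 3 * int c)) \<and> H.sigma v = 0}"
  using H.sigma_zero_iff_projector_fixed[OF _ H.w_nonzero] by (auto simp: A2.M_k_simps A2_P_k)

text \<open>The kernel of \<open>\<sigma>\<close> is free as some entry of \<open>\<sigma>\<close> is a nonzero element of the field:
  the other two coordinates can be prescribed.\<close>

lemma graded_free_kernel_sigma: "graded_free UNIV B_deg A2.M_k"
proof -
  have "\<exists>i<3. H.splitting i \<noteq> 0"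
  proof (rule ccontr)
    assume "\<not> (\<exists>i<3. H.splitting i \<noteq> 0)"
    then have "(\<Sum>i<3. H.splitting i * H.d3_entry i) = 0" by (intro sum.neutral) auto
    then show False using H.sum_splitting_d3[OF H.w_nonzero] by simp
  qed
  then obtain i where i: "i < 3" "H.splitting i \<noteq> 0" by blast
  then have "i = 0 \<or> i = 1 \<or> i = 2" by auto
  then obtain j k where ijk: "{i, j, k} = {..<3}"
  proof (elim disjE)
    have three: "{..<3} = {0, 1, 2 :: nat}" by (auto simp: numeral_eq_Suc)
    show ?thesis if "i = 0" using that \<open>\<And>j k. {i, j, k} = {..<3} \<Longrightarrow> thesis\<close>[of 1 2] three by simp
    show ?thesis if "i = 1" using that \<open>\<And>j k. {i, j, k} = {..<3} \<Longrightarrow> thesis\<close>[of 0 2] three by (simp add: insert_commute)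
    show ?thesis if "i = 2" using that \<open>\<And>j k. {i, j, k} = {..<3} \<Longrightarrow> thesis\<close>[of 0 1] three by (simp add: insert_commute)
  qed
  have jk: "j < 3" "k < 3" using ijk by auto
  have "card {i, j, k} = 3" using ijk by simp
  then have dist: "i \<noteq> j" "i \<noteq> k" "j \<noteq> k" by (auto simp: card_insert_if split: if_splits)
  define a where "a = - H.splitting j / H.splitting i"
  define b where "b = - H.splitting k / H.splitting i"
  define Q where "Q = mat 3 2 (\<lambda>(l, m). xy_const (if l = i then (if m = 0 then a else b)
      else if l = (if m = 0 then j else k) then 1 else 0))"
  have Q: "Q \<in> carrier_mat 3 2" by (simp add: Q_def)
  have Q_mult: "(Q *\<^sub>v v) $ i = xy_const a * v $ 0 + xy_const b * v $ 1" "(Q *\<^sub>v v) $ j = v $ 0" "(Q *\<^sub>v v) $ k = v $ 1"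
    if v: "v \<in> carrier_vec 2" for v
  proof -
    have row: "(Q *\<^sub>v v) $ l = Q $$ (l, 0) * v $ 0 + Q $$ (l, 1) * v $ 1" if "l < 3" for l
      using that Q v by (auto simp: scalar_prod_def numeral_2_eq_2)
    have entries: "Q $$ (i, 0) = xy_const a" "Q $$ (i, 1) = xy_const b" "Q $$ (j, 0) = 1" "Q $$ (j, 1) = 0"
        "Q $$ (k, 0) = 0" "Q $$ (k, 1) = 1"
      using i jk dist by (simp_all add: Q_def H.xy_const_simps)
    show "(Q *\<^sub>v v) $ i = xy_const a * v $ 0 + xy_const b * v $ 1" unfolding row[OF i(1)] entries ..
    show "(Q *\<^sub>v v) $ j = v $ 0" "(Q *\<^sub>v v) $ k = v $ 1"
      unfolding row[OF jk(1)] row[OF jk(2)] entries by simp_all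
  qed
  have sigma: "H.sigma v = xy_const (H.splitting i) * (v $ i - (xy_const a * v $ j + xy_const b * v $ k))" for v
  proof -
    have ab: "xy_const (H.splitting i) * xy_const a = - xy_const (H.splitting j)"
        "xy_const (H.splitting i) * xy_const b = - xy_const (H.splitting k)"
      using i by (simp_all add: a_def b_def xy_const_def xy_monom_def mult_single single_uminus)
    have "xy_const (H.splitting i) * (v $ i - (xy_const a * v $ j + xy_const b * v $ k)) =
        xy_const (H.splitting i) * v $ i - ((xy_const (H.splitting i) * xy_const a) * v $ j + (xy_const (H.splitting i) * xy_const b) * v $ k)"
      by (simp only: right_diff_distrib distrib_left mult.assoc)
    then show ?thesis
      unfolding H.sigma_def sum_three[OF ijk] ab by simp
  qed
  have xi: "xy_const (H.splitting i) * p = 0 \<longleftrightarrow> p = 0" for p :: "'k bipoly"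
  proof
    assume "xy_const (H.splitting i) * p = 0"
    then have "H.splitting i * coef p e = 0" for e using coef_xy_const_mult[of "H.splitting i" p e] by simp
    then show "p = 0" using i by (intro poly_mapping_eqI) auto
  qed simp
  have sigma_zero: "H.sigma v = 0 \<longleftrightarrow> v $ i = xy_const a * v $ j + xy_const b * v $ k" for v
    unfolding sigma xi by simp
  have Q_hom: "(\<lambda>v. Q *\<^sub>v v) \<in> graded_hom (ring_on UNIV) (gr_free UNIV B_deg [3 * int c, 3 * int c])
      (gr_free UNIV B_deg (replicate 3 (3 * int c)))"
  proof (rule graded_hom_mult_mat_vec[OF ring_closed_UNIV B_deg_zero B_deg_add])
    fix l m g and p :: "'k bipoly" assume lm: "l < length (replicate 3 (3 * int c))" "m < length [3 * int c, 3 * int c]"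
      and p: "p \<in> B_deg (g - [3 * int c, 3 * int c] ! m)"
    have "m = 0 \<or> m = 1" using lm by auto
    then have "p \<in> B_deg (g - 3 * int c)" using p by auto
    moreover have "Q $$ (l, m) \<in> B_deg 0" using lm by (simp add: Q_def B_deg_xy_const)
    ultimately show "Q $$ (l, m) * p \<in> B_deg (g - replicate 3 (3 * int c) ! l)"
      using B_deg_mult[of "Q $$ (l, m)" 0] lm by fastforce
  qed (use Q in \<open>simp_all add: numeral_2_eq_2\<close>)
  have Q_M_k: "Q *\<^sub>v v \<in> carrier A2.M_k" if "v \<in> carrier_vec 2" for v
    using that Q Q_mult[OF that] by (simp add: A2_M_k sigma_zero del: index_mult_mat_vec)
  have hom: "(\<lambda>v. Q *\<^sub>v v) \<in> graded_hom (ring_on UNIV) (gr_free UNIV B_deg [3 * int c, 3 * int c]) A2.M_k"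
  proof (rule graded_hom_restrict[OF Q_hom])
    show "Q *\<^sub>v v \<in> carrier A2.M_k" if "v \<in> carrier (gr_free UNIV B_deg [3 * int c, 3 * int c])" for v
      using that Q_M_k by (simp add: gr_free_simps numeral_2_eq_2)
    show "Q *\<^sub>v v \<in> deg_part A2.M_k g" if "v \<in> deg_part (gr_free UNIV B_deg [3 * int c, 3 * int c]) g" for v g
      using graded_hom_image(2)[OF Q_hom that] Q_M_k[of v] that
      by (simp add: gr_free_simps A2_M_k numeral_2_eq_2 del: index_mult_mat_vec)
  qed (auto simp: A2.M_k_def gr_free_def)
  have inverse: "Q *\<^sub>v vec 2 (\<lambda>m. v $ (if m = 0 then j else k)) = v" if v: "v \<in> carrier A2.M_k" for v
  proof (rule eq_vecI)
    let ?u = "vec 2 (\<lambda>m. v $ (if m = 0 then j else k))"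
    fix l assume "l < dim_vec v"
    then have "l \<in> {i, j, k}" using v by (auto simp: ijk A2_M_k)
    then show "(Q *\<^sub>v ?u) $ l = v $ l"
      using Q_mult[of ?u] v by (auto simp: A2_M_k sigma_zero simp del: index_mult_mat_vec)
  qed (use v Q in \<open>auto simp: A2_M_k\<close>)
  let ?F = "gr_free UNIV B_deg [3 * int c, 3 * int c]"
  let ?u = "\<lambda>v :: 'k bipoly vec. vec 2 (\<lambda>m. v $ (if m = 0 then j else k))"
  have inj: "inj_on (\<lambda>v. Q *\<^sub>v v) (carrier ?F)"
  proof (rule inj_onI)
    fix u v assume uv: "u \<in> carrier ?F" "v \<in> carrier ?F" "Q *\<^sub>v u = Q *\<^sub>v v"
    then have carr: "u \<in> carrier_vec 2" "v \<in> carrier_vec 2" by (auto simp: gr_free_simps numeral_2_eq_2)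
    have "u $ 0 = v $ 0" "u $ 1 = v $ 1"
      unfolding Q_mult(2)[OF carr(1), symmetric] Q_mult(2)[OF carr(2), symmetric]
        Q_mult(3)[OF carr(1), symmetric] Q_mult(3)[OF carr(2), symmetric] uv(3) by (rule refl)+
    then show "u = v" using carr by (intro eq_vecI) (auto simp: less_2_cases_iff)
  qed
  have u_carrier: "?u v \<in> carrier ?F" for v by (simp add: gr_free_simps)
  have img: "(\<lambda>v. Q *\<^sub>v v) ` carrier ?F = carrier A2.M_k"
  proof (intro subset_antisym subsetI)
    fix v assume "v \<in> carrier A2.M_k"
    then show "v \<in> (\<lambda>v. Q *\<^sub>v v) ` carrier ?F"
      using inverse[of v] u_carrier[of v] by (intro image_eqI[of v _ "?u v"]) simp_all
  qed (use graded_hom_image(1)[OF hom] in blast)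
  have deg: "(\<lambda>v. Q *\<^sub>v v) ` deg_part ?F g = deg_part A2.M_k g" for g
  proof (intro subset_antisym subsetI)
    fix v assume v: "v \<in> deg_part A2.M_k g"
    then have "Q *\<^sub>v ?u v = v" using inverse[of v] A2.deg_part_M_k_subset by blast
    moreover have "?u v \<in> deg_part ?F g"
      using v jk by (auto simp: gr_free_simps A2_M_k numeral_2_eq_2 less_Suc_eq)
    ultimately show "v \<in> (\<lambda>v. Q *\<^sub>v v) ` deg_part ?F g" by (intro image_eqI[of v _ "?u v"]) simp_all
  qed (use graded_hom_image(2)[OF hom] in blast)
  have "graded_iso (ring_on UNIV) ?F A2.M_k (\<lambda>v. Q *\<^sub>v v)"
    using hom inj img deg by (simp add: graded_iso_def bij_betw_def)
  then show ?thesis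
    unfolding graded_free_def using module_vec_module_on[OF ring_closed_UNIV A2.vec_module_on_M_k] by blast
qed

lemma d2_mat_graded_hom: "(\<lambda>v. H.d2_mat *\<^sub>v v) \<in> graded_hom (ring_on UNIV) A2.M_k A1.M_k"
proof -
  have hom: "(\<lambda>v. H.d2_mat *\<^sub>v v) \<in> graded_hom (ring_on UNIV) (gr_free UNIV B_deg (replicate 3 (3 * int c))) A1.M_k"
    unfolding A1_M_k
  proof (rule graded_hom_mult_mat_vec[OF ring_closed_UNIV B_deg_zero B_deg_add])
    fix l m g and p :: "'k bipoly" assume lm: "l < length (replicate 3 (2 * int c))" "m < length (replicate 3 (3 * int c))"
      and p: "p \<in> B_deg (g - replicate 3 (3 * int c) ! m)"
    have "H.d2_mat $$ (l, m) \<in> B_deg (int c)"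
      using lm by (simp add: H.d2_mat_index B_deg_eq homogenize_homog)
    from B_deg_mult[OF this p] show "H.d2_mat $$ (l, m) * p \<in> B_deg (g - replicate 3 (2 * int c) ! l)"
      using lm by simp
  qed (use H.d2_mat_carrier in simp_all)
  show ?thesis
  proof (rule graded_hom_restrict[OF hom])
    show "H.d2_mat *\<^sub>v v \<in> carrier A1.M_k" if "v \<in> carrier A2.M_k" for v
      using that by (intro graded_hom_image(1)[OF hom]) (simp add: gr_free_simps A2_M_k)
    show "H.d2_mat *\<^sub>v v \<in> deg_part A1.M_k g" if "v \<in> deg_part A2.M_k g" for v g
      using that by (intro graded_hom_image(2)[OF hom]) (simp add: gr_free_simps A2_M_k)
  qed (auto simp: A2_M_k gr_free_simps A2.M_k_def gr_free_def)
qed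

text \<open>The specialized differentials have the kernel and the image of those of any given minimal
  resolution with the same first differential. Hence the augmentation and the minimality of the
  given resolution carry over.\<close>

lemma minimal_resolution_specialized:
  assumes res: "minimal_resolution (gr_free UNIV B_deg as) d2 (gr_free UNIV B_deg (replicate 3 (2 * int c))) d1
      (gr_free UNIV B_deg [0]) Q"
    and d1: "\<And>v. v \<in> carrier_vec 3 \<Longrightarrow> d1 v = H.d1_mat *\<^sub>v v"
  shows "minimal_resolution A2.M_k (\<lambda>v. H.d2_mat *\<^sub>v v) A1.M_k d1 A0.M_k Q"
proof -
  note parts = res[folded A1_M_k A0_M_k, unfolded minimal_resolution_def acyclic_complex_def]
  have d1_hom: "d1 \<in> graded_hom (ring_on UNIV) A1.M_k A0.M_k"
    using parts by (elim conjE)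
  have d2_img: "d2 ` carrier (gr_free UNIV B_deg as) = {v \<in> carrier A1.M_k. d1 v = \<zero>\<^bsub>A0.M_k\<^esub>}"
    using parts by (elim conjE)
  have d2_min: "d2 ` carrier (gr_free UNIV B_deg as) \<subseteq> ideal_times B_irrel A1.M_k"
    using parts by (elim conjE)
  have d1_min: "d1 ` carrier A1.M_k \<subseteq> ideal_times B_irrel A0.M_k"
    using parts by (elim conjE)
  have free1: "graded_free UNIV B_deg A1.M_k" using parts by (elim conjE)
  have free0: "graded_free UNIV B_deg A0.M_k" using parts by (elim conjE)
  have eps: "\<exists>\<epsilon>\<in>graded_hom (ring_on UNIV) A0.M_k Q. \<epsilon> ` carrier A0.M_k = carrier Q \<and>
      d1 ` carrier A1.M_k = {v \<in> carrier A0.M_k. \<epsilon> v = \<zero>\<^bsub>Q\<^esub>}"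
    using parts by (elim conjE)
  have kernel: "(\<lambda>v. H.d2_mat *\<^sub>v v) ` carrier A2.M_k = {v \<in> carrier A1.M_k. d1 v = \<zero>\<^bsub>A0.M_k\<^esub>}"
  proof (intro equalityI subsetI)
    fix v assume "v \<in> (\<lambda>v. H.d2_mat *\<^sub>v v) ` carrier A2.M_k"
    then obtain s where s: "s \<in> carrier A2.M_k" "v = H.d2_mat *\<^sub>v s" by blast
    then have "v \<in> carrier A1.M_k" using graded_hom_image(1)[OF d2_mat_graded_hom] by blast
    moreover have "d1 v = 0\<^sub>v 1"
      using s d1[of v] H.d1_d2_zero[of s] H.d2_mat_carrier by (simp add: A2_M_k)
    ultimately show "v \<in> {v \<in> carrier A1.M_k. d1 v = \<zero>\<^bsub>A0.M_k\<^esub>}" unfolding A0.M_k_simps(2) by blast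
  next
    fix v assume "v \<in> {v \<in> carrier A1.M_k. d1 v = \<zero>\<^bsub>A0.M_k\<^esub>}"
    then have "v \<in> carrier A1.M_k" "d1 v = 0\<^sub>v 1" unfolding A0.M_k_simps(2) by blast+
    then have "v \<in> carrier_vec 3" "H.d1_mat *\<^sub>v v = 0\<^sub>v 1" using d1[of v] by (auto simp: A1.M_k_simps)
    then obtain s where "s \<in> carrier_vec 3" "H.sigma s = 0" "H.d2_mat *\<^sub>v s = v"
      using H.d1_kernel_is_combination[of v] by auto
    then show "v \<in> (\<lambda>v. H.d2_mat *\<^sub>v v) ` carrier A2.M_k" by (auto simp: A2_M_k)
  qed
  have inj: "inj_on (\<lambda>v. H.d2_mat *\<^sub>v v) (carrier A2.M_k)"
  proof (rule inj_onI)
    fix u v assume uv: "u \<in> carrier A2.M_k" "v \<in> carrier A2.M_k" "H.d2_mat *\<^sub>v u = H.d2_mat *\<^sub>v v"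
    then have carr: "u \<in> carrier_vec 3" "v \<in> carrier_vec 3" by (auto simp: A2_M_k)
    have "H.d2_mat *\<^sub>v (u - v) = H.d2_mat *\<^sub>v u - H.d2_mat *\<^sub>v v"
      using carr H.d2_mat_carrier by (intro mult_minus_distrib_mat_vec) auto
    also have "\<dots> = 0\<^sub>v 3" using uv(3) carr H.d2_mat_carrier by simp
    finally have "u - v = 0\<^sub>v 3"
      using H.d2_injective_on_kernel_sigma[of "u - v"] carr uv H.sigma_minus[OF carr] by (simp add: A2_M_k)
    then show "u = v" using carr by (intro eq_vecI) (auto simp: vec_eq_iff)
  qed
  have min: "(\<lambda>v. H.d2_mat *\<^sub>v v) ` carrier A2.M_k \<subseteq> ideal_times B_irrel A1.M_k"
    unfolding kernel d2_img[symmetric] by (rule d2_min)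
  show ?thesis
    unfolding minimal_resolution_def acyclic_complex_def
    by (intro conjI graded_free_kernel_sigma d2_mat_graded_hom d1_hom kernel inj min d1_min free1 free0 eps)
qed

lemma minimal_resolution_base_change:
  assumes res: "minimal_resolution (gr_free UNIV B_deg as) d2 (gr_free UNIV B_deg (replicate 3 (2 * int c))) d1
      (gr_free UNIV B_deg [0]) Q"
    and d1: "\<And>v. v \<in> carrier_vec 3 \<Longrightarrow> d1 v = H.d1_mat *\<^sub>v v"
  shows "minimal_resolution (base_change c \<phi>\<^sub>h (UPR2 c)) (base_change_map c \<phi>\<^sub>h (UPR1 c) (UPR_d2 c))
    (base_change c \<phi>\<^sub>h (UPR1 c)) (base_change_map c \<phi>\<^sub>h (UPR0 c) (UPR_d1 c)) (base_change c \<phi>\<^sub>h (UPR0 c)) Q"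
  unfolding A2.M_tensor_def[symmetric] A1.M_tensor_def[symmetric] A0.M_tensor_def[symmetric]
proof (rule minimal_resolution_transport[OF minimal_resolution_specialized[OF res d1]
      A2.graded_iso_cls A1.graded_iso_cls A0.graded_iso_cls A2.module_M_tensor A1.module_M_tensor A0.module_M_tensor])
  show "base_change_map c \<phi>\<^sub>h (UPR1 c) (UPR_d2 c) (A2.cls v) = A1.cls (H.d2_mat *\<^sub>v v)" if "v \<in> carrier A2.M_k" for v
    using M2.base_change_map_cls[OF that] by (simp add: UPR_d2_fun[OF c] M2.D_k_def map_\<phi>_d2)
  show "base_change_map c \<phi>\<^sub>h (UPR0 c) (UPR_d1 c) (A1.cls v) = A0.cls (d1 v)" if "v \<in> carrier A1.M_k" for v
    using M1.base_change_map_cls[OF that] d1[of v] that by (simp add: UPR_d1_fun[OF c] M1.D_k_def map_\<phi>_d1 A1.M_k_simps)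
  show "A0.cls \<zero>\<^bsub>A0.M_k\<^esub> = \<zero>\<^bsub>A0.M_tensor\<^esub>" by (simp only: A0.M_tensor_simps A0.M_k_simps)
  show "deg_part A2.M_k g \<subseteq> carrier A2.M_k" for g by (rule A2.deg_part_M_k_subset)
  show "deg_part A1.M_k g \<subseteq> carrier A1.M_k" for g by (rule A1.deg_part_M_k_subset)
  show "deg_part A0.M_k g \<subseteq> carrier A0.M_k" for g by (rule A0.deg_part_M_k_subset)
qed

end

text \<open>The forms in the first differential of a resolution with the given Betti numbers have no
  syzygies of degree less than \<open>c\<close>, as the entries of the second differential have degree \<open>c\<close>.\<close>

lemma specialization_of_resolution:
  fixes d1 d2 :: "'k::field bipoly vec \<Rightarrow> 'k bipoly vec"
  assumes c: "c > 0" and acyc: "acyclic_complex (ring_on UNIV) (gr_free UNIV B_deg (replicate 2 (3 * int c))) d2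
      (gr_free UNIV B_deg (replicate 3 (2 * int c))) d1 (gr_free UNIV B_deg [0])"
  obtains h :: "zpoly \<Rightarrow> 'k" where "comm_ring_hom h" "h (w_Z c) \<noteq> 0"
    "\<And>v. v \<in> carrier_vec 3 \<Longrightarrow> d1 v = specialization.d1_mat h c *\<^sub>v v"
proof -
  let ?F2 = "gr_free UNIV B_deg (replicate 2 (3 * int c)) :: ('k bipoly, 'k bipoly vec, int) graded_module"
  let ?F1 = "gr_free UNIV B_deg (replicate 3 (2 * int c)) :: ('k bipoly, 'k bipoly vec, int) graded_module"
  let ?F0 = "gr_free UNIV B_deg [0] :: ('k bipoly, 'k bipoly vec, int) graded_module"
  have d2_hom: "d2 \<in> graded_hom (ring_on UNIV) ?F2 ?F1" and d1_hom: "d1 \<in> graded_hom (ring_on UNIV) ?F1 ?F0"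
    and exact: "d2 ` carrier ?F2 = {v \<in> carrier ?F1. d1 v = 0\<^sub>v 1}"
    using acyc by (simp_all add: acyclic_complex_def gr_free_simps)
  have one_deg: "1 \<in> B_deg 0" by (simp add: B_deg_def zero_prod_def)
  define G where "G l = d1 (unit_vec 3 l) $ 0" for l
  have G: "G l \<in> B_deg (int (2 * c))" if "l < 3" for l
  proof -
    have "unit_vec 3 l \<in> deg_part ?F1 (2 * int c)"
      using that one_deg by (auto simp: gr_free_simps unit_vec_def B_deg_zero)
    from graded_hom_image(2)[OF d1_hom this] show ?thesis by (simp add: gr_free_simps G_def)
  qed
  \<comment> \<open>The second index of a variable starts at \<open>1\<close>, that of the generators at \<open>0\<close>.\<close>
  define val where "val = (\<lambda>(i, j). coef (G (j - 1)) (i, 2 * c - i))"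
  interpret comm_ring_hom "zeval val" by (rule comm_ring_hom_zeval)
  interpret H: specialization "zeval val" c by unfold_locales (rule c)
  have form: "homogenize (2 * c) (H.form l) = G l" if "l < 3" for l
  proof -
    have "coeff (H.form l) i = coeff (slice (2 * c) (G l)) i" for i
      unfolding H.coeff_form zeval_zvar coeff_slice by (simp add: val_def)
    then have "H.form l = slice (2 * c) (G l)" by (rule poly_eqI)
    then show ?thesis using B_deg_eq_homogenize[OF G[OF that]] by simp
  qed
  have d1_lin: "\<And>u v. u \<in> carrier_vec 3 \<Longrightarrow> v \<in> carrier_vec 3 \<Longrightarrow> d1 (u + v) = d1 u + d1 v"
    "\<And>r v. v \<in> carrier_vec 3 \<Longrightarrow> d1 (r \<cdot>\<^sub>v v) = r \<cdot>\<^sub>v d1 v" "\<And>v. v \<in> carrier_vec 3 \<Longrightarrow> d1 v \<in> carrier_vec 1"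
    using d1_hom by (auto simp: graded_hom_def gr_free_simps)
  have d1: "d1 v = H.d1_mat *\<^sub>v v" if v: "v \<in> carrier_vec 3" for v
  proof -
    have "d1 v = d1 (v $ 0 \<cdot>\<^sub>v unit_vec 3 0 + (v $ 1 \<cdot>\<^sub>v unit_vec 3 1 + v $ 2 \<cdot>\<^sub>v unit_vec 3 2))"
      using vec_eq_combination_unit_vecs[OF v] by simp
    also have "\<dots> = v $ 0 \<cdot>\<^sub>v d1 (unit_vec 3 0) + (v $ 1 \<cdot>\<^sub>v d1 (unit_vec 3 1) + v $ 2 \<cdot>\<^sub>v d1 (unit_vec 3 2))"
      by (simp add: d1_lin)
    finally have "d1 v = v $ 0 \<cdot>\<^sub>v d1 (unit_vec 3 0) + (v $ 1 \<cdot>\<^sub>v d1 (unit_vec 3 1) + v $ 2 \<cdot>\<^sub>v d1 (unit_vec 3 2))" .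
    moreover have "dim_vec (d1 (unit_vec 3 l)) = 1" for l using d1_lin(3)[of "unit_vec 3 l"] by simp
    moreover have "H.d1_mat *\<^sub>v v = vec 1 (\<lambda>_. v $ 0 * G 0 + v $ 1 * G 1 + v $ 2 * G 2)"
      unfolding H.d1_mat_mult[OF v] sum_lessThan_3 by (simp add: form)
    ultimately show ?thesis by (intro eq_vecI) (auto simp: G_def add.assoc)
  qed
  have "H.w \<noteq> 0"
    unfolding H.w_nonzero_iff
  proof (intro allI impI)
    fix V l assume V: "\<forall>l<3. \<forall>k\<ge>c. coeff (V l) k = 0" "(\<Sum>l<3. V l * H.form l) = 0" and l: "l < (3::nat)"
    define v where "v = vec 3 (\<lambda>l. homogenize (c - 1) (V l))"
    have "(\<Sum>l<3. v $ l * homogenize (2 * c) (H.form l)) = homogenize (c - 1 + 2 * c) (\<Sum>l<3. V l * H.form l)"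
      unfolding homogenize_sum
    proof (intro sum.cong refl)
      fix l :: nat assume "l \<in> {..<3}"
      then show "v $ l * homogenize (2 * c) (H.form l) = homogenize (c - 1 + 2 * c) (V l * H.form l)"
        using V(1) by (simp add: v_def) (intro homogenize_mult; auto simp: H.coeff_form)
    qed
    then have "d1 v = 0\<^sub>v 1" using d1[of v] V(2) by (auto simp: v_def H.d1_mat_mult)
    then have "v \<in> d2 ` carrier ?F2" unfolding exact by (simp add: gr_free_simps v_def)
    then obtain s where s: "s \<in> carrier_vec 2" "v = d2 s" by (auto simp: gr_free_simps)
    have d2_lin: "\<And>u v. u \<in> carrier_vec 2 \<Longrightarrow> v \<in> carrier_vec 2 \<Longrightarrow> d2 (u + v) = d2 u + d2 v"
      "\<And>r v. v \<in> carrier_vec 2 \<Longrightarrow> d2 (r \<cdot>\<^sub>v v) = r \<cdot>\<^sub>v d2 v"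
      using d2_hom by (auto simp: graded_hom_def gr_free_simps)
    have d2_unit: "d2 (unit_vec 2 i) \<in> carrier_vec 3" "d2 (unit_vec 2 i) $ l \<in> B_deg (int c)" if "i < 2" for i
    proof -
      have "unit_vec 2 i \<in> deg_part ?F2 (3 * int c)"
        using that one_deg by (auto simp: gr_free_simps unit_vec_def B_deg_zero)
      from graded_hom_image(2)[OF d2_hom this] show "d2 (unit_vec 2 i) \<in> carrier_vec 3" "d2 (unit_vec 2 i) $ l \<in> B_deg (int c)"
        using l by (auto simp: gr_free_simps)
    qed
    have "v = d2 (s $ 0 \<cdot>\<^sub>v unit_vec 2 0 + s $ 1 \<cdot>\<^sub>v unit_vec 2 1)"
      using s vec_eq_combination_unit_vecs_2[OF s(1)] by simp
    also have "\<dots> = s $ 0 \<cdot>\<^sub>v d2 (unit_vec 2 0) + s $ 1 \<cdot>\<^sub>v d2 (unit_vec 2 1)"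
      by (simp add: d2_lin)
    finally have vl: "v $ l = s $ 0 * d2 (unit_vec 2 0) $ l + s $ 1 * d2 (unit_vec 2 1) $ l"
      using l d2_unit(1)[of 0] d2_unit(1)[of 1] by simp
    show "V l = 0"
    proof (rule poly_eqI)
      fix k
      show "coeff (V l) k = coeff 0 k"
      proof (cases "k < c")
        case True
        have "coef (v $ l) (k, c - 1 - k) = 0"
          using coef_mult_B_deg_zero[OF d2_unit(2)[of 0], of k "c - 1 - k"] coef_mult_B_deg_zero[OF d2_unit(2)[of 1], of k "c - 1 - k"] True c
          by (simp add: vl lookup_add)
        then show ?thesis using l True by (simp add: v_def coef_homogenize)
      qed (use V l in simp)
    qed
  qed
  then show thesis using that[OF comm_ring_hom_zeval _ d1] by (simp add: H.w_def)
qed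

theorem corollary5p46:
  fixes c :: nat
  assumes "c > 0"
  shows "projective_resolution (S_w c) (S_w_deg c) (UPR2 c) (UPR_d2 c) (UPR1 c) (UPR_d1 c) (UPR0 c) \<and>
    (\<forall>I :: 'k::field bipoly set.
       homogeneous_ideal I \<and> has_graded_betti (replicate 2 (3 * int c)) (replicate 3 (2 * int c)) I \<longrightarrow>
       (\<exists>\<phi> \<in> Ring.ring_hom (ring_on (R_w c)) (ring_on (UNIV :: 'k set)).
          minimal_resolution
            (base_change c \<phi> (UPR2 c)) (base_change_map c \<phi> (UPR1 c) (UPR_d2 c))
            (base_change c \<phi> (UPR1 c)) (base_change_map c \<phi> (UPR0 c) (UPR_d1 c))
            (base_change c \<phi> (UPR0 c)) (B_quot I)))"
proof (intro conjI allI impI)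
  show "projective_resolution (S_w c) (S_w_deg c) (UPR2 c) (UPR_d2 c) (UPR1 c) (UPR_d1 c) (UPR0 c)"
    by (rule projective_resolution_UPR[OF assms])
  fix I :: "'k bipoly set"
  assume "homogeneous_ideal I \<and> has_graded_betti (replicate 2 (3 * int c)) (replicate 3 (2 * int c)) I"
  then obtain d2 d1 where res: "minimal_resolution (gr_free UNIV B_deg (replicate 2 (3 * int c))) d2
      (gr_free UNIV B_deg (replicate 3 (2 * int c))) d1 (gr_free UNIV B_deg [0]) (B_quot I)"
    by (auto simp: has_graded_betti_def)
  then have acyc: "acyclic_complex (ring_on UNIV) (gr_free UNIV B_deg (replicate 2 (3 * int c))) d2
      (gr_free UNIV B_deg (replicate 3 (2 * int c))) d1 (gr_free UNIV B_deg [0])"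
    by (simp add: minimal_resolution_def)
  obtain h :: "zpoly \<Rightarrow> 'k" where h: "comm_ring_hom h" "h (w_Z c) \<noteq> 0"
    "\<And>v. v \<in> carrier_vec 3 \<Longrightarrow> d1 v = specialization.d1_mat h c *\<^sub>v v"
    using specialization_of_resolution[OF assms acyc] by blast
  show "\<exists>\<phi> \<in> Ring.ring_hom (ring_on (R_w c)) (ring_on (UNIV :: 'k set)).
          minimal_resolution
            (base_change c \<phi> (UPR2 c)) (base_change_map c \<phi> (UPR1 c) (UPR_d2 c))
            (base_change c \<phi> (UPR1 c)) (base_change_map c \<phi> (UPR0 c) (UPR_d1 c))
            (base_change c \<phi> (UPR0 c)) (B_quot I)"
    using minimal_resolution_base_change[OF h(1,2) assms res h(3)] fraction_value_ring_hom[OF h(1,2)] by blast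
qed

end
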